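(* Let $t\geq 1$ and $k\geq 1$ be integers, let $a_{1}\geq a_{2}\geq\cdots\geq a_{t}\geq 3$ be integers, and let $F=\left(\bigcup_{1\leq i\leq t}K_{1,a_{i}}\right)\cup P_{2k+2}$ (disjoint union). Then for all sufficiently large $n$ (i.e. for all $n\geq n_0$ for some $n_0$ depending only on $F$), each graph in $\mathrm{EX}(n,F)$ is (up to isomorphism) either a graph in $\mathrm{EX}\left(n,\bigcup_{1\leq i\leq t}K_{1,a_{i}}\right)$, or of the form $K_{t}\vee H_{n-t,k}$, where $H_{n-t,k}$ is a graph of order $n-t$ satisfying the following: (i) if $a_{t}\leq 2k$, then $H_{n-t,k}=K_{k}\vee\overline{K_{n-t-k}}$; (ii) if $a_{t}\geq 2k+1$, then $H_{n-t,k}\in \mathrm{EX}(n-t,P_{2k+2})$; additionally, when $n-t\equiv k$ or $k+1 \pmod{2k+1}$, either $H_{n-t,k}=K_{k}\vee\overline{K_{n-t-k}}$ or $H_{n-t,k}$ has maximum degree at most $a_{t}-1$.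
   Context: All graphs are finite, undirected and simple. $K_n$ and $P_n$ denote the complete graph and the path on $n$ vertices; $K_{1,d}$ is the star on $d+1$ vertices; $\overline{G}$ is the complement of $G$ (so $\overline{K_m}$ is the edgeless graph on $m$ vertices). $G_1\cup G_2$ denotes the disjoint union, and $G_1\vee G_2$ denotes the join, obtained from the disjoint union by connecting each vertex of $G_1$ to each vertex of $G_2$. A graph $G$ is $F$-free if it does not contain $F$ as a (not necessarily induced) subgraph. $\mathrm{EX}(n,F)$ denotes the set of $F$-free graphs of order $n$ with the maximum number of edges; its members are called the extremal graphs of order $n$ for $F$. *)

theory Defs
  imports Main "HOL-Number_Theory.Cong"
begin

datatype 'a graph = Graph (verts: "'a set") (edges: "'a set set")

definition simple_graph :: "'a graph \<Rightarrow> bool" where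
  "simple_graph G \<longleftrightarrow> finite (verts G) \<and> (\<forall>e\<in>edges G. e \<subseteq> verts G \<and> card e = 2)"

definition degree :: "'a graph \<Rightarrow> 'a \<Rightarrow> nat" where
  "degree G v = card {e \<in> edges G. v \<in> e}"

text \<open>Only meaningful for graphs with at least one vertex.\<close>

definition max_degree :: "'a graph \<Rightarrow> nat" where
  "max_degree G = Max (degree G ` verts G)"

definition graph_iso :: "'a graph \<Rightarrow> 'b graph \<Rightarrow> bool" (infix \<open>\<simeq>\<^sub>g\<close> 50) where
  "G \<simeq>\<^sub>g H \<longleftrightarrow> (\<exists>f. bij_betw f (verts G) (verts H) \<and> edges H = (`) f ` edges G)"

definition subgraph :: "'a graph \<Rightarrow> 'a graph \<Rightarrow> bool" where
  "subgraph H G \<longleftrightarrow> simple_graph H \<and> verts H \<subseteq> verts G \<and> edges H \<subseteq> edges G"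

definition graph_free :: "'b graph \<Rightarrow> 'a graph \<Rightarrow> bool" where
  "graph_free F G \<longleftrightarrow> \<not> (\<exists>H. subgraph H G \<and> F \<simeq>\<^sub>g H)"

text \<open>Every finite graph is isomorphic to one whose vertices are natural numbers. The vertex set
  may be any set of \<open>n\<close> naturals, so \<open>ex_graphs n F\<close> is closed under isomorphism of such graphs.\<close>

definition ex_graphs :: "nat \<Rightarrow> 'b graph \<Rightarrow> nat graph set" where
  "ex_graphs n F = {G. simple_graph G \<and> card (verts G) = n \<and> graph_free F G \<and>
     (\<forall>G' :: nat graph. simple_graph G' \<and> card (verts G') = n \<and> graph_free F G' \<longrightarrow>
        card (edges G') \<le> card (edges G))}"

definition complete_graph :: "nat \<Rightarrow> nat graph" where
  "complete_graph n = Graph {..<n} {{u, v} |u v. u < n \<and> v < n \<and> u \<noteq> v}"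

text \<open>The path on \<open>n\<close> vertices (not \<open>n\<close> edges).\<close>

definition path_graph :: "nat \<Rightarrow> nat graph" where
  "path_graph n = Graph {..<n} {{i, Suc i} |i. Suc i < n}"

text \<open>The star with \<open>d\<close> edges and centre \<open>0\<close>.\<close>

definition star_graph :: "nat \<Rightarrow> nat graph" where
  "star_graph d = Graph {..d} {{0, i} |i. 1 \<le> i \<and> i \<le> d}"

definition graph_compl :: "'a graph \<Rightarrow> 'a graph" where
  "graph_compl G = Graph (verts G)
     {{u, v} |u v. u \<in> verts G \<and> v \<in> verts G \<and> u \<noteq> v \<and> {u, v} \<notin> edges G}"

definition graph_union :: "'a graph \<Rightarrow> 'b graph \<Rightarrow> ('a + 'b) graph" (infixl \<open>\<union>\<^sub>g\<close> 65) where
  "G \<union>\<^sub>g H = Graph (verts G <+> verts H) ((`) Inl ` edges G \<union> (`) Inr ` edges H)"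

definition graph_join :: "'a graph \<Rightarrow> 'b graph \<Rightarrow> ('a + 'b) graph" (infixl \<open>\<or>\<^sub>g\<close> 65) where
  "G \<or>\<^sub>g H = Graph (verts (G \<union>\<^sub>g H))
     (edges (G \<union>\<^sub>g H) \<union> {{Inl u, Inr v} |u v. u \<in> verts G \<and> v \<in> verts H})"

definition graph_Union :: "'i set \<Rightarrow> ('i \<Rightarrow> 'a graph) \<Rightarrow> ('i \<times> 'a) graph" where
  "graph_Union I G = Graph (SIGMA i:I. verts (G i)) (\<Union>i\<in>I. (`) (Pair i) ` edges (G i))"

definition star_forest :: "nat \<Rightarrow> (nat \<Rightarrow> nat) \<Rightarrow> (nat \<times> nat) graph" where
  "star_forest t a = graph_Union {1..t} (\<lambda>i. star_graph (a i))"

end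

theory Submission
  imports Defs
begin

text \<open>Let \<open>G\<close> be extremal for \<open>F\<close> and suppose that it contains the star forest. Deleting a copy of the
  star forest leaves a graph without \<open>P\<^bsub>2k+2\<^esub>\<close>, which has at most \<open>k n\<close> edges, whereas \<open>G\<close> has at least
  as many edges as the join of \<open>K\<^bsub>t+k\<^esub>\<close> and an edgeless graph. So \<open>G\<close> has a set \<open>T\<close> of \<open>t\<close> vertices of large
  degree. The stars can be placed greedily at the vertices of \<open>T\<close>, so \<open>H = G - T\<close> contains no \<open>P\<^bsub>2k+2\<^esub>\<close>.

  If \<open>a\<^sub>t \<ge> 2k+1\<close>, the join of \<open>K\<^sub>t\<close> with a disjoint union of copies of \<open>K\<^bsub>2k+1\<^esub>\<close> and one smaller clique is
  \<open>F\<close>-free, which forces \<open>T\<close> to be joined to everything and \<open>H\<close> to be extremal for \<open>P\<^bsub>2k+2\<^esub>\<close>. In the remaining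
  cases the deficit \<open>k |H| - e(H)\<close> is at most \<open>k (k+1) / 2\<close>. A component \<open>K\<^bsub>2k+1\<^esub>\<close> of \<open>H\<close> with a neighbour in \<open>T\<close>
  yields the path, and a vertex of degree at least \<open>a\<^sub>t\<close> in another component yields the smallest star,
  so these cannot coexist; counting deficits over components, \<open>H\<close> is connected and is \<open>K\<^sub>k\<close> joined to
  an edgeless graph.

  The deficit of a connected graph is bounded below by Kopylov's method: an edge-maximal connected
  graph without \<open>P\<^bsub>2k+2\<^esub>\<close> either is \<open>k\<close>-degenerate or has a clique as its \<open>(k+1)\<close>-core.\<close>

section \<open>Edge sets, paths and cuts\<close>

text \<open>All edge bounds are doubled, and a graph with e edges on c vertices is measured by its
  deficit 2kc - 2e. Disjoint copies of K_{2k+1} have deficit 0; a further clique on r vertices adds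
  r(2k+1-r); K_k joined to an edgeless graph has k(k+1), whatever its order. Since r(2k+1-r) is at
  most k(k+1), with equality only for r = k and r = k+1, the join ties with the cliques exactly at
  these residues, and this is the origin of the congruence in the theorem. The obstacle is that for
  a_t \<le> 2k counting alone cannot exclude copies of K_{2k+1} in H: they are cheaper than the
  join, but the lower bound on e(G) comes from the join. They are excluded because a hub attached to
  such a copy serves the path. Then only t - 1 hubs are left for stars and the smallest star has to
  be found inside H, where a second copy of K_{2k+1} provides it.\<close>

definition sgr :: "'a set \<Rightarrow> 'a set set \<Rightarrow> bool" where
  "sgr V E \<longleftrightarrow> finite V \<and> (\<forall>e\<in>E. e \<subseteq> V \<and> card e = 2)"

definition ind :: "'a set set \<Rightarrow> 'a set \<Rightarrow> 'a set set" where
  "ind E W = {e \<in> E. e \<subseteq> W}"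

definition nb :: "'a set set \<Rightarrow> 'a set \<Rightarrow> 'a \<Rightarrow> 'a set" where
  "nb E W v = {u \<in> W. {v, u} \<in> E}"

text \<open>The list is not confined to a vertex set: as soon as it has two entries its edges
  confine it, whereas \<open>[x]\<close> is a path for every \<open>x\<close> of the type. Hence the
  side conditions \<open>2 \<le> length xs\<close> below.\<close>

definition gpath :: "'a set set \<Rightarrow> 'a list \<Rightarrow> bool" where
  "gpath E xs \<longleftrightarrow> distinct xs \<and> successively (\<lambda>u v. {u, v} \<in> E) xs"

definition pfree :: "'a set set \<Rightarrow> nat \<Rightarrow> bool" where
  "pfree E l \<longleftrightarrow> (\<forall>xs. gpath E xs \<longrightarrow> length xs < l)"

abbreviation clique :: "'a set set \<Rightarrow> 'a set \<Rightarrow> bool" where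
  "clique E Z \<equiv> \<forall>x\<in>Z. \<forall>y\<in>Z. x \<noteq> y \<longrightarrow> {x, y} \<in> E"

lemma simple_graph_iff_sgr: "simple_graph G \<longleftrightarrow> sgr (verts G) (edges G)"
  by (simp add: simple_graph_def sgr_def)

lemma sgr_finite_verts: "sgr V E \<Longrightarrow> finite V"
  by (simp add: sgr_def)

lemma sgr_finite_edges: "sgr V E \<Longrightarrow> finite E"
proof (rule finite_subset[of E "Pow V"])
qed (auto simp: sgr_def)

lemma sgr_edge:
  assumes "sgr V E" "{u, v} \<in> E"
  shows "u \<in> V" "v \<in> V" "u \<noteq> v"
  using assms by (auto simp: sgr_def)

lemma sgr_edgeE:
  assumes "sgr V E" "e \<in> E"
  obtains u v where "e = {u, v}" "u \<noteq> v" "u \<in> V" "v \<in> V"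
proof -
  have "card e = 2" "e \<subseteq> V" using assms by (auto simp: sgr_def)
  then show ?thesis using that by (auto simp: card_2_iff)
qed

lemma ind_ind: "W \<subseteq> V \<Longrightarrow> ind (ind E V) W = ind E W"
  by (auto simp: ind_def)

lemma ind_self: "sgr V E \<Longrightarrow> ind E V = E"
  by (auto simp: ind_def sgr_def)

lemma ind_empty: "sgr V E \<Longrightarrow> ind E {} = {}"
  by (auto simp: ind_def sgr_def)

lemma pair_in_ind: "{u, v} \<in> ind E W \<longleftrightarrow> {u, v} \<in> E \<and> u \<in> W \<and> v \<in> W"
  by (auto simp: ind_def)

lemma sgr_ind: "sgr V E \<Longrightarrow> W \<subseteq> V \<Longrightarrow> sgr W (ind E W)"
  using finite_subset by (auto simp: ind_def sgr_def)

lemma nb_subset: "nb E W v \<subseteq> W"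
  by (auto simp: nb_def)

lemma nb_mono: "W \<subseteq> W' \<Longrightarrow> nb E W v \<subseteq> nb E W' v"
  by (auto simp: nb_def)

lemma finite_nb [simp]: "finite W \<Longrightarrow> finite (nb E W v)"
  by (auto simp: nb_def)

lemma nb_self: "sgr V E \<Longrightarrow> v \<notin> nb E W v"
  using sgr_edge(3)[of V E v v] by (auto simp: nb_def)

lemma card_ind_insert:
  assumes "sgr V E" "finite W" "v \<notin> W"
  shows "card (ind E (insert v W)) = card (ind E W) + card (nb E W v)"
proof -
  have "ind E (insert v W) = ind E W \<union> (\<lambda>u. {v, u}) ` nb E W v"
  proof (intro set_eqI iffI)
    fix e assume e: "e \<in> ind E (insert v W)"
    then obtain a b where ab: "e = {a, b}" "a \<noteq> b"
      using assms(1) by (auto simp: ind_def elim: sgr_edgeE)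
    then show "e \<in> ind E W \<union> (\<lambda>u. {v, u}) ` nb E W v"
      using e by (auto simp: ind_def nb_def insert_commute)
  qed (auto simp: ind_def nb_def)
  moreover have "ind E W \<inter> (\<lambda>u. {v, u}) ` nb E W v = {}"
    using assms(3) by (auto simp: ind_def)
  moreover have "inj_on (\<lambda>u. {v, u}) (nb E W v)"
    by (auto simp: inj_on_def doubleton_eq_iff)
  moreover have "finite (ind E W)"
    using sgr_finite_edges[OF assms(1)] by (auto simp: ind_def)
  ultimately show ?thesis
    using assms(2) by (simp add: card_Un_disjoint card_image)
qed

lemma card_ind_remove:
  assumes "sgr V E" "finite W" "v \<in> W"
  shows "card (ind E W) = card (ind E (W - {v})) + card (nb E W v)"
proof -
  have "nb E W v = nb E (W - {v}) v"
    using nb_self[OF assms(1), of v W] by (auto simp: nb_def)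
  moreover have "insert v (W - {v}) = W" using assms(3) by auto
  ultimately show ?thesis
    using card_ind_insert[OF assms(1), of "W - {v}" v] assms(2) by simp
qed

lemma card_ind_le:
  assumes "sgr V E" "finite W"
  shows "2 * card (ind E W) \<le> card W * (card W - 1)"
proof -
  have "ind E W \<subseteq> {e. e \<subseteq> W \<and> card e = 2}"
    using assms(1) by (auto simp: ind_def sgr_def)
  then have "card (ind E W) \<le> card W choose 2"
    using card_mono[of "{e. e \<subseteq> W \<and> card e = 2}" "ind E W"] n_subsets[OF assms(2), of 2] assms(2) by simp
  then have "2 * card (ind E W) \<le> 2 * (card W * (card W - 1) div 2)"
    by (simp add: choose_two)
  then show ?thesis by (rule order_trans) simp
qed

lemma card_ind_Un_separated:
  assumes "sgr V E" "finite A" "finite B" "A \<inter> B = {}"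
    and "\<And>u v. u \<in> A \<Longrightarrow> v \<in> B \<Longrightarrow> {u, v} \<notin> E"
  shows "card (ind E (A \<union> B)) = card (ind E A) + card (ind E B)"
proof -
  have "ind E (A \<union> B) = ind E A \<union> ind E B"
  proof (intro set_eqI iffI)
    fix e assume e: "e \<in> ind E (A \<union> B)"
    then obtain a b where ab: "e = {a, b}" "a \<noteq> b"
      using assms(1) by (auto simp: ind_def elim: sgr_edgeE)
    then show "e \<in> ind E A \<union> ind E B"
      using e assms(5)[of a b] assms(5)[of b a] by (auto simp: ind_def insert_commute)
  qed (auto simp: ind_def)
  moreover have "ind E A \<inter> ind E B = {}"
  proof (rule ccontr)
    assume "ind E A \<inter> ind E B \<noteq> {}"
    then obtain e where e: "e \<in> E" "e \<subseteq> A" "e \<subseteq> B" by (auto simp: ind_def)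
    then have "e \<subseteq> {}" using assms(4) by blast
    then show False using e(1) assms(1) by (auto simp: sgr_def)
  qed
  ultimately show ?thesis
    using sgr_finite_edges[OF assms(1)] by (simp add: card_Un_disjoint ind_def)
qed

section \<open>Paths as lists of vertices\<close>

lemma gpath_Nil [simp]: "gpath E []"
  and gpath_single [simp]: "gpath E [x]"
  by (auto simp: gpath_def)

lemma gpath_Cons:
  "gpath E (x # xs) \<longleftrightarrow> x \<notin> set xs \<and> gpath E xs \<and> (xs = [] \<or> {x, hd xs} \<in> E)"
  by (auto simp: gpath_def successively_Cons)

lemma gpath_append:
  "gpath E (xs @ ys) \<longleftrightarrow> gpath E xs \<and> gpath E ys \<and> set xs \<inter> set ys = {} \<and>
     (xs = [] \<or> ys = [] \<or> {last xs, hd ys} \<in> E)"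
  by (auto simp: gpath_def successively_append_iff)

lemma gpath_rev [simp]: "gpath E (rev xs) \<longleftrightarrow> gpath E xs"
  by (simp add: gpath_def insert_commute)

lemma gpath_take: "gpath E xs \<Longrightarrow> gpath E (take i xs)"
  and gpath_drop: "gpath E xs \<Longrightarrow> gpath E (drop i xs)"
  using gpath_append[of E "take i xs" "drop i xs"] by auto

lemma gpath_mono: "gpath E xs \<Longrightarrow> E \<subseteq> E' \<Longrightarrow> gpath E' xs"
  unfolding gpath_def by (blast intro: successively_mono)

lemma gpath_distinct: "gpath E xs \<Longrightarrow> distinct xs"
  by (simp add: gpath_def)

lemma gpath_edge: "gpath E xs \<Longrightarrow> Suc i < length xs \<Longrightarrow> {xs ! i, xs ! Suc i} \<in> E"
  by (simp add: gpath_def successively_conv_nth)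

lemma gpath_in_edge:
  assumes "gpath E xs" "2 \<le> length xs" "x \<in> set xs"
  shows "\<exists>y\<in>set xs. {x, y} \<in> E"
proof -
  obtain i where i: "i < length xs" "x = xs ! i"
    using assms(3) by (auto simp: in_set_conv_nth)
  show ?thesis
  proof (cases "Suc i < length xs")
    case True
    then show ?thesis using gpath_edge[OF assms(1)] i by (metis nth_mem)
  next
    case False
    then have "{xs ! (i - 1), xs ! i} \<in> E" "i - 1 < length xs"
      using gpath_edge[OF assms(1), of "i - 1"] i assms(2) by auto
    then show ?thesis using i by (metis insert_commute nth_mem)
  qed
qed

lemma gpath_subset:
  assumes "sgr V E" "gpath E xs" "2 \<le> length xs"
  shows "set xs \<subseteq> V"
  using gpath_in_edge[OF assms(2,3)] sgr_edge(1)[OF assms(1)] by blast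

lemma gpath_ind_iff:
  assumes "2 \<le> length xs"
  shows "gpath (ind E W) xs \<longleftrightarrow> gpath E xs \<and> set xs \<subseteq> W"
proof
  assume p: "gpath (ind E W) xs"
  then have "gpath E xs" by (rule gpath_mono) (auto simp: ind_def)
  moreover have "set xs \<subseteq> W"
    using gpath_in_edge[OF p assms] by (auto simp: ind_def)
  ultimately show "gpath E xs \<and> set xs \<subseteq> W" ..
next
  assume "gpath E xs \<and> set xs \<subseteq> W"
  then show "gpath (ind E W) xs"
    by (auto simp: gpath_def successively_conv_nth pair_in_ind)
qed

lemma not_pfreeE:
  assumes "\<not> pfree E l"
  obtains xs where "gpath E xs" "length xs = l"
proof -
  obtain ys where "gpath E ys" "l \<le> length ys"
    using assms by (auto simp: pfree_def not_less)
  then show ?thesis using that[of "take l ys"] by (simp add: gpath_take)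
qed

lemma pfreeD: "pfree E l \<Longrightarrow> gpath E xs \<Longrightarrow> length xs < l"
  by (simp add: pfree_def)

lemma pfree_subset: "pfree E l \<Longrightarrow> E' \<subseteq> E \<Longrightarrow> pfree E' l"
  unfolding pfree_def by (blast intro: gpath_mono)

lemma ind_subset: "ind E W \<subseteq> E"
  by (auto simp: ind_def)

section \<open>Connectivity through cuts\<close>

text \<open>Phrased by cuts so that its negation directly gives two parts without edges between
  them, and so that adding edges preserves it. The empty set counts as connected.\<close>

definition conn :: "'a set set \<Rightarrow> 'a set \<Rightarrow> bool" where
  "conn E V \<longleftrightarrow> (\<forall>A \<subseteq> V. A \<noteq> {} \<longrightarrow> A \<noteq> V \<longrightarrow> (\<exists>u\<in>A. \<exists>v\<in>V - A. {u, v} \<in> E))"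

lemma conn_mono: "conn E V \<Longrightarrow> E \<subseteq> E' \<Longrightarrow> conn E' V"
  unfolding conn_def by blast

lemma conn_ind: "conn (ind E V) V \<longleftrightarrow> conn E V"
  unfolding conn_def by (simp add: pair_in_ind) blast

text \<open>The set \<open>R\<close> of vertices of \<open>V\<close> reached from \<open>A\<close>
  by a path that never returns to \<open>A\<close> has no edge leaving it, so it is all of
  \<open>V\<close>. A path to a point of \<open>B\<close> is then cut at its first vertex in
  \<open>B\<close>.\<close>

lemma conn_link:
  assumes "conn E V" "A \<subseteq> V" "B \<subseteq> V" "A \<noteq> {}" "B \<noteq> {}" "A \<inter> B = {}"
  obtains u ms v where "u \<in> A" "v \<in> B" "gpath E (u # ms @ [v])" "set ms \<inter> (A \<union> B) = {}"
proof -
  define R where "R = {v \<in> V. \<exists>us. gpath E (us @ [v]) \<and> hd (us @ [v]) \<in> A \<and> set (tl (us @ [v])) \<inter> A = {} \<and> set us \<subseteq> V}"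
  have AR: "A \<subseteq> R"
    using assms(2) by (auto simp: R_def intro!: exI[of _ "[]"])
  have "R = V"
  proof (rule ccontr)
    assume "R \<noteq> V"
    moreover have "R \<subseteq> V" "R \<noteq> {}" using AR assms(4) by (auto simp: R_def)
    ultimately obtain u v where uv: "u \<in> R" "v \<in> V - R" "{u, v} \<in> E"
      using assms(1) unfolding conn_def by metis
    then obtain us where us: "gpath E (us @ [u])" "hd (us @ [u]) \<in> A"
      "set (tl (us @ [u])) \<inter> A = {}" "set us \<subseteq> V"
      by (auto simp: R_def)
    have vA: "v \<notin> A" using uv AR by auto
    show False
    proof (cases "v \<in> set (us @ [u])")
      case False
      then have "gpath E ((us @ [u]) @ [v])" using us uv by (auto simp: gpath_append gpath_Cons)
      moreover have "hd ((us @ [u]) @ [v]) \<in> A" using us by (cases us) auto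
      moreover have "set (tl ((us @ [u]) @ [v])) \<inter> A = {}" using us vA by (cases us) auto
      moreover have "set (us @ [u]) \<subseteq> V" using us uv by (auto simp: R_def)
      ultimately have "v \<in> R" using uv unfolding R_def by blast
      then show False using uv by auto
    next
      case True
      then have "v \<in> set us" using uv by (cases "v = u") auto
      then obtain ys zs where ys: "us = ys @ v # zs" by (meson split_list)
      have "gpath E (ys @ [v])" using us(1) unfolding ys by (auto simp: gpath_append gpath_Cons)
      moreover have "hd (ys @ [v]) \<in> A" using us(2) unfolding ys by (cases ys) auto
      moreover have "set (tl (ys @ [v])) \<inter> A = {}" using us(3) unfolding ys by (cases ys) auto
      moreover have "set ys \<subseteq> V" using us(4) ys by auto
      ultimately have "v \<in> R" using uv unfolding R_def by blast
      then show False using uv by auto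
    qed
  qed
  then obtain b where "b \<in> B" "b \<in> R" using assms(3,5) by blast
  then obtain us where b: "b \<in> B" "gpath E (us @ [b])" "hd (us @ [b]) \<in> A"
    "set (tl (us @ [b])) \<inter> A = {}"
    unfolding R_def by blast
  then have "us \<noteq> []" using assms(6) by auto
  then obtain u ms where us: "us = u # ms" by (cases us) auto
  have ex: "\<exists>v\<in>set (ms @ [b]). v \<in> B" using b by auto
  obtain ys v zs where yz: "ms @ [b] = ys @ v # zs" "v \<in> B" "\<forall>y\<in>set ys. y \<notin> B"
    using split_list_first_prop[OF ex] by blast
  have "gpath E ((u # ys @ [v]) @ zs)" using b(2) us yz(1) by simp
  then have "gpath E (u # ys @ [v])" unfolding gpath_append by blast
  moreover have "u \<in> A" using b us by simp
  moreover have "set ys \<inter> A = {}"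
  proof -
    have "set (ys @ v # zs) \<inter> A = {}" using b(4) us yz(1) by simp
    then show ?thesis by auto
  qed
  ultimately show ?thesis using that[of u v ys] yz by auto
qed

section \<open>Disjoint paths in graphs without long paths\<close>

text \<open>Among all positions \<open>i < j\<close> with a member of \<open>Y\<close> at
  \<open>i\<close> and a member of \<open>X\<close> at \<open>j\<close>, take a pair at least
  distance. The open segment between them misses \<open>X\<close> and \<open>Y\<close>, and skipping
  it closes a cycle: from the start to \<open>i\<close>, over to the end, back to \<open>j\<close>,
  over to the start. The adjacency is an arbitrary symmetric relation because an apex will be added
  to the graph.\<close>

lemma crossing_cycle:
  assumes dist: "distinct ps" and succ: "successively R ps" and sym: "\<And>u v. R u v \<Longrightarrow> R v u"
    and X: "X \<subseteq> set ps" "hd ps \<notin> X" "\<And>z. z \<in> X \<Longrightarrow> R (hd ps) z"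
    and Y: "Y \<subseteq> set ps" "last ps \<notin> Y" "\<And>z. z \<in> Y \<Longrightarrow> R (last ps) z"
    and ij: "i0 < j0" "j0 < length ps" "ps ! i0 \<in> Y" "ps ! j0 \<in> X"
  obtains cs where "distinct cs" "successively R cs" "cs \<noteq> []" "R (last cs) (hd cs)"
    "set cs \<subseteq> set ps" "X \<union> Y \<subseteq> set cs" "length cs = length ps \<or> card X + card Y \<le> length cs"
proof -
  let ?n = "length ps"
  define P where "P d \<longleftrightarrow> (\<exists>i j. i < j \<and> j < ?n \<and> ps ! i \<in> Y \<and> ps ! j \<in> X \<and> j - i = d)" for d
  have "P (j0 - i0)" using ij by (auto simp: P_def)
  then obtain d where d: "P d" "\<And>d'. P d' \<Longrightarrow> d \<le> d'"
    using LeastI[of P] Least_le[of P] by blast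
  then obtain i j where i: "i < j" "j < ?n" "ps ! i \<in> Y" "ps ! j \<in> X" "j - i = d"
    by (auto simp: P_def)
  have min: "j - i \<le> j' - i'" if "i' < j'" "j' < ?n" "ps ! i' \<in> Y" "ps ! j' \<in> X" for i' j'
    using d(2)[of "j' - i'"] that i(5) by (auto simp: P_def)
  have gap: "ps ! m \<notin> X \<union> Y" if "i < m" "m < j" for m
    using min[of i m] min[of m j] that i by force
  have ne: "ps \<noteq> []" using i by auto
  define cs where "cs = take (Suc i) ps @ rev (drop j ps)"
  have last_take: "last (take (Suc i) ps) = ps ! i"
    using i by (simp add: take_Suc_conv_app_nth)
  have hd_drop: "hd (drop j ps) = ps ! j"
    using i by (simp add: hd_drop_conv_nth)
  have sp: "successively R (take (Suc i) ps)" "successively R (drop j ps)"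
    using succ successively_append_iff[of R "take (Suc i) ps" "drop (Suc i) ps"]
      successively_append_iff[of R "take j ps" "drop j ps"] by auto
  have "distinct cs"
    unfolding cs_def using dist i set_take_disj_set_drop_if_distinct[of ps "Suc i" j] by auto
  moreover have "successively R cs"
    unfolding cs_def successively_append_iff
  proof (intro conjI)
    show "successively R (rev (drop j ps))"
      unfolding successively_rev by (rule successively_mono[OF sp(2)]) (auto intro: sym)
    have "hd (rev (drop j ps)) = last ps" using i by (simp add: hd_rev)
    then show "take (Suc i) ps = [] \<or> rev (drop j ps) = [] \<or> R (last (take (Suc i) ps)) (hd (rev (drop j ps)))"
      using Y(3)[OF i(3)] sym last_take by auto
  qed (rule sp)
  moreover have "cs \<noteq> []" using ne by (auto simp: cs_def)
  moreover have "R (last cs) (hd cs)"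
  proof -
    have "last cs = ps ! j" using i hd_drop by (simp add: cs_def last_rev)
    moreover have "hd cs = hd ps" using ne by (simp add: cs_def hd_append)
    ultimately show ?thesis using X(3)[OF i(4)] sym by simp
  qed
  moreover have "set cs \<subseteq> set ps"
    unfolding cs_def using set_take_subset set_drop_subset by fastforce
  moreover have "X \<union> Y \<subseteq> set cs"
  proof
    fix z assume z: "z \<in> X \<union> Y"
    then obtain m where m: "m < ?n" "z = ps ! m"
      using X(1) Y(1) by (metis UnE in_set_conv_nth subsetD)
    then have "m \<le> i \<or> j \<le> m" using gap[of m] z by (metis not_le_imp_less)
    then have "z \<in> set (take (Suc i) ps) \<or> z \<in> set (drop j ps)"
    proof
      assume "m \<le> i"
      then have "take (Suc i) ps ! m = z" "m < length (take (Suc i) ps)" using m i by auto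
      then show ?thesis by (metis nth_mem)
    next
      assume "j \<le> m"
      then have "drop j ps ! (m - j) = z" "m - j < length (drop j ps)" using m i by auto
      then show ?thesis by (metis nth_mem)
    qed
    then show "z \<in> set cs" by (auto simp: cs_def)
  qed
  moreover have "length cs = ?n \<or> card X + card Y \<le> length cs"
  proof (cases "j = Suc i")
    case True
    then show ?thesis using i(1,2) by (auto simp: cs_def)
  next
    case False
    define IX where "IX = {m. m < ?n \<and> ps ! m \<in> X}"
    define IY where "IY = {m. m < ?n \<and> ps ! m \<in> Y}"
    have fin: "finite IX" "finite IY" by (auto simp: IX_def IY_def)
    have inj: "inj_on ((!) ps) IX" "inj_on ((!) ps) IY"
      using dist by (auto simp: inj_on_def IX_def IY_def nth_eq_iff_index_eq)
    have "(!) ps ` IX = X" "(!) ps ` IY = Y"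
      using X(1) Y(1) by (auto simp: IX_def IY_def in_set_conv_nth image_iff subset_iff)+
    then have cards: "card X = card IX" "card Y = card IY"
      using inj by (auto dest: card_image)
    have jX: "j \<in> IX" using i by (simp add: IX_def)
    have zero: "0 \<notin> IX" using X(2) ne by (auto simp: IX_def hd_conv_nth)
    have lastY: "?n - 1 \<notin> IY" using Y(2) ne by (auto simp: IY_def last_conv_nth)
    \<comment> \<open>The members of \<open>X\<close> are moved down one position, as in Ore's
      argument. A common index with \<open>IY\<close> would be a pair at distance 1, closer than
      \<open>i\<close> and \<open>j\<close>. The index \<open>j\<close> is left out because its
      shift falls into the skipped segment.\<close>
    define IX' where "IX' = (\<lambda>m. m - 1) ` (IX - {j})"
    have "inj_on (\<lambda>m. m - 1) (IX - {j})"
      using zero by (auto simp: inj_on_def) (metis Suc_pred neq0_conv)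
    then have cX': "card IX' = card IX - 1"
      unfolding IX'_def using jX by (simp add: card_image)
    have "IX' \<inter> IY = {}"
    proof (rule ccontr)
      assume "IX' \<inter> IY \<noteq> {}"
      then obtain m where m: "m \<in> IX" "m \<noteq> j" "m - 1 \<in> IY" by (auto simp: IX'_def)
      then have "0 < m" using zero by (cases m) auto
      then have "j - i \<le> m - (m - 1)" using m by (intro min) (auto simp: IX_def IY_def)
      then show False using False i by auto
    qed
    moreover have "IX' \<union> IY \<subseteq> {..i} \<union> {j..<?n - 1}"
    proof
      fix m assume "m \<in> IX' \<union> IY"
      then show "m \<in> {..i} \<union> {j..<?n - 1}"
      proof
        assume "m \<in> IX'"
        then obtain l where l: "l \<in> IX" "l \<noteq> j" "m = l - 1" by (auto simp: IX'_def)
        then have "l \<le> i \<or> j < l" using gap[of l] by (auto simp: IX_def) (metis linorder_neqE_nat not_less)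
        then show ?thesis using l by (auto simp: IX_def)
      next
        assume m: "m \<in> IY"
        then have "m \<le> i \<or> j \<le> m" "m < ?n" using gap[of m] by (auto simp: IY_def) (metis not_le_imp_less)
        moreover have "m \<noteq> ?n - 1" using m lastY by auto
        ultimately show ?thesis by auto
      qed
    qed
    ultimately have "card IX' + card IY \<le> card ({..i} \<union> {j..<?n - 1})"
      using fin by (subst card_Un_disjoint[symmetric]) (auto simp: IX'_def intro!: card_mono)
    also have "\<dots> \<le> Suc i + (?n - 1 - j)"
      by (rule order_trans[OF card_Un_le]) simp
    finally have "card IX' + card IY \<le> Suc i + (?n - 1 - j)" .
    moreover have "0 < card IX" using jX fin by (auto simp: card_gt_0_iff)
    moreover have "length cs = Suc i + (?n - j)" using i by (simp add: cs_def)
    ultimately show ?thesis using cards cX' i(1,2) by linarith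
  qed
  ultimately show ?thesis by (rule that)
qed

text \<open>Adding an apex vertex \<open>None\<close> joins two disjoint paths into one, so that \<open>crossing_cycle\<close> applies
  to their outer ends; the apex is deleted from the resulting cycle.\<close>

fun apex_adj :: "'a set set \<Rightarrow> 'a option \<Rightarrow> 'a option \<Rightarrow> bool" where
  "apex_adj E None None = False"
| "apex_adj E None (Some v) = True"
| "apex_adj E (Some u) None = True"
| "apex_adj E (Some u) (Some v) = ({u, v} \<in> E)"

lemma apex_adj_sym: "apex_adj E u v \<Longrightarrow> apex_adj E v u"
  by (cases "(E, u, v)" rule: apex_adj.cases) (auto simp: insert_commute)

lemma path_of_apex_cycle:
  assumes "distinct cs" "successively (apex_adj E) cs" "apex_adj E (last cs) (hd cs)" "None \<in> set cs"
  obtains zs where "gpath E zs" "Suc (length zs) = length cs"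
proof -
  obtain as bs where cs: "cs = as @ None # bs" using assms(4) by (meson split_list)
  define ys where "ys = bs @ as"
  have "None \<notin> set ys" using assms(1) by (auto simp: cs ys_def)
  then have ys: "ys = map Some (map the ys)"
    by (induction ys) auto
  have d: "distinct ys" using assms(1) by (auto simp: cs ys_def)
  have "successively (apex_adj E) ys"
    using assms(2,3) by (cases as) (auto simp: cs ys_def successively_append_iff successively_Cons hd_append split: if_splits)
  then have "successively (\<lambda>u v. {u, v} \<in> E) (map the ys)"
    by (subst (asm) ys) (simp only: successively_map apex_adj.simps)
  moreover have "distinct (map the ys)"
    using d by (subst (asm) ys) (simp only: distinct_map)
  ultimately show ?thesis using that[of "map the ys"] cs by (auto simp: gpath_def ys_def)
qed

text \<open>On the path formed by \<open>p\<close>, the apex and the reversed \<open>q\<close>, the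
  apex is itself a neighbour of \<open>hd p\<close> placed behind all of \<open>p\<close>, so any
  neighbour of \<open>hd q\<close> on \<open>p\<close> gives a crossing pair. The resulting cycle
  has more than \<open>l\<close> vertices in either case, as the apex adds 1 to the total length and
  1 to each degree; without the apex it is a path on at least \<open>l\<close> vertices.\<close>

lemma no_crossing:
  assumes free: "pfree E l" and sgr: "sgr V E"
    and p: "gpath E p" "p \<noteq> []" and q: "gpath E q" "q \<noteq> []" and pq: "set p \<inter> set q = {}"
    and len: "l \<le> length p + length q"
    and A: "A \<subseteq> set p \<union> set q" "\<And>z. z \<in> A \<Longrightarrow> {hd p, z} \<in> E"
    and B: "B \<subseteq> set p \<union> set q" "\<And>z. z \<in> B \<Longrightarrow> {hd q, z} \<in> E"
    and card: "l \<le> card A + card B + 1"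
  shows "B \<inter> set p = {}"
proof (rule ccontr)
  assume "B \<inter> set p \<noteq> {}"
  then obtain i0 where i0: "i0 < length p" "p ! i0 \<in> B" by (auto simp: in_set_conv_nth)
  define ps where "ps = map Some p @ None # rev (map Some q)"
  have hd: "hd ps = Some (hd p)" using p by (cases p) (auto simp: ps_def)
  have last: "last ps = Some (hd q)" using q by (cases q) (auto simp: ps_def)
  have dist: "distinct ps"
    using gpath_distinct[OF p(1)] gpath_distinct[OF q(1)] pq by (auto simp: ps_def distinct_map)
  have succ: "successively (apex_adj E) ps"
  proof -
    have "successively (apex_adj E) (map Some p)" 
      using p(1) by (auto simp: gpath_def successively_map)
    moreover have "successively (apex_adj E) (rev (map Some q))" 
      using q(1) by (auto simp: gpath_def successively_map insert_commute)
    moreover have "hd (rev (map Some q)) = Some (last q)" "last (map Some p) = Some (last p)" using p q by (auto simp: hd_rev last_map)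
    ultimately show ?thesis by (auto simp: ps_def successively_append_iff successively_Cons)
  qed
  have finAB: "finite A" "finite B" using A(1) B(1) by (auto intro: finite_subset)
  have "insert None (Some ` A) \<subseteq> set ps" "insert None (Some ` B) \<subseteq> set ps"
    using A(1) B(1) by (auto simp: ps_def)
  moreover have "hd ps \<notin> insert None (Some ` A)" "last ps \<notin> insert None (Some ` B)"
    using A(2) B(2) hd last sgr_edge(3)[OF sgr] by auto
  moreover have "\<And>z. z \<in> insert None (Some ` A) \<Longrightarrow> apex_adj E (hd ps) z"
    "\<And>z. z \<in> insert None (Some ` B) \<Longrightarrow> apex_adj E (last ps) z"
    using A(2) B(2) hd last by auto
  moreover have "i0 < length p" by (rule i0)
  moreover have "length p < length ps" by (simp add: ps_def)
  moreover have "ps ! i0 \<in> insert None (Some ` B)" "ps ! length p \<in> insert None (Some ` A)"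
    using i0 by (simp_all add: ps_def nth_append)
  ultimately obtain cs where cs: "distinct cs" "successively (apex_adj E) cs" "cs \<noteq> []"
    "apex_adj E (last cs) (hd cs)" "set cs \<subseteq> set ps"
    "insert None (Some ` A) \<union> insert None (Some ` B) \<subseteq> set cs"
    "length cs = length ps \<or> card (insert None (Some ` A)) + card (insert None (Some ` B)) \<le> length cs"
    using crossing_cycle[OF dist succ apex_adj_sym] by metis
  then obtain zs where "gpath E zs" "Suc (length zs) = length cs"
    using path_of_apex_cycle[of cs E] by blast
  then have "length cs \<le> l" using pfreeD[OF free, of zs] by linarith
  moreover have "card (insert None (Some ` A)) = Suc (card A)" "card (insert None (Some ` B)) = Suc (card B)"
    using finAB by (auto simp: card_image)
  ultimately show False using cs(7) len card by (auto simp: ps_def)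
qed

text \<open>Let \<open>v\<close> have index \<open>i\<close> and let \<open>j\<close> be the last
  index of a member of \<open>A\<close>. If \<open>j \<le> i\<close>, run from \<open>v\<close> back
  to the start; otherwise do the same, jump from the start to \<open>j\<close> and run back to
  \<open>i + 1\<close>. In both cases all members of \<open>A\<close> have indices from 1 up to the
  number of steps taken.\<close>

lemma lollipop:
  assumes "sgr V E" "gpath E p" "p \<noteq> []" "A \<subseteq> set p" "\<And>z. z \<in> A \<Longrightarrow> {hd p, z} \<in> E" "v \<in> set p"
  obtains r where "gpath E r" "r \<noteq> []" "hd r = v" "set r \<subseteq> set p" "Suc (card A) \<le> length r"
proof -
  obtain i where i: "i < length p" "p ! i = v" using assms(6) by (auto simp: in_set_conv_nth)
  have vtake: "hd (rev (take (Suc i) p)) = v" using i by (simp add: hd_rev take_Suc_conv_app_nth)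
  define I where "I = {m. m < length p \<and> p ! m \<in> A}"
  have finI: "finite I" by (simp add: I_def)
  have "A = (!) p ` I" using assms(4) by (auto simp: I_def in_set_conv_nth image_iff subset_iff)
  then have cA: "card A \<le> card I" using finI card_image_le by blast
  have zero: "0 \<notin> I"
    using assms(5)[of "hd p"] sgr_edge(3)[OF assms(1), of "hd p" "hd p"] assms(3) by (auto simp: I_def hd_conv_nth)
  show ?thesis
  proof (cases "\<forall>m\<in>I. m \<le> i")
    case True
    then have "I \<subseteq> {1..i}" using zero by (auto simp: Suc_le_eq intro: gr0I)
    then have "card I \<le> i" using card_mono[of "{1..i}" I] by simp
    then show ?thesis
      using that[of "rev (take (Suc i) p)"] vtake i cA assms(2,3) set_take_subset[of "Suc i" p]
      by (auto simp: gpath_take)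
  next
    case False
    then have I: "I \<noteq> {}" by auto
    define j where "j = Max I"
    have j: "j \<in> I" "\<And>m. m \<in> I \<Longrightarrow> m \<le> j" using finI I by (auto simp: j_def)
    then have ij: "i < j" using False by force
    have jl: "j < length p" "p ! j \<in> A" using j by (auto simp: I_def)
    have "I \<subseteq> {1..j}" using zero j(2) by (auto simp: Suc_le_eq intro: gr0I)
    then have cI: "card I \<le> j" using card_mono[of "{1..j}" I] by simp
    define m where "m = take (j - i) (drop (Suc i) p)"
    have hdm: "hd (rev m) = p ! j"
    proof -
      have "length m = j - i" using ij jl by (simp add: m_def)
      then have "last m = m ! (j - i - 1)" using ij by (subst last_conv_nth) auto
      then show ?thesis using ij jl by (simp add: m_def hd_rev)
    qed
    have m: "gpath E m" using assms(2) by (simp add: m_def gpath_take gpath_drop)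
    have "set (take (Suc i) p) \<inter> set m = {}"
      using gpath_distinct[OF assms(2)] set_take_disj_set_drop_if_distinct[of p "Suc i" "Suc i"] set_take_subset[of "j - i" "drop (Suc i) p"]
      by (auto simp: m_def)
    then have "gpath E (rev (take (Suc i) p) @ rev m)"
      using m assms(2) hdm assms(3) assms(5)[OF jl(2)] by (auto simp: gpath_append gpath_take last_rev)
    moreover have "set m \<subseteq> set p"
      unfolding m_def by (meson set_drop_subset set_take_subset subset_trans)
    moreover have "length (rev (take (Suc i) p) @ rev m) = Suc j"
      using ij jl by (simp add: m_def)
    moreover have "hd (rev (take (Suc i) p) @ rev m) = v"
      using assms(3) vtake by (subst hd_append) auto
    moreover have "rev (take (Suc i) p) @ rev m \<noteq> []" using assms(3) by simp
    moreover have "set (rev (take (Suc i) p) @ rev m) \<subseteq> set p"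
      using \<open>set m \<subseteq> set p\<close> set_take_subset[of "Suc i" p] by auto
    ultimately show ?thesis using that[of "rev (take (Suc i) p) @ rev m"] cA cI by linarith
  qed
qed

text \<open>If the degrees were larger, \<open>no_crossing\<close> in both directions would keep the
  neighbours of each end on its own path. A connection between \<open>p\<close> and \<open>q\<close>
  could then be extended on both sides by a \<open>lollipop\<close>, to at least |A| + |B| + 2
  vertices.\<close>

lemma endpoint_degrees:
  assumes free: "pfree E l" and sgr: "sgr V E" and conn: "conn E V"
    and p: "gpath E p" "p \<noteq> []" "set p \<subseteq> V" and q: "gpath E q" "q \<noteq> []" "set q \<subseteq> V"
    and pq: "set p \<inter> set q = {}"
    and len: "l \<le> length p + length q"
    and A: "A \<subseteq> set p \<union> set q" "\<And>z. z \<in> A \<Longrightarrow> {hd p, z} \<in> E"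
    and B: "B \<subseteq> set p \<union> set q" "\<And>z. z \<in> B \<Longrightarrow> {hd q, z} \<in> E"
  shows "card A + card B + 1 < l"
proof (rule ccontr)
  assume "\<not> ?thesis"
  then have card: "l \<le> card A + card B + 1" by simp
  have "B \<inter> set p = {}"
    by (rule no_crossing[OF free sgr p(1,2) q(1,2) pq len A B card])
  then have Bq: "B \<subseteq> set q" using B(1) by auto
  have "A \<inter> set q = {}"
    by (rule no_crossing[OF free sgr q(1,2) p(1,2), of B A]) (use pq len A B card in auto)
  then have Ap: "A \<subseteq> set p" using A(1) by auto
  obtain u ms v where uv: "u \<in> set p" "v \<in> set q" "gpath E (u # ms @ [v])" "set ms \<inter> (set p \<union> set q) = {}"
    using conn_link[OF conn p(3) q(3) _ _ pq] p(2) q(2) by (metis set_empty)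
  obtain r where r: "gpath E r" "r \<noteq> []" "hd r = u" "set r \<subseteq> set p" "Suc (card A) \<le> length r"
    using lollipop[OF sgr p(1,2) Ap A(2) uv(1)] by blast
  obtain s where s: "gpath E s" "s \<noteq> []" "hd s = v" "set s \<subseteq> set q" "Suc (card B) \<le> length s"
    using lollipop[OF sgr q(1,2) Bq B(2) uv(2)] by blast
  have "gpath E (rev r @ ms @ s)"
  proof (cases "ms = []")
    case True
    then show ?thesis using uv r s pq by (auto simp: gpath_append gpath_Cons last_rev)
  next
    case False
    then show ?thesis using uv r s pq by (auto simp: gpath_append gpath_Cons last_rev)
  qed
  from pfreeD[OF free this] show False using r s card by simp
qed

section \<open>Kopylov's disintegration\<close>

lemma gpath_subset_hd:
  assumes "sgr V E" "gpath E xs" "xs \<noteq> []" "hd xs \<in> V"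
  shows "set xs \<subseteq> V"
proof (cases "2 \<le> length xs")
  case True
  then show ?thesis using gpath_subset assms by blast
next
  case False
  then obtain x where "xs = [x]" using assms(3) by (cases xs; cases "tl xs") auto
  then show ?thesis using assms by simp
qed

definition saturated :: "'a set set \<Rightarrow> 'a set \<Rightarrow> nat \<Rightarrow> bool" where
  "saturated E V l \<longleftrightarrow> pfree E l \<and>
     (\<forall>x\<in>V. \<forall>y\<in>V. x \<noteq> y \<longrightarrow> {x, y} \<notin> E \<longrightarrow> \<not> pfree (insert {x, y} E) l)"

lemma ex_saturated:
  assumes "sgr V E" "pfree E l"
  obtains E' where "E \<subseteq> E'" "sgr V E'" "saturated E' V l"
proof -
  define S where "S = {E'. E \<subseteq> E' \<and> sgr V E' \<and> pfree E' l}"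
  have "S \<subseteq> Pow (Pow V)" by (auto simp: S_def sgr_def)
  then have "finite S" using sgr_finite_verts[OF assms(1)] by (meson finite_Pow_iff finite_subset)
  moreover have "E \<in> S" using assms by (simp add: S_def)
  ultimately obtain M where M: "M \<in> S" "E \<subseteq> M" "\<And>E'. E' \<in> S \<Longrightarrow> M \<subseteq> E' \<Longrightarrow> M = E'"
    using finite_has_maximal2[of S E] by auto
  have "saturated M V l"
    unfolding saturated_def
  proof (intro conjI ballI impI notI)
    show "pfree M l" using M by (simp add: S_def)
    fix x y assume xy: "x \<in> V" "y \<in> V" "x \<noteq> y" "{x, y} \<notin> M" "pfree (insert {x, y} M) l"
    then have "insert {x, y} M \<in> S" using M(1) by (auto simp: S_def sgr_def)
    then show False using M(3)[of "insert {x, y} M"] xy(4) by auto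
  qed
  then show ?thesis using that M by (auto simp: S_def)
qed

text \<open>A path has distinct vertices, so it uses the new edge only once; the two pieces are
  turned so that they start at its ends.\<close>

lemma split_at_new_edge:
  assumes "gpath (insert {x, y} E) xs" "\<not> gpath E xs"
  obtains p q where "gpath E p" "gpath E q" "p \<noteq> []" "q \<noteq> []" "hd p = x" "hd q = y"
    "set p \<inter> set q = {}" "length p + length q = length xs"
proof -
  obtain i where i: "Suc i < length xs" "{xs ! i, xs ! Suc i} \<notin> E"
    using assms by (auto simp: gpath_def successively_conv_nth)
  have xy: "{xs ! i, xs ! Suc i} = {x, y}"
    using gpath_edge[OF assms(1) i(1)] i(2) by auto
  define p where "p = take (Suc i) xs"
  define q where "q = drop (Suc i) xs"
  have pq: "set p \<inter> set q = {}"
    using gpath_distinct[OF assms(1)] by (simp add: p_def q_def set_take_disj_set_drop_if_distinct)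
  have ne: "p \<noteq> []" "q \<noteq> []" using i by (auto simp: p_def q_def)
  have lastp: "last p = xs ! i" using i by (simp add: p_def take_Suc_conv_app_nth)
  have hdq: "hd q = xs ! Suc i" using i by (simp add: q_def hd_drop_conv_nth)
  have one: "\<not> {x, y} \<subseteq> set p" "\<not> {x, y} \<subseteq> set q"
    using pq ne last_in_set[OF ne(1)] hd_in_set[OF ne(2)] xy[symmetric] lastp hdq by auto
  have sub: "gpath E r" if "gpath (insert {x, y} E) r" "\<not> {x, y} \<subseteq> set r" for r
    unfolding gpath_def successively_conv_nth
  proof (intro conjI allI impI)
    show "distinct r" using that gpath_distinct by blast
    fix j assume j: "Suc j < length r"
    then have "{r ! j, r ! Suc j} \<subseteq> set r" by auto
    then have "{r ! j, r ! Suc j} \<noteq> {x, y}" using that(2) by metis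
    then show "{r ! j, r ! Suc j} \<in> E" using gpath_edge[OF that(1) j] by auto
  qed
  have gp: "gpath E p" "gpath E q"
    using sub one assms(1) by (auto simp: p_def q_def gpath_take gpath_drop)
  have len: "length p + length q = length xs" by (simp add: p_def q_def)
  consider "xs ! i = x" "xs ! Suc i = y" | "xs ! i = y" "xs ! Suc i = x"
    using xy by (auto simp: doubleton_eq_iff)
  then show ?thesis
  proof cases
    case 1
    then show ?thesis using that[of "rev p" q] gp ne lastp hdq pq len by (simp add: hd_rev)
  next
    case 2
    then show ?thesis using that[of q "rev p"] gp ne lastp hdq pq len by (auto simp: hd_rev)
  qed
qed

text \<open>Kopylov's argument: a longest pair of disjoint paths leaving a non-adjacent pair contains all
  neighbours of the pair inside \<open>A\<close> and \<open>B\<close>.\<close>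

lemma saturated_adjacent:
  assumes sgr: "sgr V E" and conn: "conn E V" and sat: "saturated E V l"
    and A: "A \<subseteq> V" "\<And>v. v \<in> A \<Longrightarrow> \<alpha> \<le> card (nb E A v)"
    and B: "B \<subseteq> V" "\<And>v. v \<in> B \<Longrightarrow> \<beta> \<le> card (nb E B v)"
    and l: "l \<le> \<alpha> + \<beta> + 1" and xy: "x \<in> A" "y \<in> B" "x \<noteq> y"
  shows "{x, y} \<in> E"
proof (rule ccontr)
  assume nadj: "{x, y} \<notin> E"
  have free: "pfree E l" using sat by (simp add: saturated_def)
  define Q where "Q x y p q \<longleftrightarrow> x \<in> A \<and> y \<in> B \<and> x \<noteq> y \<and> {x, y} \<notin> E \<and> gpath E p \<and> gpath E q \<and>
    p \<noteq> [] \<and> q \<noteq> [] \<and> hd p = x \<and> hd q = y \<and> set p \<inter> set q = {}" for x y p q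
  define P where "P n \<longleftrightarrow> (\<exists>x y p q. Q x y p q \<and> n = length p + length q)" for n
  obtain xs where xs: "gpath (insert {x, y} E) xs" "length xs = l"
    using sat nadj xy A(1) B(1) unfolding saturated_def by (meson not_pfreeE subsetD)
  have "\<not> gpath E xs" using pfreeD[OF free] xs(2) by blast
  then obtain p q where "gpath E p" "gpath E q" "p \<noteq> []" "q \<noteq> []" "hd p = x" "hd q = y"
    "set p \<inter> set q = {}" "length p + length q = length xs"
    using split_at_new_edge[OF xs(1)] by blast
  then have Pl: "P l" using xs(2) xy nadj unfolding P_def Q_def by metis
  have bound: "n \<le> 2 * l" if "P n" for n
    using that pfreeD[OF free] unfolding P_def Q_def by (metis add_mono less_imp_le mult_2)
  define n where "n = Greatest P"
  have Pn: "P n" and nmax: "\<And>m. P m \<Longrightarrow> m \<le> n"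
    using GreatestI_nat[of P l "2 * l"] Greatest_le_nat[of P _ "2 * l"] Pl bound by (auto simp: n_def)
  obtain x y p q where pq: "Q x y p q" "n = length p + length q"
    using Pn by (auto simp: P_def)
  have x: "x \<in> A" and y: "y \<in> B" and nadj: "{x, y} \<notin> E" and p: "gpath E p" "p \<noteq> []" "hd p = x"
    and q: "gpath E q" "q \<noteq> []" "hd q = y" and dis: "set p \<inter> set q = {}"
    using pq(1) by (auto simp: Q_def)
  have len: "l \<le> length p + length q" using nmax[OF Pl] pq(2) by simp
  have bridge: False if "{x, z} \<in> E" "{y, z} \<in> E" "z \<notin> set p \<union> set q" for z
  proof -
    have "gpath E (rev p @ z # q)"
      using p q dis that by (auto simp: gpath_append gpath_Cons last_rev insert_commute)
    from pfreeD[OF free this] show False using len by simp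
  qed
  \<comment> \<open>A neighbour \<open>z\<close> outside both paths is not adjacent to
    \<open>y\<close>, by \<open>bridge\<close>. So \<open>z\<close> and \<open>y\<close> are again a
    non-adjacent pair, with the longer paths \<open>z # p\<close> and \<open>q\<close>.\<close>
  have NA: "nb E A x \<subseteq> set p \<union> set q"
  proof
    fix z assume z: "z \<in> nb E A x"
    show "z \<in> set p \<union> set q"
    proof (rule ccontr)
      assume nz: "z \<notin> set p \<union> set q"
      have zy: "z \<noteq> y" using nz q by auto
      have "{z, y} \<notin> E" using bridge[of z] z nz by (auto simp: nb_def insert_commute)
      moreover have "gpath E (z # p)" using p z nz by (auto simp: nb_def gpath_Cons insert_commute)
      ultimately have "Q z y (z # p) q" using z zy nz y q dis by (auto simp: Q_def nb_def)
      then have "P (Suc n)" using pq(2) unfolding P_def by (metis length_Cons add_Suc)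
      then show False using nmax by fastforce
    qed
  qed
  have NB: "nb E B y \<subseteq> set p \<union> set q"
  proof
    fix z assume z: "z \<in> nb E B y"
    show "z \<in> set p \<union> set q"
    proof (rule ccontr)
      assume nz: "z \<notin> set p \<union> set q"
      have zx: "x \<noteq> z" using nz p by auto
      have "{x, z} \<notin> E" using bridge[of z] z nz by (auto simp: nb_def insert_commute)
      moreover have "gpath E (z # q)" using q z nz by (auto simp: nb_def gpath_Cons insert_commute)
      ultimately have "Q x z p (z # q)" using z zx nz x p dis by (auto simp: Q_def nb_def)
      then have "P (Suc n)" using pq(2) unfolding P_def by (metis length_Cons add_Suc_right)
      then show False using nmax by fastforce
    qed
  qed
  have "set p \<subseteq> V" "set q \<subseteq> V"
    using gpath_subset_hd[OF sgr p(1,2)] gpath_subset_hd[OF sgr q(1,2)] p(3) q(3) x y A(1) B(1) by auto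
  then have "card (nb E A x) + card (nb E B y) + 1 < l"
    using endpoint_degrees[OF free sgr conn p(1,2) _ q(1,2) _ dis len NA _ NB] p(3) q(3)
    by (auto simp: nb_def)
  then show False using A(2)[OF x] B(2)[OF y] l by linarith
qed

section \<open>Cores and degeneracy\<close>

text \<open>A union of sets of minimum degree at least \<open>d\<close> has this property again, so
  the \<open>d\<close>-core is obtained without tracking an order of deletions.\<close>

definition core :: "'a set set \<Rightarrow> 'a set \<Rightarrow> nat \<Rightarrow> 'a set" where
  "core E V d = \<Union> {A. A \<subseteq> V \<and> (\<forall>v\<in>A. d \<le> card (nb E A v))}"

lemma core_subset: "core E V d \<subseteq> V"
  by (auto simp: core_def)

lemma core_greatest: "A \<subseteq> V \<Longrightarrow> (\<And>v. v \<in> A \<Longrightarrow> d \<le> card (nb E A v)) \<Longrightarrow> A \<subseteq> core E V d"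
  by (auto simp: core_def)

lemma core_degree:
  assumes "finite V" "v \<in> core E V d"
  shows "d \<le> card (nb E (core E V d) v)"
proof -
  obtain A where A: "v \<in> A" "A \<subseteq> V" "\<forall>v\<in>A. d \<le> card (nb E A v)"
    using assms(2) by (auto simp: core_def)
  then have "A \<subseteq> core E V d" by (intro core_greatest) auto
  moreover have "finite (core E V d)" using core_subset assms(1) finite_subset by metis
  ultimately have "card (nb E A v) \<le> card (nb E (core E V d) v)"
    by (auto intro!: card_mono nb_mono)
  then show ?thesis using A by force
qed

definition degenerate :: "'a set set \<Rightarrow> 'a set \<Rightarrow> nat \<Rightarrow> bool" where
  "degenerate E V d \<longleftrightarrow> core E V (Suc d) = {}"

lemma degenerate_iff:
  "degenerate E V d \<longleftrightarrow> (\<forall>B\<subseteq>V. B \<noteq> {} \<longrightarrow> (\<exists>v\<in>B. card (nb E B v) \<le> d))"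
proof
  assume *: "degenerate E V d"
  show "\<forall>B\<subseteq>V. B \<noteq> {} \<longrightarrow> (\<exists>v\<in>B. card (nb E B v) \<le> d)"
  proof (intro allI impI, rule ccontr)
    fix B assume B: "B \<subseteq> V" "B \<noteq> {}" "\<not> (\<exists>v\<in>B. card (nb E B v) \<le> d)"
    then have "B \<subseteq> core E V (Suc d)" by (intro core_greatest) (auto simp: not_le Suc_le_eq)
    then show False using * B(2) by (simp add: degenerate_def)
  qed
next
  assume *: "\<forall>B\<subseteq>V. B \<noteq> {} \<longrightarrow> (\<exists>v\<in>B. card (nb E B v) \<le> d)"
  have "A = {}" if "A \<subseteq> V" "\<forall>v\<in>A. Suc d \<le> card (nb E A v)" for A
    using * that by (metis not_less_eq_eq)
  then show "degenerate E V d" unfolding degenerate_def core_def by blast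
qed

lemma degenerate_anti:
  assumes "degenerate E' V d" "E \<subseteq> E'" "W \<subseteq> V" "finite V"
  shows "degenerate E W d"
  unfolding degenerate_iff
proof (intro allI impI)
  fix B assume B: "B \<subseteq> W" "B \<noteq> {}"
  then have finB: "finite B" using assms(3,4) by (meson finite_subset)
  obtain v where v: "v \<in> B" "card (nb E' B v) \<le> d"
    using assms(1)[unfolded degenerate_iff, rule_format, of B] assms(3) B by blast
  have "card (nb E B v) \<le> card (nb E' B v)"
    using assms(2) finB by (intro card_mono) (auto simp: nb_def)
  then show "\<exists>v\<in>B. card (nb E B v) \<le> d" using v le_trans by blast
qed

lemma peel:
  assumes "sgr V E" "A \<subseteq> W" "W \<subseteq> V"
    and "\<And>B. A \<subset> B \<Longrightarrow> B \<subseteq> W \<Longrightarrow> \<exists>v\<in>B - A. card (nb E B v) \<le> d"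
  shows "card (ind E W) \<le> card (ind E A) + d * card (W - A)"
  using assms(2-)
proof (induction "card (W - A)" arbitrary: W)
  case 0
  have "finite W" using 0(3) assms(1) finite_subset by (auto simp: sgr_def)
  then have "W = A" using 0 by auto
  then show ?case by simp
next
  case (Suc n)
  have fin: "finite W" using Suc.prems(2) assms(1) finite_subset by (auto simp: sgr_def)
  have "A \<subset> W" using Suc.hyps(2) Suc.prems(1) by auto
  then obtain v where v: "v \<in> W - A" "card (nb E W v) \<le> d" using Suc.prems(3)[of W] by blast
  have eq: "(W - {v}) - A = (W - A) - {v}" by auto
  have n: "n = card ((W - {v}) - A)" using Suc.hyps(2) v(1) fin by (simp add: eq)
  have "card (ind E (W - {v})) \<le> card (ind E A) + d * card ((W - {v}) - A)"
    using Suc.prems v by (intro Suc.hyps(1)[OF n]) auto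
  moreover have "card (ind E W) = card (ind E (W - {v})) + card (nb E W v)"
    using card_ind_remove[OF assms(1) fin] v by blast
  ultimately show ?case using v(2) n Suc.hyps(2)[symmetric] by simp
qed

lemma core_peel:
  assumes "sgr V E"
  shows "card (ind E V) \<le> card (ind E (core E V (Suc d))) + d * card (V - core E V (Suc d))"
proof (rule peel[OF assms core_subset subset_refl])
  fix B assume B: "core E V (Suc d) \<subset> B" "B \<subseteq> V"
  then have finB: "finite B" using assms finite_subset by (auto simp: sgr_def)
  have "\<not> (\<forall>v\<in>B. Suc d \<le> card (nb E B v))" using core_greatest[of B V "Suc d" E] B by blast
  then obtain v where v: "v \<in> B" "card (nb E B v) \<le> d" by (auto simp: not_less_eq_eq)
  have "v \<notin> core E V (Suc d)"
  proof
    assume "v \<in> core E V (Suc d)"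
    then have "Suc d \<le> card (nb E (core E V (Suc d)) v)"
      using core_degree sgr_finite_verts[OF assms] by metis
    also have "\<dots> \<le> card (nb E B v)" using B finB by (intro card_mono nb_mono) auto
    finally show False using v by simp
  qed
  then show "\<exists>v\<in>B - core E V (Suc d). card (nb E B v) \<le> d" using v by auto
qed

text \<open>Vertices of degree at most \<open>d\<close> are deleted until \<open>d\<close> are left,
  and these span at most d(d-1)/2 edges. Against \<open>d\<close> edges per vertex, d(d+1)/2 are
  lost; K_d joined to an edgeless graph attains this.\<close>

lemma degenerate_edges:
  assumes "sgr V E" "degenerate E V d" "W \<subseteq> V" "d \<le> card W"
  shows "2 * card (ind E W) + d * (d + 1) \<le> 2 * d * card W"
  using assms(3,4)
proof (induction "card W - d" arbitrary: W)
  case 0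
  then have "card W = d" "finite W" using assms(1) finite_subset by (auto simp: sgr_def)
  then have "2 * card (ind E W) \<le> d * (d - 1)" using card_ind_le[OF assms(1)] by metis
  moreover have "d * (d - 1) + d * (d + 1) = 2 * d * d" by (cases d) auto
  ultimately show ?case using \<open>card W = d\<close> by simp
next
  case (Suc n)
  have fin: "finite W" using Suc.prems(1) assms(1) finite_subset by (auto simp: sgr_def)
  have "W \<noteq> {}" using Suc.hyps(2) by auto
  then obtain v where v: "v \<in> W" "card (nb E W v) \<le> d"
    using assms(2) Suc.prems(1) unfolding degenerate_iff by blast
  have c: "card W = Suc (card (W - {v}))" using v(1) fin by (metis card_Suc_Diff1)
  have "2 * card (ind E (W - {v})) + d * (d + 1) \<le> 2 * d * card (W - {v})"
    using Suc.prems Suc.hyps(2) c by (intro Suc.hyps(1)) auto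
  moreover have "card (ind E W) = card (ind E (W - {v})) + card (nb E W v)"
    using card_ind_remove[OF assms(1) fin] v by blast
  ultimately show ?case using v(2) c by (simp add: algebra_simps)
qed

lemma clique_path:
  assumes "finite W" "\<And>x y. x \<in> W \<Longrightarrow> y \<in> W \<Longrightarrow> x \<noteq> y \<Longrightarrow> {x, y} \<in> E" "x \<in> W"
  obtains xs where "gpath E (x # xs)" "set (x # xs) = W" "length (x # xs) = card W"
proof -
  obtain xs where xs: "set xs = W - {x}" "distinct xs"
    using assms(1) finite_distinct_list[of "W - {x}"] by auto
  have "set (x # xs) = W" "distinct (x # xs)" using xs assms(3) by auto
  moreover have "gpath E (x # xs)"
    unfolding gpath_def successively_conv_nth
  proof (intro conjI allI impI)
    fix i assume i: "Suc i < length (x # xs)"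
    then have "(x # xs) ! i \<noteq> (x # xs) ! Suc i"
      using \<open>distinct (x # xs)\<close> nth_eq_iff_index_eq[of "x # xs" i "Suc i"] by simp
    moreover have "(x # xs) ! i \<in> W" "(x # xs) ! Suc i \<in> W"
      using i \<open>set (x # xs) = W\<close> by (metis Suc_lessD nth_mem)+
    ultimately show "{(x # xs) ! i, (x # xs) ! Suc i} \<in> E" using assms(2) by blast
  qed (rule \<open>distinct (x # xs)\<close>)
  moreover have "length (x # xs) = card W" using calculation by (metis distinct_card)
  ultimately show ?thesis using that by blast
qed

text \<open>If the \<open>(k + 1)\<close>-core of a saturated supergraph is not empty, it is a clique on \<open>h\<close> vertices, and
  by \<open>saturated_adjacent\<close> it is also the \<open>(2 k + 2 - h)\<close>-core: outside of it, vertices can be removed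
  one at a time with at most \<open>2 k + 1 - h\<close> edges each.\<close>

lemma conn_pfree_cases:
  assumes sgr: "sgr V E" and conn: "conn E V" and free: "pfree E (2 * k + 2)" and big: "2 * k + 2 \<le> card V"
  shows "degenerate E V k \<or>
    (\<exists>h. k + 2 \<le> h \<and> h \<le> 2 * k \<and> 2 * card E \<le> h * (h - 1) + 2 * ((2 * k + 1 - h) * (card V - h)))"
proof -
  obtain E' where E': "E \<subseteq> E'" "sgr V E'" "saturated E' V (2 * k + 2)"
    using ex_saturated[OF sgr free] by blast
  have free': "pfree E' (2 * k + 2)" using E' by (simp add: saturated_def)
  have conn': "conn E' V" using conn_mono[OF conn E'(1)] .
  have fin: "finite V" using sgr sgr_finite_verts by blast
  define H where "H = core E' V (Suc k)"
  have HV: "H \<subseteq> V" and Hdeg: "\<And>v. v \<in> H \<Longrightarrow> Suc k \<le> card (nb E' H v)"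
    using core_subset core_degree[OF fin] unfolding H_def by metis+
  have finH: "finite H" using HV fin finite_subset by blast
  show ?thesis
  proof (cases "H = {}")
    case True
    then have "degenerate E' V k" by (simp add: degenerate_def H_def)
    then show ?thesis using degenerate_anti E'(1) fin by blast
  next
    case False
    have clique: "{x, y} \<in> E'" if "x \<in> H" "y \<in> H" "x \<noteq> y" for x y
      using saturated_adjacent[OF E'(2) conn' E'(3) HV Hdeg HV Hdeg _ that] by simp
    define h where "h = card H"
    have nbH: "nb E' H v = H - {v}" if "v \<in> H" for v
      using clique that sgr_edge(3)[OF E'(2)] by (auto simp: nb_def)
    have Hcard: "card (nb E' H v) = h - 1" if "v \<in> H" for v
      using that nbH finH by (simp add: h_def)
    have h1: "k + 2 \<le> h" using False Hdeg Hcard by fastforce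
    \<comment> \<open>A clique has a spanning path from any prescribed vertex, so one on at least
      2k+1 vertices extends by a neighbour outside. If nothing lies outside, the clique alone has at
      least 2k+2 vertices.\<close>
    have h2: "h \<le> 2 * k"
    proof (rule ccontr)
      assume nh: "\<not> h \<le> 2 * k"
      show False
      proof (cases "H = V")
        case True
        obtain x where "x \<in> H" using False by auto
        then obtain xs where "gpath E' (x # xs)" "length (x # xs) = card H"
          using clique_path[of H E'] finH clique by metis
        then show False using pfreeD[OF free', of "x # xs"] big True by simp
      next
        case ne: False
        then obtain u v where uv: "u \<in> H" "v \<in> V - H" "{u, v} \<in> E'"
          using conn' False HV unfolding conn_def by metis
        then obtain xs where "gpath E' (u # xs)" "set (u # xs) = H" "length (u # xs) = card H"
          using clique_path[of H E'] finH clique by metis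
        moreover from this have "gpath E' (v # u # xs)"
          using uv by (auto simp: gpath_Cons insert_commute)
        ultimately show False using pfreeD[OF free', of "v # u # xs"] nh by (simp add: h_def)
      qed
    qed
    \<comment> \<open>The minimum degrees h - 1 inside \<open>H\<close> and g + 1 inside
      \<open>H2\<close> have the sum 2k+1 that \<open>saturated_adjacent\<close> asks for.\<close>
    define g where "g = 2 * k + 1 - h"
    define H2 where "H2 = core E' V (Suc g)"
    have H2V: "H2 \<subseteq> V" and H2deg: "\<And>v. v \<in> H2 \<Longrightarrow> Suc g \<le> card (nb E' H2 v)"
      using core_subset core_degree[OF fin] unfolding H2_def by metis+
    have "H \<subseteq> H2"
      unfolding H2_def using HV
    proof (rule core_greatest)
      show "Suc g \<le> card (nb E' H v)" if "v \<in> H" for v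
        using Hcard[OF that] h1 h2 by (simp add: g_def)
    qed
    have adj: "{x, y} \<in> E'" if "x \<in> H" "y \<in> H2" "x \<noteq> y" for x y
    proof (rule saturated_adjacent[OF E'(2) conn' E'(3) HV _ H2V H2deg _ that])
      show "h - 1 \<le> card (nb E' H v)" if "v \<in> H" for v using Hcard[OF that] by simp
      show "2 * k + 2 \<le> h - 1 + Suc g + 1" using h1 h2 by (simp add: g_def)
    qed
    \<comment> \<open>A vertex of \<open>H2\<close> outside \<open>H\<close> would be adjacent to
      all of the at least k+2 vertices of \<open>H\<close>, and could be added to the
      (k+1)-core.\<close>
    have "H2 \<subseteq> H"
    proof
      fix y assume y: "y \<in> H2"
      show "y \<in> H"
      proof (rule ccontr)
        assume yH: "y \<notin> H"
        have "insert y H \<subseteq> core E' V (Suc k)"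
        proof (rule core_greatest)
          show "insert y H \<subseteq> V" using y H2V HV by auto
          fix v assume v: "v \<in> insert y H"
          show "Suc k \<le> card (nb E' (insert y H) v)"
          proof (cases "v = y")
            case True
            have "H \<subseteq> nb E' (insert y H) y"
              using adj[OF _ y] yH by (auto simp: nb_def insert_commute)
            then have "h \<le> card (nb E' (insert y H) y)"
              unfolding h_def using finH by (intro card_mono) auto
            then show ?thesis using True h1 by simp
          next
            case False
            then have "Suc k \<le> card (nb E' H v)" using v Hdeg by auto
            also have "\<dots> \<le> card (nb E' (insert y H) v)"
              using finH by (intro card_mono nb_mono) auto
            finally show ?thesis .
          qed
        qed
        then show False using yH by (auto simp: H_def)
      qed
    qed
    then have "H2 = H" using \<open>H \<subseteq> H2\<close> by auto
    then have "card (ind E' V) \<le> card (ind E' H) + g * card (V - H)"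
      using core_peel[OF E'(2), of g] by (simp add: H2_def)
    moreover have "card (V - H) = card V - h" using HV finH by (simp add: h_def card_Diff_subset)
    moreover have "2 * card (ind E' H) \<le> h * (h - 1)" using card_ind_le[OF E'(2) finH] by (simp add: h_def)
    moreover have "card E \<le> card E'" using E' sgr_finite_edges by (auto intro: card_mono)
    ultimately have "2 * card E \<le> h * (h - 1) + 2 * (g * (card V - h))"
      using ind_self[OF E'(2)] by simp
    then show ?thesis using h1 h2 by (auto simp: g_def)
  qed
qed

section \<open>The extremal number of a path\<close>

text \<open>Let c = r modulo 2k+1. Copies of K_{2k+1} together with one clique on the remaining r
  vertices fall short of degree 2k only at these r vertices, which have degree r - 1. The sum
  r(2k+1-r) is twice the number of edges lacking; doubling avoids halves.\<close>

definition deficit :: "nat \<Rightarrow> nat \<Rightarrow> nat" where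
  "deficit k c = (c mod (2 * k + 1)) * (2 * k + 1 - c mod (2 * k + 1))"

lemma deficit_small: "c \<le> 2 * k + 1 \<Longrightarrow> deficit k c = c * (2 * k + 1 - c)"
  by (cases "c = 2 * k + 1") (auto simp: deficit_def)

lemma int_deficit:
  "int (deficit k c) = int (c mod (2 * k + 1)) * (2 * int k + 1 - int (c mod (2 * k + 1)))"
proof -
  have "c mod (2 * k + 1) \<le> 2 * k + 1" by (simp add: less_imp_le)
  then show ?thesis unfolding deficit_def of_nat_mult by (subst of_nat_diff) simp_all
qed

lemma int_square_ge: "(x::int) \<le> x * x"
proof (cases "x \<le> 0")
  case True
  then show ?thesis by (meson order_trans zero_le_square)
next
  case False
  then show ?thesis using mult_left_mono[of 1 x x] by simp
qed

text \<open>Two numbers with sum 2k+1 have the largest product at \<open>k\<close> and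
  \<open>k + 1\<close>. The bound is the loss found in \<open>degenerate_edges\<close>, so
  degenerate graphs never have more edges than the cliques.\<close>

lemma deficit_le: "deficit k c \<le> k * (k + 1)"
proof -
  define r where "r = int (c mod (2 * k + 1))"
  have "0 \<le> (int k - r) * (int k - r) + (int k - r)"
    using int_square_ge[of "r - int k"] by (simp add: algebra_simps)
  then have "int (deficit k c) \<le> int (k * (k + 1))"
    unfolding int_deficit r_def[symmetric] by (simp add: algebra_simps)
  then show ?thesis by linarith
qed

text \<open>With residues r, s and N = 2k+1, the two sides differ by 2rs if r + s < N and by
  2(N-r)(N-s) otherwise. This is what allows the edge bounds of separated parts to be added.\<close>

lemma deficit_add: "deficit k (a + b) \<le> deficit k a + deficit k b"
proof -
  define N where "N = 2 * k + 1"
  define r where "r = a mod N"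
  define s where "s = b mod N"
  have rs: "r < N" "s < N" by (auto simp: r_def s_def N_def)
  have m: "(a + b) mod N = (r + s) mod N" by (simp add: r_def s_def mod_add_eq)
  show ?thesis
  proof (cases "r + s < N")
    case True
    then have "int (deficit k (a + b)) = int (r + s) * (int N - int (r + s))"
      unfolding int_deficit N_def[symmetric] m using N_def by simp
    moreover have "int (deficit k a) = int r * (int N - int r)" "int (deficit k b) = int s * (int N - int s)"
      unfolding int_deficit r_def s_def N_def by simp_all
    ultimately have "int (deficit k (a + b)) = int (deficit k a) + int (deficit k b) - 2 * (int r * int s)"
      by (simp add: algebra_simps)
    moreover have "0 \<le> int r * int s" by simp
    ultimately show ?thesis by linarith
  next
    case False
    then have "(r + s) mod N = r + s - N" using rs by (simp add: mod_if)
    then have "int (deficit k (a + b)) = (int r + int s - int N) * (int N - (int r + int s - int N))"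
      unfolding int_deficit N_def[symmetric] m using N_def False by simp
    moreover have "int (deficit k a) = int r * (int N - int r)" "int (deficit k b) = int s * (int N - int s)"
      unfolding int_deficit r_def s_def N_def by simp_all
    moreover have "0 \<le> (int N - int r) * (int N - int s)" using rs by simp
    ultimately have "int (deficit k (a + b)) \<le> int (deficit k a) + int (deficit k b)"
      by (simp add: algebra_simps)
    then show ?thesis by linarith
  qed
qed

text \<open>The Faudree--Schelp number is \<open>k m - deficit k m / 2\<close>.\<close>

lemma sum_mod_deficit: "2 * (\<Sum>j<m. j mod (2 * k + 1)) + deficit k m = 2 * k * m"
proof (induction m)
  case 0
  show ?case by (simp add: deficit_def)
next
  case (Suc m)
  define r where "r = m mod (2 * k + 1)"
  have r: "r \<le> 2 * k" by (auto simp: r_def less_Suc_eq_le[symmetric])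
  have "int (deficit k (Suc m)) = int (deficit k m) + 2 * int k - 2 * int r"
  proof (cases "r = 2 * k")
    case True
    then have "Suc m mod (2 * k + 1) = 0" by (simp add: r_def mod_Suc)
    then show ?thesis using True unfolding int_deficit r_def[symmetric] by simp
  next
    case False
    then have "Suc m mod (2 * k + 1) = Suc r" by (simp add: r_def mod_Suc)
    then show ?thesis unfolding int_deficit r_def[symmetric] by (simp add: algebra_simps)
  qed
  then have "int (2 * (\<Sum>j<Suc m. j mod (2 * k + 1)) + deficit k (Suc m)) = int (2 * k * Suc m)"
    using arg_cong[OF Suc.IH, of int] unfolding r_def by (simp add: algebra_simps)
  then show ?case by linarith
qed

text \<open>With \<open>g = 2 k + 1 - h\<close> and \<open>r = c mod (2 k + 1)\<close> the first claim reduces to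
  \<open>(r - g)\<^sup>2 - (r - g) + 4 g (k - g) > 0\<close>.\<close>

lemma clique_pendant_deficit:
  assumes h: "k + 2 \<le> h" "h \<le> 2 * k" and c: "2 * k + 2 \<le> c"
    and e: "2 * e \<le> h * (h - 1) + 2 * ((2 * k + 1 - h) * (c - h))"
  shows "2 * e + deficit k c < 2 * k * c" "2 * e + 2 * (c - 2 * k) \<le> 2 * k * c"
proof -
  define g where "g = 2 * int k + 1 - int h"
  define s where "s = int c - 2 * int k - 1"
  define r where "r = int (c mod (2 * k + 1))"
  have g: "1 \<le> g" "g \<le> int k - 1" using h by (auto simp: g_def)
  have s: "1 \<le> s" using c by (auto simp: s_def)
  \<comment> \<open>The number \<open>s\<close> is congruent to \<open>c\<close> modulo 2k+1 and not
    negative, so it is at least the residue \<open>r\<close>.\<close>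
  have "c mod (2 * k + 1) = (c - (2 * k + 1)) mod (2 * k + 1)"
    using c by (simp add: le_mod_geq)
  also have "\<dots> \<le> c - (2 * k + 1)" by simp
  finally have rs: "r \<le> s" using c by (simp add: r_def s_def)
  have hk: "int h = 2 * int k + 1 - g" and ck: "int c = s + 2 * int k + 1"
    by (auto simp: g_def s_def)
  have "int (2 * e) \<le> int (h * (h - 1) + 2 * ((2 * k + 1 - h) * (c - h)))" using e by linarith
  also have "\<dots> = int h * (int h - 1) + 2 * (g * (s + g))"
    using h c by (simp add: of_nat_diff g_def s_def)
  finally have "2 * int e \<le> (2 * int k + 1 - g) * (2 * int k - g) + 2 * (g * (s + g))"
    by (simp add: hk)
  then have d: "2 * int k * int c - 2 * int e \<ge> 2 * ((s + g) * (int k - g)) + g * (2 * int k + 1 - g)"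
    unfolding ck by (simp add: algebra_simps)
  have 1: "(r + g) * (int k - g) \<le> (s + g) * (int k - g)"
    using rs g by (intro mult_right_mono) auto
  have "0 \<le> (r - g) * (r - g) - (r - g)" using int_square_ge[of "r - g"] by simp
  moreover have "0 < g * (int k - g)" using g by simp
  ultimately have "r * (2 * int k + 1 - r) < 2 * ((r + g) * (int k - g)) + g * (2 * int k + 1 - g)"
    by (simp add: algebra_simps)
  then have "int (deficit k c) < 2 * int k * int c - 2 * int e"
    unfolding int_deficit r_def[symmetric] using 1 d by linarith
  then have "int (2 * e + deficit k c) < int (2 * k * c)" by simp
  then show "2 * e + deficit k c < 2 * k * c" by linarith
  \<comment> \<open>The second bound is linear in the order, since s + g \<ge> s + 1 and k - g \<ge>
    1. It later bounds the size of such a component by its deficit.\<close>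
  have "(s + 1) * 1 \<le> (s + g) * (int k - g)" using g s by (intro mult_mono) auto
  moreover have "0 \<le> g * (2 * int k + 1 - g)" using g by simp
  ultimately have "2 * (s + 1) \<le> 2 * int k * int c - 2 * int e" using d by linarith
  then have "int (2 * e + 2 * (c - 2 * k)) \<le> int (2 * k * c)"
    using c by (simp add: of_nat_diff s_def)
  then show "2 * e + 2 * (c - 2 * k) \<le> 2 * k * c" by linarith
qed

text \<open>The trichotomy used for components: up to 2k+1 vertices the complete graph is the only
  obstruction, degenerate graphs pay the fixed amount k(k+1), and graphs with a clique as core are
  strictly worse than \<open>deficit\<close> and pay in proportion to their order.\<close>

lemma conn_deficit_cases:
  assumes "sgr V E" "conn E V" "pfree E (2 * k + 2)"
  obtains (small) "card V \<le> 2 * k + 1" "2 * card E + deficit k (card V) \<le> 2 * k * card V"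
    | (degen) "2 * k + 2 \<le> card V" "degenerate E V k" "2 * card E + k * (k + 1) \<le> 2 * k * card V"
    | (pendant) "2 * k + 2 \<le> card V" "2 * card E + deficit k (card V) < 2 * k * card V"
        "2 * card E + 2 * (card V - 2 * k) \<le> 2 * k * card V"
proof (cases "card V \<le> 2 * k + 1")
  case True
  have "2 * card E \<le> card V * (card V - 1)"
    using card_ind_le[OF assms(1)] ind_self[OF assms(1)] sgr_finite_verts[OF assms(1)] by metis
  moreover have "card V * (card V - 1) + card V * (2 * k + 1 - card V) = 2 * k * card V"
  proof (cases "card V")
    case (Suc c)
    then have "c \<le> 2 * k" using True by simp
    then have "c + (2 * k - c) = 2 * k" by simp
    then have "Suc c * c + Suc c * (2 * k - c) = Suc c * (2 * k)" by (metis distrib_left)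
    then show ?thesis using Suc by simp
  qed simp
  ultimately show ?thesis using small[OF True] deficit_small[OF True] by simp
next
  case False
  then have big: "2 * k + 2 \<le> card V" by simp
  show ?thesis
    using conn_pfree_cases[OF assms big]
  proof
    assume "degenerate E V k"
    then show ?thesis
      using degen[OF big] degenerate_edges[OF assms(1), of k V] ind_self[OF assms(1)] big by simp
  next
    assume "\<exists>h. k + 2 \<le> h \<and> h \<le> 2 * k \<and> 2 * card E \<le> h * (h - 1) + 2 * ((2 * k + 1 - h) * (card V - h))"
    then show ?thesis using pendant[OF big] clique_pendant_deficit[OF _ _ big] by blast
  qed
qed

lemma not_connE:
  assumes "sgr V E" "\<not> conn E V"
  obtains A where "A \<subset> V" "A \<noteq> {}" "\<And>u v. u \<in> A \<Longrightarrow> v \<in> V - A \<Longrightarrow> {u, v} \<notin> E"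
    "card V = card A + card (V - A)" "card (ind E V) = card (ind E A) + card (ind E (V - A))"
proof -
  obtain A where A: "A \<subseteq> V" "A \<noteq> {}" "A \<noteq> V" "\<And>u v. u \<in> A \<Longrightarrow> v \<in> V - A \<Longrightarrow> {u, v} \<notin> E"
    using assms(2) unfolding conn_def by metis
  have fin: "finite A" "finite (V - A)" using finite_subset[OF A(1)] sgr_finite_verts[OF assms(1)] by auto
  have "A \<union> (V - A) = V" using A by auto
  then show ?thesis
    using that[of A] A card_ind_Un_separated[OF assms(1) fin _ A(4)] card_Un_disjoint[OF fin] by auto
qed

text \<open>The Faudree-Schelp bound. Connected graphs are covered by
  \<open>conn_deficit_cases\<close>; otherwise the bounds of two separated parts are combined by
  \<open>deficit_add\<close>.\<close>

theorem pfree_edges: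
  assumes "sgr V E" "pfree E (2 * k + 2)"
  shows "2 * card E + deficit k (card V) \<le> 2 * k * card V"
  using assms
proof (induction "card V" arbitrary: V E rule: less_induct)
  case less
  show ?case
  proof (cases "conn E V")
    case True
    show ?thesis
      using less.prems(1) True less.prems(2)
    proof (cases rule: conn_deficit_cases)
      case degen
      then show ?thesis using deficit_le[of k "card V"] by linarith
    qed auto
  next
    case False
    then obtain A where A: "A \<subset> V" "A \<noteq> {}"
      "card V = card A + card (V - A)" "card (ind E V) = card (ind E A) + card (ind E (V - A))"
      using not_connE[OF less.prems(1)] by metis
    have fin: "finite V" using sgr_finite_verts less.prems by blast
    have IH: "2 * card (ind E W) + deficit k (card W) \<le> 2 * k * card W" if "W \<subset> V" for W
      using that psubset_card_mono[OF fin that] sgr_ind[OF less.prems(1)] pfree_subset[OF less.prems(2) ind_subset]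
      by (intro less.hyps) auto
    have "2 * card (ind E A) + deficit k (card A) \<le> 2 * k * card A" using IH A by blast
    moreover have "2 * card (ind E (V - A)) + deficit k (card (V - A)) \<le> 2 * k * card (V - A)"
      using IH A by blast
    moreover have "deficit k (card V) \<le> deficit k (card A) + deficit k (card (V - A))"
      unfolding A(3) by (rule deficit_add)
    ultimately show ?thesis using A(3,4) ind_self[OF less.prems(1)] by (simp add: distrib_left)
  qed
qed

section \<open>Decomposition into components\<close>

definition components :: "'a set set \<Rightarrow> 'a set \<Rightarrow> 'a set set \<Rightarrow> bool" where
  "components E V \<C> \<longleftrightarrow> finite \<C> \<and> (\<forall>C\<in>\<C>. \<forall>D\<in>\<C>. C \<noteq> D \<longrightarrow> C \<inter> D = {}) \<and> \<Union>\<C> = V \<and>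
     (\<forall>C\<in>\<C>. C \<noteq> {} \<and> conn E C \<and> (\<forall>u\<in>C. \<forall>v\<in>V - C. {u, v} \<notin> E))"

lemma ex_components:
  assumes "sgr V E"
  shows "\<exists>\<C>. components E V \<C>"
  using assms
proof (induction "card V" arbitrary: V E rule: less_induct)
  case less
  show ?case
  proof (cases "conn E V")
    case True
    then have "components E V (if V = {} then {} else {V})"
      by (auto simp: components_def)
    then show ?thesis by blast
  next
    case False
    then obtain A where A: "A \<subset> V" "A \<noteq> {}" "\<And>u v. u \<in> A \<Longrightarrow> v \<in> V - A \<Longrightarrow> {u, v} \<notin> E"
      using not_connE[OF less.prems] by metis
    have fin: "finite V" using sgr_finite_verts less.prems by blast
    have IH: "\<exists>\<C>. components (ind E W) W \<C>" if "W \<subset> V" for W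
      using that psubset_card_mono[OF fin that] sgr_ind[OF less.prems(1)] by (intro less.hyps) auto
    obtain \<A> where \<A>: "components (ind E A) A \<A>" using IH A by blast
    obtain \<B> where \<B>: "components (ind E (V - A)) (V - A) \<B>" using IH[of "V - A"] A by blast
    have "components E V (\<A> \<union> \<B>)"
      unfolding components_def
    proof (intro conjI ballI)
      show "finite (\<A> \<union> \<B>)" "\<Union>(\<A> \<union> \<B>) = V" using \<A> \<B> A by (auto simp: components_def)
      have cross: "C \<inter> D = {}" if "C \<in> \<A>" "D \<in> \<B>" for C D
        using that \<A> \<B> unfolding components_def by blast
      show "C \<noteq> D \<longrightarrow> C \<inter> D = {}" if "C \<in> \<A> \<union> \<B>" "D \<in> \<A> \<union> \<B>" for C D
      proof -
        have "C \<inter> D = {}" if "C \<noteq> D" "C \<in> \<A>" "D \<in> \<A>"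
          using that \<A> unfolding components_def by blast
        moreover have "C \<inter> D = {}" if "C \<noteq> D" "C \<in> \<B>" "D \<in> \<B>"
          using that \<B> unfolding components_def by blast
        ultimately show ?thesis
          using \<open>C \<in> \<A> \<union> \<B>\<close> \<open>D \<in> \<A> \<union> \<B>\<close> cross[of C D] cross[of D C] by blast
      qed
      fix C assume "C \<in> \<A> \<union> \<B>"
      then show "C \<noteq> {}" using \<A> \<B> by (auto simp: components_def)
      show "conn E C"
      proof -
        have "conn (ind E A) C \<or> conn (ind E (V - A)) C"
          using \<open>C \<in> \<A> \<union> \<B>\<close> \<A> \<B> unfolding components_def by blast
        then show ?thesis by (metis conn_mono ind_subset)
      qed
      fix u v assume uv: "u \<in> C" "v \<in> V - C"
      show "{u, v} \<notin> E"
      proof (cases "C \<in> \<A>")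
        case True
        then have uA: "u \<in> A" and "v \<in> A \<longrightarrow> {u, v} \<notin> ind E A"
          using \<A> uv unfolding components_def by blast+
        then show ?thesis using A(3)[OF uA, of v] uv(2) unfolding pair_in_ind by blast
      next
        case False
        then have "C \<in> \<B>" using \<open>C \<in> \<A> \<union> \<B>\<close> by simp
        then have uA: "u \<in> V - A" and "v \<in> V - A \<longrightarrow> {u, v} \<notin> ind E (V - A)"
          using \<B> uv unfolding components_def by blast+
        then show ?thesis
          using A(3)[of v u] uv(2) unfolding pair_in_ind by (auto simp: insert_commute)
      qed
    qed
    then show ?thesis by blast
  qed
qed

lemma components_sums:
  assumes "sgr V E" "components E V \<C>"
  shows "card V = (\<Sum>C\<in>\<C>. card C)" "card E = (\<Sum>C\<in>\<C>. card (ind E C))"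
proof -
  have fin: "finite V" using assms sgr_finite_verts by blast
  have finC: "finite \<C>" and sub: "\<And>C. C \<in> \<C> \<Longrightarrow> C \<subseteq> V" using assms(2) by (auto simp: components_def)
  have dis: "C \<inter> D = {}" if "C \<in> \<C>" "D \<in> \<C>" "C \<noteq> D" for C D
    using assms(2) that unfolding components_def by blast
  have "card (\<Union>\<D>) = (\<Sum>C\<in>\<D>. card C) \<and> card (ind E (\<Union>\<D>)) = (\<Sum>C\<in>\<D>. card (ind E C))" if "\<D> \<subseteq> \<C>" for \<D>
    using finite_subset[OF that finC] that
  proof (induction \<D> rule: finite_induct)
    case empty
    then show ?case by (simp add: ind_empty[OF assms(1)])
  next
    case (insert C \<D>)
    have "C \<subseteq> V" "\<Union>\<D> \<subseteq> V" using insert.prems sub by blast+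
    then have finD: "finite C" "finite (\<Union>\<D>)" using fin by (meson finite_subset)+
    have "C \<inter> D = {}" if "D \<in> \<D>" for D
      using dis[of C D] that insert.hyps(2) insert.prems by auto
    then have dj: "C \<inter> \<Union>\<D> = {}" by blast
    have no: "{u, v} \<notin> E" if "u \<in> C" "v \<in> \<Union>\<D>" for u v
    proof -
      have "C \<in> \<C>" "v \<in> V - C" using insert.prems that dj sub by auto
      then show ?thesis using assms(2) that unfolding components_def by blast
    qed
    show ?case
      using insert card_Un_disjoint[OF finD dj] card_ind_Un_separated[OF assms(1) finD dj no] by simp
  qed
  from this[of \<C>] show "card V = (\<Sum>C\<in>\<C>. card C)" "card E = (\<Sum>C\<in>\<C>. card (ind E C))"
    using assms(2) ind_self[OF assms(1)] by (auto simp: components_def)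
qed

section \<open>Connected extremal graphs for a path\<close>

lemma gpath_rotate:
  assumes "gpath E cs" "{last cs, hd cs} \<in> E" "u \<in> set cs"
  obtains ds where "gpath E (u # ds)" "set (u # ds) = set cs" "length (u # ds) = length cs"
proof -
  obtain as bs where cs: "cs = as @ u # bs" using assms(3) by (meson split_list)
  have "gpath E ((u # bs) @ as)"
    using assms(1,2) unfolding cs by (cases as) (auto simp: gpath_append gpath_Cons hd_append split: if_splits)
  then show ?thesis using that[of "bs @ as"] cs by auto
qed

text \<open>Ore's exchange: if \<open>P ! Suc i\<close> is adjacent to the first vertex and
  \<open>P ! i\<close> to the last, then \<open>P\<close> closes to a cycle on the same vertices,
  and by connectivity a vertex outside prolongs it. So \<open>I\<close> and \<open>J\<close> are
  disjoint sets of positions before the last one.\<close>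

lemma longest_path_ends:
  assumes sgr: "sgr V E" and conn: "conn E V" and free: "pfree E (Suc (length P))"
    and P: "gpath E P" "P \<noteq> []" "set P \<subset> V"
  shows "nb E V (hd P) \<subseteq> set P" "card (nb E V (hd P)) + card (nb E V (last P)) < length P"
proof -
  have ext: False if "gpath E xs" "length xs = Suc (length P)" for xs
    using pfreeD[OF free that(1)] that(2) by simp
  show hdP: "nb E V (hd P) \<subseteq> set P"
  proof
    fix z assume z: "z \<in> nb E V (hd P)"
    show "z \<in> set P"
      using ext[of "z # P"] z P by (auto simp: gpath_Cons nb_def insert_commute)
  qed
  have lastP: "nb E V (last P) \<subseteq> set P"
  proof
    fix z assume z: "z \<in> nb E V (last P)"
    show "z \<in> set P"
      using ext[of "P @ [z]"] z P by (auto simp: gpath_append nb_def)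
  qed
  define n where "n = length P"
  define I where "I = {i. Suc i < n \<and> P ! Suc i \<in> nb E V (hd P)}"
  define J where "J = {i. Suc i < n \<and> P ! i \<in> nb E V (last P)}"
  have "nb E V (hd P) \<subseteq> (\<lambda>i. P ! Suc i) ` I"
  proof
    fix z assume z: "z \<in> nb E V (hd P)"
    then obtain i where i: "i < n" "z = P ! i" using hdP by (metis in_set_conv_nth n_def subsetD)
    have "i \<noteq> 0" using i z nb_self[OF sgr, of "hd P" V] P(2) by (metis hd_conv_nth)
    then obtain j where "i = Suc j" by (cases i) auto
    then show "z \<in> (\<lambda>i. P ! Suc i) ` I" using i z by (auto simp: I_def)
  qed
  moreover have "finite I" "finite J"
    by (rule finite_subset[of _ "{..<n}"]; force simp: I_def J_def)+
  ultimately have cI: "card (nb E V (hd P)) \<le> card I"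
    by (meson card_image_le card_mono finite_imageI le_trans)
  have "nb E V (last P) \<subseteq> (!) P ` J"
  proof
    fix z assume z: "z \<in> nb E V (last P)"
    then obtain i where i: "i < n" "z = P ! i" using lastP by (metis in_set_conv_nth n_def subsetD)
    have "i \<noteq> n - 1" using i z nb_self[OF sgr, of "last P" V] P(2) by (metis last_conv_nth n_def)
    then show "z \<in> (!) P ` J" using i z by (auto simp: J_def)
  qed
  with \<open>finite J\<close> have cJ: "card (nb E V (last P)) \<le> card J"
    by (meson card_image_le card_mono finite_imageI le_trans)
  have "I \<inter> J = {}"
  proof (rule ccontr)
    assume "I \<inter> J \<noteq> {}"
    then obtain i where i: "Suc i < n" "P ! Suc i \<in> nb E V (hd P)" "P ! i \<in> nb E V (last P)"
      by (auto simp: I_def J_def)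
    define a where "a = take (Suc i) P"
    define b where "b = drop (Suc i) P"
    have ab: "P = a @ b" by (simp add: a_def b_def)
    have ne: "a \<noteq> []" "b \<noteq> []" using i by (auto simp: a_def b_def n_def)
    have "last a = P ! i" "hd b = P ! Suc i"
      using i by (auto simp: a_def b_def n_def take_Suc_conv_app_nth hd_drop_conv_nth)
    then have e: "{last a, last b} \<in> E" "{hd b, hd a} \<in> E"
      using i ne by (auto simp: ab nb_def insert_commute)
    have c: "gpath E (a @ rev b)"
      using P(1) ne e unfolding ab by (auto simp: gpath_append hd_rev)
    obtain u v where uv: "u \<in> set P" "v \<in> V - set P" "{u, v} \<in> E"
      using conn P unfolding conn_def by (metis psubset_eq set_empty)
    then obtain ds where ds: "gpath E (u # ds)" "set (u # ds) = set P" "length (u # ds) = length P"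
      using gpath_rotate[OF c, of u] e(2) ne by (auto simp: ab last_rev)
    then have "gpath E (v # u # ds)"
      using uv by (auto simp: gpath_Cons insert_commute)
    then show False using ext[of "v # u # ds"] ds by simp
  qed
  then have "card I + card J = card (I \<union> J)"
    using \<open>finite I\<close> \<open>finite J\<close> by (simp add: card_Un_disjoint)
  also have "\<dots> \<le> card {..<n - 1}" by (intro card_mono) (auto simp: I_def J_def)
  finally show "card (nb E V (hd P)) + card (nb E V (last P)) < length P"
    using cI cJ P(2) by (cases P) (auto simp: n_def)
qed

lemma ex_longest_path:
  assumes "V \<noteq> {}" "sgr V E" "pfree E l"
  obtains P where "gpath E P" "P \<noteq> []" "set P \<subseteq> V" "pfree E (Suc (length P))" "length P < l"
proof -
  define Q where "Q n \<longleftrightarrow> (\<exists>P. gpath E P \<and> P \<noteq> [] \<and> set P \<subseteq> V \<and> length P = n)" for n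
  obtain x where "x \<in> V" using assms(1) by auto
  then have Q1: "Q 1" unfolding Q_def by (intro exI[of _ "[x]"]) auto
  have bound: "\<And>n. Q n \<Longrightarrow> n \<le> l" using pfreeD[OF assms(3)] by (force simp: Q_def)
  have max: "\<And>n. Q n \<Longrightarrow> n \<le> Greatest Q" and "Q (Greatest Q)"
    using Greatest_le_nat[of Q _ l] GreatestI_nat[of Q 1 l] Q1 bound by auto
  then obtain P where P: "gpath E P" "P \<noteq> []" "set P \<subseteq> V" "length P = Greatest Q"
    by (auto simp: Q_def)
  have "length xs < Suc (length P)" if "gpath E xs" for xs
  proof (cases "2 \<le> length xs")
    case True
    then have "Q (length xs)" using that gpath_subset[OF assms(2) that True] by (auto simp: Q_def)
    then show ?thesis using max P(4) by (metis le_imp_less_Suc)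
  next
    case False
    then show ?thesis using P(2) by (cases P) auto
  qed
  then show ?thesis using that P pfreeD[OF assms(3) P(1)] by (simp add: pfree_def)
qed

lemma gpath_one_side:
  assumes "gpath E xs" "set xs \<subseteq> A \<union> B" "\<And>u v. u \<in> A \<Longrightarrow> v \<in> B \<Longrightarrow> {u, v} \<notin> E"
  shows "set xs \<subseteq> A \<or> set xs \<subseteq> B"
  using assms(1,2)
proof (induction xs)
  case (Cons x xs)
  show ?case
  proof (cases xs)
    case Nil
    then show ?thesis using Cons.prems by auto
  next
    case (Cons y ys)
    then have e: "{x, y} \<in> E" using Cons.prems by (auto simp: gpath_Cons)
    have "set xs \<subseteq> A \<or> set xs \<subseteq> B" using Cons.IH Cons.prems by (auto simp: gpath_Cons)
    then show ?thesis
    proof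
      assume "set xs \<subseteq> A"
      then show ?thesis using assms(3)[of y x] e Cons Cons.prems(2) by (auto simp: insert_commute)
    next
      assume "set xs \<subseteq> B"
      then show ?thesis using assms(3)[of x y] e Cons Cons.prems(2) by auto
    qed
  qed
qed simp

text \<open>Suppose that V - {v} had a cut without edges. The rest of the path would lie on one side
  of it, and so would all neighbours of \<open>v\<close>; the other side would then be cut off in
  \<open>V\<close> as well.\<close>

lemma conn_remove_path_end:
  assumes conn: "conn E V" and P: "gpath E (v # xs)" "set (v # xs) \<subseteq> V"
    and nb: "nb E V v \<subseteq> set (v # xs)" and v: "{v} \<notin> E"
  shows "conn E (V - {v})"
  unfolding conn_def
proof (intro allI impI, rule ccontr)
  fix A assume A: "A \<subseteq> V - {v}" "A \<noteq> {}" "A \<noteq> V - {v}"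
    and no: "\<not> (\<exists>u\<in>A. \<exists>w\<in>V - {v} - A. {u, w} \<in> E)"
  define B where "B = V - {v} - A"
  have B: "B \<noteq> {}" "B \<subseteq> V" "v \<notin> B" "A \<inter> B = {}" using A by (auto simp: B_def)
  have no': "{u, w} \<notin> E" "{w, u} \<notin> E" if "u \<in> A" "w \<in> B" for u w
    using no that by (auto simp: B_def insert_commute)
  have xs: "gpath E xs" "set xs \<subseteq> A \<union> B" using P by (auto simp: gpath_Cons B_def)
  have vn: "v \<in> V" "v \<notin> A" using P A by auto
  have nbxs: "w \<in> set xs" if "{v, w} \<in> E" "w \<in> V" for w
    using nb v that by (auto simp: nb_def)
  have cut: False if "C \<subseteq> V - {v}" "C \<noteq> {}" "set xs \<inter> C = {}"
    "\<And>u w. u \<in> C \<Longrightarrow> w \<in> V - {v} - C \<Longrightarrow> {u, w} \<notin> E" for C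
  proof -
    have "C \<noteq> V" using \<open>C \<subseteq> V - {v}\<close> vn by auto
    then obtain u w where uw: "u \<in> C" "w \<in> V - C" "{u, w} \<in> E"
      using conn \<open>C \<subseteq> V - {v}\<close> \<open>C \<noteq> {}\<close> unfolding conn_def by blast
    then have "w = v" using \<open>\<And>u w. u \<in> C \<Longrightarrow> w \<in> V - {v} - C \<Longrightarrow> {u, w} \<notin> E\<close> by auto
    then have "u \<in> set xs" using nbxs[of u] uw \<open>C \<subseteq> V - {v}\<close> by (auto simp: insert_commute)
    then show False using \<open>set xs \<inter> C = {}\<close> uw by auto
  qed
  from gpath_one_side[OF xs no'(1)] show False
  proof
    assume "set xs \<subseteq> A"
    moreover have "V - {v} - B = A" "B \<subseteq> V - {v}" using A by (auto simp: B_def)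
    ultimately show False using cut[of B] B no' by blast
  next
    assume "set xs \<subseteq> B"
    moreover have "V - {v} - A = B" by (simp add: B_def)
    ultimately show False using cut[of A] A B no' by blast
  qed
qed

text \<open>Vertices of \<open>X\<close> and \<open>U\<close> alternate, beginning and ending in
  \<open>X\<close> and using up \<open>U\<close>, so \<open>X\<close> has to be larger than
  \<open>U\<close>.\<close>

lemma alternating_path:
  assumes "finite U" "finite X" "U \<inter> X = {}" "card U < card X" "x \<in> X"
    "\<And>u y. u \<in> U \<Longrightarrow> y \<in> X \<Longrightarrow> {u, y} \<in> E"
  obtains xs where "gpath E (x # xs)" "set (x # xs) \<subseteq> U \<union> X" "length xs = 2 * card U"
proof -
  have "\<exists>xs. gpath E (x # xs) \<and> set (x # xs) \<subseteq> U \<union> X \<and> length xs = 2 * card U"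
    using assms
  proof (induction U arbitrary: X x rule: finite_induct)
    case empty
    then show ?case by (intro exI[of _ "[]"]) auto
  next
    case (insert u U)
    have "card (X - {x}) = card X - 1" using insert.prems by simp
    then have c: "card U < card (X - {x})" using insert by simp
    then have "X - {x} \<noteq> {}" by (metis card.empty not_less_zero)
    then obtain y where y: "y \<in> X - {x}" by auto
    obtain xs where xs: "gpath E (y # xs)" "set (y # xs) \<subseteq> U \<union> (X - {x})" "length xs = 2 * card U"
      using insert.IH[of "X - {x}" y] insert.prems c y by auto
    have "gpath E (x # u # y # xs)"
      using xs insert.hyps insert.prems y by (auto simp: gpath_Cons insert_commute)
    moreover have "set (x # u # y # xs) \<subseteq> insert u U \<union> X" using xs insert.prems by auto
    ultimately show ?case using xs(3) insert.hyps by (intro exI[of _ "u # y # xs"]) auto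
  qed
  then show ?thesis using that by blast
qed

lemma full_clique:
  assumes "sgr V E" "finite U" "card U * (card U - 1) \<le> 2 * card (ind E U)" "x \<in> U" "y \<in> U" "x \<noteq> y"
  shows "{x, y} \<in> E"
proof -
  let ?P = "{e. e \<subseteq> U \<and> card e = 2}"
  have sub: "ind E U \<subseteq> ?P" using assms(1) by (auto simp: ind_def sgr_def)
  have "card ?P = card U * (card U - 1) div 2"
    using n_subsets[OF assms(2), of 2] by (simp add: choose_two)
  then have "card ?P \<le> card (ind E U)" using assms(3) by linarith
  moreover have fin: "finite ?P" using assms(2) by simp
  ultimately have "ind E U = ?P" using sub by (metis card_subset_eq card_mono le_antisym)
  moreover have "{x, y} \<in> ?P" using assms by auto
  ultimately show ?thesis by (auto simp: ind_def)
qed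

text \<open>\<open>X\<close> consists of \<open>z\<close>, the first vertex of \<open>P\<close> and the successors on \<open>P\<close> of the neighbours of \<open>z\<close>:
  an edge inside \<open>X\<close> would allow \<open>z\<close> to be inserted into \<open>P\<close>.\<close>

lemma near_hamiltonian_independent:
  assumes sgr: "sgr V E" and P: "gpath E P" "P \<noteq> []" and z: "z \<notin> set P" "V = insert z (set P)"
    and free: "pfree E (card V)"
  obtains X where "X \<subseteq> V" "card X = card (nb E V z) + 2" "\<And>x y. x \<in> X \<Longrightarrow> y \<in> X \<Longrightarrow> {x, y} \<notin> E"
proof -
  define n where "n = length P"
  have cV: "card V = Suc n" using z gpath_distinct[OF P(1)] by (simp add: n_def distinct_card)
  have dP: "distinct P" using gpath_distinct[OF P(1)] .
  have ext: False if "gpath E xs" "length xs = Suc n" for xs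
    using pfreeD[OF free that(1)] that(2) cV by simp
  define I where "I = {i. i < n \<and> P ! i \<in> nb E V z}"
  have nI: "nb E V z = (!) P ` I"
    using nb_self[OF sgr, of z V] nb_subset[of E V z] z by (auto simp: I_def n_def in_set_conv_nth image_iff) (metis insertE in_set_conv_nth subsetD)
  have injP: "inj_on ((!) P) {..<n}" using dP by (auto simp: inj_on_def n_def nth_eq_iff_index_eq)
  then have cI: "card (nb E V z) = card I"
    unfolding nI by (intro card_image) (auto simp: I_def inj_on_def)
  have Iz: "{z, P ! i} \<in> E" if "i \<in> I" for i using that by (auto simp: I_def nb_def)
  have last: "Suc i < n" if "i \<in> I" for i
  proof (rule ccontr)
    assume "\<not> Suc i < n"
    then have "i = n - 1" using that by (auto simp: I_def)
    then have "P ! i = last P" using P(2) by (simp add: last_conv_nth n_def)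
    then have "gpath E (P @ [z])" using Iz[OF that] P z by (auto simp: gpath_append insert_commute)
    then show False using ext[of "P @ [z]"] by (simp add: n_def)
  qed
  have n0: "0 < n" using P by (simp add: n_def)
  have split: "\<exists>a b. P = a @ b \<and> a \<noteq> [] \<and> b \<noteq> [] \<and> last a = P ! i \<and> hd b = P ! Suc i \<and> length a = Suc i"
    if "i \<in> I" for i
  proof -
    have "P = take (Suc i) P @ drop (Suc i) P" by simp
    moreover have "take (Suc i) P \<noteq> []" "drop (Suc i) P \<noteq> []" "length (take (Suc i) P) = Suc i"
      using last[OF that] by (auto simp: n_def)
    moreover have "last (take (Suc i) P) = P ! i" "hd (drop (Suc i) P) = P ! Suc i"
      using last[OF that] by (auto simp: n_def take_Suc_conv_app_nth hd_drop_conv_nth)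
    ultimately show ?thesis by blast
  qed
  define J where "J = insert 0 (Suc ` I)"
  define X where "X = insert z ((!) P ` J)"
  have Jn: "J \<subseteq> {..<n}" using last n0 by (auto simp: J_def)
  have finI: "finite I" by (simp add: I_def)
  have "card J = Suc (card I)" using finI by (simp add: J_def card_image)
  moreover have "card ((!) P ` J) = card J" using injP Jn by (intro card_image) (rule inj_on_subset)
  moreover have "z \<notin> (!) P ` J" using z Jn by (auto simp: n_def)
  ultimately have cX: "card X = card (nb E V z) + 2" using cI finI by (simp add: X_def J_def)
  have XV: "X \<subseteq> V" using Jn z by (auto simp: X_def n_def)
  have z0: "{z, P ! 0} \<notin> E"
  proof
    assume "{z, P ! 0} \<in> E"
    then have "gpath E (z # P)" using P z by (auto simp: gpath_Cons hd_conv_nth)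
    then show False using ext[of "z # P"] by (simp add: n_def)
  qed
  have zS: "{z, P ! Suc i} \<notin> E" if iI: "i \<in> I" for i
  proof
    assume e: "{z, P ! Suc i} \<in> E"
    obtain a b where ab: "P = a @ b" "a \<noteq> []" "b \<noteq> []" "last a = P ! i" "hd b = P ! Suc i"
      using split[OF iI] by blast
    have "gpath E (a @ z # b)"
      using P(1) z(1) e Iz[OF iI] ab by (auto simp: gpath_append gpath_Cons insert_commute)
    then show False using ext[of "a @ z # b"] ab by (simp add: n_def)
  qed
  have S0: "{P ! 0, P ! Suc i} \<notin> E" if iI: "i \<in> I" for i
  proof
    assume e: "{P ! 0, P ! Suc i} \<in> E"
    obtain a b where ab: "P = a @ b" "a \<noteq> []" "b \<noteq> []" "last a = P ! i" "hd b = P ! Suc i"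
      using split[OF iI] by blast
    have "hd a = P ! 0" using ab by (simp add: hd_conv_nth nth_append)
    then have "gpath E ((z # rev a) @ b)"
      using P(1) z(1) e Iz[OF iI] ab by (auto simp: gpath_append gpath_Cons last_rev hd_rev)
    then show False using ext[of "(z # rev a) @ b"] ab by (simp add: n_def)
  qed
  \<comment> \<open>The forbidden path runs to \<open>P ! i\<close>, through \<open>z\<close> to
    \<open>P ! j\<close>, back to \<open>P ! Suc i\<close> and over the supposed edge to
    \<open>P ! Suc j\<close>.\<close>
  have SS: "{P ! Suc i, P ! Suc j} \<notin> E" if iI: "i \<in> I" and jI: "j \<in> I" and ij: "i < j" for i j
  proof
    assume e: "{P ! Suc i, P ! Suc j} \<in> E"
    obtain d b where db: "P = d @ b" "d \<noteq> []" "b \<noteq> []" "last d = P ! j" "hd b = P ! Suc j" "length d = Suc j"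
      using split[OF jI] by blast
    define a where "a = take (Suc i) d"
    define c where "c = drop (Suc i) d"
    have dac: "d = a @ c" by (simp add: a_def c_def)
    have ne: "a \<noteq> []" "c \<noteq> []" using ij db(6) by (auto simp: a_def c_def)
    have la: "last a = P ! i"
      using ij db(1,6) by (simp add: a_def take_Suc_conv_app_nth nth_append)
    have hc: "hd c = P ! Suc i"
      using ij db(1,6) by (simp add: c_def hd_drop_conv_nth nth_append)
    have lc: "last c = P ! j" using db(4) dac ne by simp
    have "gpath E (a @ z # rev c @ b)"
      using P(1) z(1) e Iz[OF iI] Iz[OF jI] db(3,5) ne la hc lc unfolding db(1) dac
      by (auto simp: gpath_append gpath_Cons last_rev hd_rev insert_commute)
    then show False using ext[of "a @ z # rev c @ b"] by (simp add: n_def db(1) dac)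
  qed
  have loop: "{x} \<notin> E" for x using sgr_edge(3)[OF sgr, of x x] by auto
  have "{P ! i, P ! j} \<notin> E" if "i \<in> J" "j \<in> J" for i j
  proof (cases i j rule: linorder_cases)
    case less
    then show ?thesis using that S0 SS by (auto simp: J_def)
  next
    case equal
    then show ?thesis using loop by simp
  next
    case greater
    then have "{P ! j, P ! i} \<notin> E" using that S0 SS by (auto simp: J_def)
    then show ?thesis by (simp add: insert_commute)
  qed
  moreover have "{z, P ! i} \<notin> E" if "i \<in> J" for i using that z0 zS by (auto simp: J_def)
  ultimately have "{x, y} \<notin> E" if "x \<in> X" "y \<in> X" for x y
    using that loop by (auto simp: X_def insert_commute)
  then show ?thesis using that XV cX by blast
qed

text \<open>Induction on the order, deleting an end of a longest path. Equality in
  \<open>degenerate_edges\<close> forces minimum degree \<open>k\<close>; a longest path then has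
  exactly 2k+1 vertices, and deleting its first vertex, of degree \<open>k\<close>, preserves
  connectivity and equality. In the base case of 2k+2 vertices the path misses a single vertex, so
  \<open>near_hamiltonian_independent\<close> applies.\<close>

theorem extremal_structure:
  assumes "sgr V E" "conn E V" "pfree E (2 * k + 2)" "degenerate E V k"
    "2 * k * card V \<le> 2 * card E + k * (k + 1)" "2 * k + 2 \<le> card V"
  shows "\<exists>U\<subseteq>V. card U = k \<and> (\<forall>u\<in>U. \<forall>v\<in>V. u \<noteq> v \<longrightarrow> {u, v} \<in> E) \<and>
    (\<forall>u\<in>V - U. \<forall>v\<in>V - U. {u, v} \<notin> E)"
  using assms
proof (induction "card V" arbitrary: V E rule: less_induct)
  case less
  note sgr = less.prems(1) and conn = less.prems(2) and free = less.prems(3) and degen = less.prems(4)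
    and edges = less.prems(5) and big = less.prems(6)
  have fin: "finite V" using sgr sgr_finite_verts by blast
  have E: "ind E V = E" using ind_self[OF sgr] .
  \<comment> \<open>Deleting a vertex of degree below \<open>k\<close> would leave more edges than
    degeneracy permits.\<close>
  have mindeg: "k \<le> card (nb E V v)" if "v \<in> V" for v
  proof -
    have c: "card V = Suc (card (V - {v}))" using that fin by (metis card_Suc_Diff1)
    have "2 * card (ind E (V - {v})) + k * (k + 1) \<le> 2 * k * card (V - {v})"
      using degenerate_edges[OF sgr degen, of "V - {v}"] c big by auto
    moreover have "card E = card (ind E (V - {v})) + card (nb E V v)"
      using card_ind_remove[OF sgr fin that] E by simp
    moreover have "2 * k * card V = 2 * k * card (V - {v}) + 2 * k" using c by simp
    ultimately show ?thesis using edges by linarith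
  qed
  have "V \<noteq> {}" using big by auto
  then obtain P where P: "gpath E P" "P \<noteq> []" "set P \<subseteq> V" "pfree E (Suc (length P))" "length P < 2 * k + 2"
    using ex_longest_path[OF _ sgr free] by blast
  have cP: "card (set P) = length P" using gpath_distinct[OF P(1)] by (rule distinct_card)
  then have PV: "set P \<subset> V" using P(3,5) big by auto
  note ends = longest_path_ends[OF sgr conn P(4,1,2) PV]
  have hdV: "hd P \<in> V" "last P \<in> V" using P by auto
  \<comment> \<open>Both end degrees are at least \<open>k\<close>, and their sum is less than
    \<open>length P\<close>, which is at most 2k+1; so everything is tight.\<close>
  have lenP: "length P = 2 * k + 1" and deg: "card (nb E V (hd P)) = k"
    using ends(2) mindeg[OF hdV(1)] mindeg[OF hdV(2)] P(5) by linarith+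
  show ?case
  proof (cases "card V = 2 * k + 2")
    case True
    have "card (V - set P) = 1" using True PV cP lenP fin by (simp add: card_Diff_subset)
    then obtain z where z: "V - set P = {z}" by (meson card_1_singletonE)
    then have zP: "z \<notin> set P" "V = insert z (set P)" using PV by auto
    obtain X where X: "X \<subseteq> V" "card X = card (nb E V z) + 2"
      "\<And>x y. x \<in> X \<Longrightarrow> y \<in> X \<Longrightarrow> {x, y} \<notin> E"
      using near_hamiltonian_independent[OF sgr P(1,2) zP] free True by metis
    define U where "U = V - X"
    have finU: "finite U" "finite X" using fin X(1) finite_subset by (auto simp: U_def)
    have cU: "card U + card X = 2 * k + 2"
      using X(1) finU card_mono[OF fin X(1)] True by (simp add: U_def card_Diff_subset)
    have nbU: "nb E V x \<subseteq> U" if "x \<in> X" for x using X(3)[OF that] by (auto simp: nb_def U_def)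
    have "k \<le> card (nb E V z)" using mindeg zP by auto
    then have "X \<noteq> {}" using X(2) by auto
    then obtain x where "x \<in> X" by auto
    then have "k \<le> card U" using nbU mindeg[of x] X(1) card_mono[OF finU(1) nbU] by fastforce
    then have ck: "card U = k" "card X = k + 2" using cU X(2) \<open>k \<le> card (nb E V z)\<close> by auto
    have nbX: "nb E V x = U" if "x \<in> X" for x
      using nbU[OF that] mindeg[of x] that X(1) ck finU by (intro card_subset_eq) (auto intro: le_antisym card_mono)
    \<comment> \<open>The k+2 vertices of \<open>X\<close> account for at most k(k+2) edges. The
      edge count leaves at least k(k-1)/2 edges for \<open>U\<close>, which makes \<open>U\<close> a
      clique.\<close>
    have "card (ind E V) \<le> card (ind E U) + k * card (V - U)"
    proof (rule peel[OF sgr])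
      fix B assume B: "U \<subset> B" "B \<subseteq> V"
      then obtain v where v: "v \<in> B - U" by auto
      then have "v \<in> X" using B by (auto simp: U_def)
      then have "nb E B v \<subseteq> U" using nbU nb_mono[OF B(2)] by blast
      then have "card (nb E B v) \<le> k" using card_mono[OF finU(1)] ck by metis
      then show "\<exists>v\<in>B - U. card (nb E B v) \<le> k" using v by auto
    qed (auto simp: U_def)
    moreover have "V - U = X" using X(1) by (auto simp: U_def)
    ultimately have "card E \<le> card (ind E U) + k * (k + 2)" using E ck by simp
    then have "2 * k * (2 * k + 2) \<le> 2 * card (ind E U) + 2 * (k * (k + 2)) + k * (k + 1)"
      using edges True by simp
    moreover have "2 * k * (2 * k + 2) = k * (k - 1) + 2 * (k * (k + 2)) + k * (k + 1)"
      by (cases k) (auto simp: algebra_simps)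
    ultimately have full: "card U * (card U - 1) \<le> 2 * card (ind E U)"
      unfolding ck by linarith
    have "{u, v} \<in> E" if "u \<in> U" "v \<in> V" "u \<noteq> v" for u v
    proof (cases "v \<in> U")
      case True
      then show ?thesis using full_clique[OF sgr finU(1) full] that by blast
    next
      case False
      then have "v \<in> X" using that by (auto simp: U_def)
      then have "u \<in> nb E V v" using nbX that by auto
      then show ?thesis by (auto simp: nb_def insert_commute)
    qed
    moreover have "{u, v} \<notin> E" if "u \<in> V - U" "v \<in> V - U" for u v
      using that X(3) by (auto simp: U_def)
    ultimately show ?thesis using ck by (intro exI[of _ U]) (auto simp: U_def)
  next
    case False
    define v where "v = hd P"
    define W where "W = V - {v}"
    have vV: "v \<in> V" using hdV by (simp add: v_def)
    have finW: "finite W" using fin by (simp add: W_def)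
    have cW: "card V = Suc (card W)" using card_Suc_Diff1[OF fin vV] by (simp add: W_def)
    have VW: "insert v W = V" "v \<notin> W" "W \<subseteq> V" using vV by (auto simp: W_def)
    obtain xs where Pxs: "P = v # xs" using P(2) by (cases P) (auto simp: v_def)
    have loop: "{x} \<notin> E" for x using sgr_edge(3)[OF sgr, of x x] by auto
    have "conn E W"
      unfolding W_def
      by (rule conn_remove_path_end[OF conn P(1,3)[unfolded Pxs]])
        (use ends(1) loop in \<open>auto simp: Pxs\<close>)
    then have conn': "conn (ind E W) W" by (simp add: conn_ind)
    have e: "card E = card (ind E W) + k"
      using card_ind_remove[OF sgr fin vV] E deg by (simp add: W_def v_def)
    have nbW: "nb E W v = nb E V v" using nb_self[OF sgr] by (auto simp: nb_def W_def)
    have "degenerate (ind E W) W k"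
      by (rule degenerate_anti[OF degen ind_subset VW(3) fin])
    moreover have "2 * k * card W \<le> 2 * card (ind E W) + k * (k + 1)"
      using edges e cW by simp
    moreover have big': "2 * k + 2 \<le> card W" using big False cW by simp
    ultimately have "\<exists>U\<subseteq>W. card U = k \<and> (\<forall>u\<in>U. \<forall>v\<in>W. u \<noteq> v \<longrightarrow> {u, v} \<in> ind E W) \<and>
        (\<forall>u\<in>W - U. \<forall>v\<in>W - U. {u, v} \<notin> ind E W)"
      using cW sgr_ind[OF sgr VW(3)] conn' pfree_subset[OF free ind_subset] by (intro less.hyps) auto
    then obtain U where U: "U \<subseteq> W" "card U = k"
      "\<forall>u\<in>U. \<forall>v\<in>W. u \<noteq> v \<longrightarrow> {u, v} \<in> ind E W"
      "\<forall>u\<in>W - U. \<forall>v\<in>W - U. {u, v} \<notin> ind E W"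
      by blast
    have finU: "finite U" using U(1) finW finite_subset by blast
    \<comment> \<open>A neighbour of \<open>v\<close> in the independent part would start an
      alternating path through all of \<open>U\<close> on 2k+1 vertices, and \<open>v\<close> in
      front of it makes 2k+2.\<close>
    have "nb E V v \<subseteq> U"
    proof (rule ccontr)
      assume "\<not> nb E V v \<subseteq> U"
      then obtain w where w: "w \<in> W - U" "{v, w} \<in> E"
        using nbW nb_subset[of E W v] by (auto simp: nb_def)
      have "card (W - U) = card W - k" using U finU by (simp add: card_Diff_subset)
      then have "card U < card (W - U)" using big' U(2) by simp
      moreover have "{u, y} \<in> E" if "u \<in> U" "y \<in> W - U" for u y
        using U(3) that by (auto simp: ind_def)
      ultimately obtain ys where ys: "gpath E (w # ys)" "set (w # ys) \<subseteq> U \<union> (W - U)" "length ys = 2 * card U"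
        using alternating_path[OF finU, of "W - U" w E] finW w(1) by blast
      then have "gpath E (v # w # ys)"
        using w VW(2) U(1) by (auto simp: gpath_Cons)
      then show False using pfreeD[OF free] ys(3) U(2) by fastforce
    qed
    then have nbU: "nb E V v = U" using deg U(2) finU by (intro card_subset_eq) (auto simp: v_def)
    have "{u, w} \<in> E" if "u \<in> U" "w \<in> V" "u \<noteq> w" for u w
    proof (cases "w = v")
      case True
      then show ?thesis using nbU that by (auto simp: nb_def insert_commute)
    next
      case False
      then show ?thesis using U(3) that by (auto simp: ind_def W_def)
    qed
    moreover have "{u, w} \<notin> E" if uw: "u \<in> V - U" "w \<in> V - U" for u w
    proof -
      consider "u = v" | "w = v" | "u \<in> W" "w \<in> W" using uw by (auto simp: W_def)
      then show ?thesis
      proof cases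
        case 1
        then show ?thesis using nbU that by (auto simp: nb_def)
      next
        case 2
        then show ?thesis using nbU that by (auto simp: nb_def insert_commute)
      next
        case 3
        then show ?thesis using U(4) that by (auto simp: pair_in_ind)
      qed
    qed
    ultimately show ?thesis using U VW(3) by (intro exI[of _ U]) auto
  qed
qed

section \<open>Copies of star forests and paths\<close>

definition embeds :: "('b \<Rightarrow> 'a) \<Rightarrow> 'b graph \<Rightarrow> 'a graph \<Rightarrow> bool" where
  "embeds f F G \<longleftrightarrow> inj_on f (verts F) \<and> f ` verts F \<subseteq> verts G \<and> (\<forall>e\<in>edges F. f ` e \<in> edges G)"

lemma not_graph_free_iff:
  assumes "simple_graph F"
  shows "\<not> graph_free F G \<longleftrightarrow> (\<exists>f. embeds f F G)"
proof
  assume "\<not> graph_free F G"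
  then obtain H f where H: "subgraph H G" "bij_betw f (verts F) (verts H)" "edges H = (`) f ` edges F"
    by (auto simp: graph_free_def graph_iso_def)
  then have "embeds f F G" by (auto simp: embeds_def subgraph_def bij_betw_def)
  then show "\<exists>f. embeds f F G" by blast
next
  assume "\<exists>f. embeds f F G"
  then obtain f where f: "embeds f F G" ..
  define H where "H = Graph (f ` verts F) ((`) f ` edges F)"
  have "card (f ` e) = 2" if "e \<in> edges F" for e
    using assms f that by (subst card_image) (auto simp: simple_graph_def embeds_def intro: inj_on_subset)
  then have "simple_graph H" using assms by (force simp: simple_graph_def H_def)
  then have "subgraph H G" using f by (auto simp: subgraph_def H_def embeds_def)
  moreover have "F \<simeq>\<^sub>g H"
    using f by (auto simp: graph_iso_def H_def embeds_def bij_betw_def intro!: exI[of _ f])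
  ultimately show "\<not> graph_free F G" by (auto simp: graph_free_def)
qed

lemma simple_path_graph: "simple_graph (path_graph n)"
  by (auto simp: simple_graph_def path_graph_def)

lemma star_forest_simps:
  "verts (star_forest t a) = (SIGMA i:{1..t}. {..a i})"
  "edges (star_forest t a) = {{(i, 0), (i, j)} | i j. i \<in> {1..t} \<and> j \<in> {1..a i}}"
proof -
  show "verts (star_forest t a) = (SIGMA i:{1..t}. {..a i})"
    by (simp add: star_forest_def graph_Union_def star_graph_def)
  have "(`) (Pair i) ` {{0, j} | j. 1 \<le> j \<and> j \<le> a i} = {{(i, 0), (i, j)} | j. j \<in> {1..a i}}" for i :: nat
  proof (intro set_eqI iffI)
    fix e assume "e \<in> {{(i, 0::nat), (i, j)} | j. j \<in> {1..a i}}"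
    then obtain j where "e = Pair i ` {0, j}" "1 \<le> j" "j \<le> a i" by auto
    then show "e \<in> (`) (Pair i) ` {{0, j} | j. 1 \<le> j \<and> j \<le> a i}" by blast
  qed auto
  then have "edges (star_forest t a) = (\<Union>i\<in>{1..t}. {{(i, 0), (i, j)} | j. j \<in> {1..a i}})"
    by (simp add: star_forest_def graph_Union_def star_graph_def del: atLeastAtMost_iff)
  then show "edges (star_forest t a) = {{(i, 0), (i, j)} | i j. i \<in> {1..t} \<and> j \<in> {1..a i}}"
    by blast
qed

lemma simple_star_forest: "simple_graph (star_forest t a)"
  unfolding simple_graph_def star_forest_simps by auto

lemma simple_graph_union:
  assumes "simple_graph A" "simple_graph B"
  shows "simple_graph (A \<union>\<^sub>g B)"
  using assms by (auto simp: simple_graph_def graph_union_def card_image)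

lemma embeds_union:
  "(\<exists>h. embeds h (A \<union>\<^sub>g B) G) \<longleftrightarrow>
     (\<exists>f g. embeds f A G \<and> embeds g B G \<and> f ` verts A \<inter> g ` verts B = {})"
proof
  assume "\<exists>h. embeds h (A \<union>\<^sub>g B) G"
  then obtain h where h: "embeds h (A \<union>\<^sub>g B) G" ..
  have "h ` (Inl ` e) \<in> edges G" if "e \<in> edges A" for e
    using h that by (auto simp: embeds_def graph_union_def)
  moreover have "h ` (Inr ` e) \<in> edges G" if "e \<in> edges B" for e
    using h that by (auto simp: embeds_def graph_union_def)
  ultimately have "embeds (h \<circ> Inl) A G" "embeds (h \<circ> Inr) B G"
    using h by (auto simp: embeds_def graph_union_def inj_on_def image_image)
  moreover have "(h \<circ> Inl) ` verts A \<inter> (h \<circ> Inr) ` verts B = {}"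
    using h by (auto simp: embeds_def graph_union_def inj_on_def)
  ultimately show "\<exists>f g. embeds f A G \<and> embeds g B G \<and> f ` verts A \<inter> g ` verts B = {}" by blast
next
  assume "\<exists>f g. embeds f A G \<and> embeds g B G \<and> f ` verts A \<inter> g ` verts B = {}"
  then obtain f g where fg: "embeds f A G" "embeds g B G" "f ` verts A \<inter> g ` verts B = {}" by blast
  have "inj_on (case_sum f g) (verts A <+> verts B)"
    using fg by (auto simp: embeds_def inj_on_def split: sum.splits)
  moreover have "case_sum f g ` (verts A <+> verts B) \<subseteq> verts G"
    using fg by (auto simp: embeds_def)
  ultimately have "embeds (case_sum f g) (A \<union>\<^sub>g B) G"
    using fg by (auto simp: embeds_def graph_union_def image_image)
  then show "\<exists>h. embeds h (A \<union>\<^sub>g B) G" by blast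
qed

text \<open>A copy of a star forest with unlabelled leaves, since only the leaf sets matter for
  disjointness and degrees. The index set is a parameter so that stars can be placed one after
  another.\<close>

definition star_system :: "'a set set \<Rightarrow> 'i set \<Rightarrow> ('i \<Rightarrow> nat) \<Rightarrow> ('i \<Rightarrow> 'a) \<Rightarrow> ('i \<Rightarrow> 'a set) \<Rightarrow> bool" where
  "star_system E I a c L \<longleftrightarrow>
     (\<forall>i\<in>I. finite (L i) \<and> card (L i) = a i \<and> c i \<notin> L i \<and> (\<forall>u\<in>L i. {c i, u} \<in> E)) \<and>
     (\<forall>i\<in>I. \<forall>j\<in>I. i \<noteq> j \<longrightarrow> insert (c i) (L i) \<inter> insert (c j) (L j) = {})"

abbreviation star_verts :: "'i set \<Rightarrow> ('i \<Rightarrow> 'a) \<Rightarrow> ('i \<Rightarrow> 'a set) \<Rightarrow> 'a set" where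
  "star_verts I c L \<equiv> (\<Union>i\<in>I. insert (c i) (L i))"

lemma star_systemD:
  assumes "star_system E I a c L" "i \<in> I"
  shows "finite (L i)" "card (L i) = a i" "c i \<notin> L i" "u \<in> L i \<Longrightarrow> {c i, u} \<in> E"
  using assms by (auto simp: star_system_def)

lemma star_system_leaf:
  assumes "star_system E I a c L" "i \<in> I" "1 \<le> a i"
  obtains u where "u \<in> L i" "{c i, u} \<in> E"
proof -
  have "L i \<noteq> {}" using star_systemD(2)[OF assms(1,2)] assms(3) by auto
  then show ?thesis using that star_systemD(4)[OF assms(1,2)] by blast
qed

lemma star_verts_insert:
  assumes "i \<notin> I"
  shows "star_verts (insert i I) (c(i := v)) (L(i := L0)) = insert v L0 \<union> star_verts I c L"
proof -
  have "star_verts I (c(i := v)) (L(i := L0)) = star_verts I c L"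
    using assms by (intro SUP_cong) auto
  then show ?thesis by simp
qed

lemma star_system_insert:
  assumes S: "star_system E I a c L" and i: "i \<notin> I"
    and L0: "finite L0" "card L0 = a i" "v \<notin> L0" "\<And>u. u \<in> L0 \<Longrightarrow> {v, u} \<in> E"
    and dis: "star_verts I c L \<inter> insert v L0 = {}"
  shows "star_system E (insert i I) a (c(i := v)) (L(i := L0))"
proof -
  have "insert (c j) (L j) \<inter> insert (c l) (L l) = {}" if "j \<in> I" "l \<in> I" "j \<noteq> l" for j l
    using S that by (simp add: star_system_def)
  moreover have "insert (c j) (L j) \<inter> insert v L0 = {}" "insert v L0 \<inter> insert (c j) (L j) = {}" "c j \<noteq> v"
    if "j \<in> I" for j
    using dis that by blast+
  moreover have "j \<noteq> i" if "j \<in> I" for j using that i by blast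
  ultimately show ?thesis
    unfolding star_system_def using star_systemD[OF S] L0 by simp
qed

lemma embeds_star_forest:
  assumes "embeds f (star_forest t a) G"
  obtains c L where "star_system (edges G) {1..t} a c L"
    "f ` verts (star_forest t a) = star_verts {1..t} c L"
proof -
  define c where "c i = f (i, 0)" for i
  define L where "L i = (\<lambda>j. f (i, j)) ` {1..a i}" for i
  have inj: "inj_on f (SIGMA i:{1..t}. {..a i})" using assms by (simp add: embeds_def star_forest_simps)
  have eq: "f p = f q \<longleftrightarrow> p = q" if "p \<in> (SIGMA i:{1..t}. {..a i})" "q \<in> (SIGMA i:{1..t}. {..a i})" for p q
    using inj_on_eq_iff[OF inj that] .
  have "star_system (edges G) {1..t} a c L"
    unfolding star_system_def
  proof (intro conjI ballI impI)
    fix i assume i: "i \<in> {1..t}"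
    show "finite (L i)" by (simp add: L_def)
    show "card (L i) = a i"
      unfolding L_def using i by (subst card_image) (auto simp: inj_on_def eq)
    show "c i \<notin> L i" using i by (auto simp: c_def L_def eq)
    fix u assume "u \<in> L i"
    then obtain j where j: "j \<in> {1..a i}" "u = f (i, j)" by (auto simp: L_def)
    then have "{(i, 0), (i, j)} \<in> edges (star_forest t a)" using i unfolding star_forest_simps by blast
    then have "f ` {(i, 0), (i, j)} \<in> edges G" using assms unfolding embeds_def by blast
    then show "{c i, u} \<in> edges G" using j by (simp add: c_def)
  next
    fix i j assume "i \<in> {1..t}" "j \<in> {1..t}" "i \<noteq> j"
    then show "insert (c i) (L i) \<inter> insert (c j) (L j) = {}" by (auto simp: c_def L_def eq)
  qed
  moreover have "f ` verts (star_forest t a) = star_verts {1..t} c L"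
  proof (intro set_eqI iffI)
    fix x assume "x \<in> f ` verts (star_forest t a)"
    then obtain i j where ij: "i \<in> {1..t}" "j \<le> a i" "x = f (i, j)" by (auto simp: star_forest_simps)
    then show "x \<in> star_verts {1..t} c L"
      by (cases "j = 0") (auto simp: c_def L_def intro!: bexI[of _ i])
  next
    fix x assume "x \<in> star_verts {1..t} c L"
    then show "x \<in> f ` verts (star_forest t a)" by (auto simp: star_forest_simps c_def L_def)
  qed
  ultimately show ?thesis by (rule that)
qed

lemma star_system_embeds:
  assumes "star_system (edges G) {1..t} a c L" "simple_graph G" "\<And>i. i \<in> {1..t} \<Longrightarrow> 1 \<le> a i"
  obtains f where "embeds f (star_forest t a) G"
    "f ` verts (star_forest t a) = star_verts {1..t} c L"
proof -
  have "\<exists>g. bij_betw g {1..a i} (L i)" if "i \<in> {1..t}" for i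
    using assms(1) that finite_same_card_bij[of "{1..a i}" "L i"] by (auto simp: star_system_def)
  then obtain g where g: "\<And>i. i \<in> {1..t} \<Longrightarrow> bij_betw (g i) {1..a i} (L i)" by metis
  define f where "f p = (if snd p = 0 then c (fst p) else g (fst p) (snd p))" for p
  have gi: "g i j \<in> L i" if "i \<in> {1..t}" "j \<in> {1..a i}" for i j
    using g[OF that(1)] that(2) by (auto simp: bij_betw_def)
  have fin: "f (i, j) \<in> insert (c i) (L i)" if "i \<in> {1..t}" "j \<le> a i" for i j
    using gi[OF that(1), of j] that by (auto simp: f_def Suc_le_eq)
  have im: "f ` verts (star_forest t a) = star_verts {1..t} c L"
  proof (intro set_eqI iffI)
    fix x assume "x \<in> star_verts {1..t} c L"
    then obtain i where i: "i \<in> {1..t}" "x \<in> insert (c i) (L i)" by blast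
    show "x \<in> f ` verts (star_forest t a)"
    proof (cases "x = c i")
      case True
      then have "x = f (i, 0)" by (simp add: f_def)
      then show ?thesis using i by (auto simp: star_forest_simps)
    next
      case False
      then have "x \<in> g i ` {1..a i}" using i g[OF i(1)] by (simp add: bij_betw_def)
      then obtain j where "j \<in> {1..a i}" "x = g i j" by blast
      then have "x = f (i, j)" "j \<le> a i" by (auto simp: f_def)
      then show ?thesis using i by (auto simp: star_forest_simps)
    qed
  next
    fix x assume "x \<in> f ` verts (star_forest t a)"
    then obtain i j where "i \<in> {1..t}" "j \<le> a i" "x = f (i, j)" by (auto simp: star_forest_simps)
    then show "x \<in> star_verts {1..t} c L" using fin by blast
  qed
  have "inj_on f (verts (star_forest t a))"
  proof (rule inj_onI)
    fix p q assume pq: "p \<in> verts (star_forest t a)" "q \<in> verts (star_forest t a)" "f p = f q"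
    obtain i j i' j' where ij: "p = (i, j)" "q = (i', j')" by (cases p; cases q) auto
    have ii: "i \<in> {1..t}" "i' \<in> {1..t}" "j \<le> a i" "j' \<le> a i'" using pq ij by (auto simp: star_forest_simps)
    have "f p \<in> insert (c i) (L i) \<inter> insert (c i') (L i')"
      using fin[OF ii(1,3)] fin[OF ii(2,4)] pq(3) ij by simp
    then have i': "i' = i" using assms(1) ii unfolding star_system_def by blast
    have ci: "c i \<notin> L i" using assms(1) ii by (simp add: star_system_def)
    have "j = j'"
    proof (cases "j = 0 \<or> j' = 0")
      case True
      then show ?thesis
        using pq(3) ci gi[OF ii(1), of j] gi[OF ii(1), of j'] ii i' ij
        by (auto simp: f_def Suc_le_eq split: if_splits)
    next
      case False
      then have "g i j = g i j'" "j \<in> {1..a i}" "j' \<in> {1..a i}" using pq(3) ij i' ii by (auto simp: f_def)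
      then show ?thesis using inj_onD[OF bij_betw_imp_inj_on[OF g[OF ii(1)]]] by blast
    qed
    then show "p = q" using ij i' by simp
  qed
  moreover have "f ` verts (star_forest t a) \<subseteq> verts G"
  proof
    fix x assume "x \<in> f ` verts (star_forest t a)"
    then obtain i where i: "i \<in> {1..t}" "x \<in> insert (c i) (L i)" using im by auto
    \<comment> \<open>Each star needs a leaf, because only an edge shows that its centre is a vertex
      of \<open>G\<close>.\<close>
    then obtain u where u: "u \<in> L i" using star_system_leaf[OF assms(1)] assms(3) by blast
    have e: "{c i, v} \<in> edges G" if "v \<in> L i" for v using star_systemD(4)[OF assms(1) i(1) that] .
    have "c i \<in> verts G" "v \<in> verts G" if "v \<in> L i" for v
      using sgr_edge(1,2)[OF assms(2)[unfolded simple_graph_iff_sgr] e[OF that]] .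
    then show "x \<in> verts G" using i(2) u by blast
  qed
  moreover have "f ` e \<in> edges G" if "e \<in> edges (star_forest t a)" for e
  proof -
    obtain i j where ij: "i \<in> {1..t}" "j \<in> {1..a i}" "e = {(i, 0), (i, j)}"
      using \<open>e \<in> edges (star_forest t a)\<close> unfolding star_forest_simps by blast
    then have "f ` e = {c i, g i j}" by (auto simp: f_def)
    then show ?thesis using gi[OF ij(1,2)] ij assms(1) by (auto simp: star_system_def)
  qed
  ultimately have "embeds f (star_forest t a) G" by (simp add: embeds_def)
  then show ?thesis using that im by blast
qed

lemma embeds_path_graph:
  assumes "embeds f (path_graph m) G"
  shows "gpath (edges G) (map f [0..<m])" "set (map f [0..<m]) = f ` verts (path_graph m)"
proof -
  have "{f i, f (Suc i)} \<in> edges G" if "Suc i < m" for i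
  proof -
    have "{i, Suc i} \<in> edges (path_graph m)" using that by (auto simp: path_graph_def)
    then have "f ` {i, Suc i} \<in> edges G" using assms unfolding embeds_def by blast
    then show ?thesis by simp
  qed
  moreover have "inj_on f {..<m}" using assms by (simp add: embeds_def path_graph_def)
  ultimately show "gpath (edges G) (map f [0..<m])"
    by (simp add: gpath_def distinct_map successively_conv_nth atLeast0LessThan)
  show "set (map f [0..<m]) = f ` verts (path_graph m)" by (auto simp: path_graph_def)
qed

lemma gpath_embeds:
  assumes "gpath (edges G) xs" "set xs \<subseteq> verts G"
  shows "embeds ((!) xs) (path_graph (length xs)) G" "(!) xs ` verts (path_graph (length xs)) = set xs"
proof -
  show im: "(!) xs ` verts (path_graph (length xs)) = set xs"
    by (auto simp: path_graph_def in_set_conv_nth)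
  have "(!) xs ` e \<in> edges G" if "e \<in> edges (path_graph (length xs))" for e
    using that gpath_edge[OF assms(1)] by (auto simp: path_graph_def)
  then show "embeds ((!) xs) (path_graph (length xs)) G"
    using gpath_distinct[OF assms(1)] assms(2) im
    by (auto simp: embeds_def path_graph_def inj_on_def nth_eq_iff_index_eq)
qed

lemma graph_free_star_forest_iff:
  assumes "simple_graph G" "\<And>i. i \<in> {1..t} \<Longrightarrow> 1 \<le> a i"
  shows "graph_free (star_forest t a) G \<longleftrightarrow> \<not> (\<exists>c L. star_system (edges G) {1..t} a c L)"
proof -
  have "(\<exists>f. embeds f (star_forest t a) G) \<longleftrightarrow> (\<exists>c L. star_system (edges G) {1..t} a c L)"
  proof
    assume "\<exists>f. embeds f (star_forest t a) G"
    then obtain f where "embeds f (star_forest t a) G" ..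
    then show "\<exists>c L. star_system (edges G) {1..t} a c L" by (rule embeds_star_forest) blast
  next
    assume "\<exists>c L. star_system (edges G) {1..t} a c L"
    then obtain c L where "star_system (edges G) {1..t} a c L" by blast
    from star_system_embeds[OF this assms(1)] assms(2)
    obtain f where "embeds f (star_forest t a) G" by metis
    then show "\<exists>f. embeds f (star_forest t a) G" by blast
  qed
  then show ?thesis using not_graph_free_iff[OF simple_star_forest, of t a G] by blast
qed

lemma graph_free_path_iff:
  assumes "simple_graph G" "2 \<le> m"
  shows "graph_free (path_graph m) G \<longleftrightarrow> pfree (edges G) m"
proof -
  have "(\<exists>f. embeds f (path_graph m) G) \<longleftrightarrow> \<not> pfree (edges G) m"
  proof
    assume "\<exists>f. embeds f (path_graph m) G"
    then obtain f where "gpath (edges G) (map f [0..<m])" using embeds_path_graph(1) by blast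
    then show "\<not> pfree (edges G) m" using pfreeD by fastforce
  next
    assume "\<not> pfree (edges G) m"
    then obtain xs where xs: "gpath (edges G) xs" "length xs = m" by (rule not_pfreeE)
    then have "set xs \<subseteq> verts G"
      using gpath_subset assms by (metis simple_graph_iff_sgr)
    then show "\<exists>f. embeds f (path_graph m) G" using gpath_embeds(1) xs by blast
  qed
  then show ?thesis using not_graph_free_iff[OF simple_path_graph, of m G] by blast
qed

lemma graph_free_star_forest_path_iff:
  assumes "simple_graph G" "\<And>i. i \<in> {1..t} \<Longrightarrow> 1 \<le> a i" "2 \<le> m"
  shows "graph_free (star_forest t a \<union>\<^sub>g path_graph m) G \<longleftrightarrow>
    \<not> (\<exists>c L xs. star_system (edges G) {1..t} a c L \<and> gpath (edges G) xs \<and> length xs = m \<and>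
         star_verts {1..t} c L \<inter> set xs = {})" (is "_ \<longleftrightarrow> \<not> ?C")
proof -
  have "(\<exists>h. embeds h (star_forest t a \<union>\<^sub>g path_graph m) G) \<longleftrightarrow> ?C"
    unfolding embeds_union
  proof
    assume "\<exists>f g. embeds f (star_forest t a) G \<and> embeds g (path_graph m) G \<and>
      f ` verts (star_forest t a) \<inter> g ` verts (path_graph m) = {}"
    then obtain f g where fg: "embeds f (star_forest t a) G" "embeds g (path_graph m) G"
      "f ` verts (star_forest t a) \<inter> g ` verts (path_graph m) = {}" by blast
    obtain c L where "star_system (edges G) {1..t} a c L"
      "f ` verts (star_forest t a) = star_verts {1..t} c L"
      using embeds_star_forest[OF fg(1)] by blast
    moreover have "length (map g [0..<m]) = m" by simp
    ultimately show ?C using embeds_path_graph[OF fg(2)] fg(3) by metis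
  next
    assume ?C
    then obtain c L xs where *: "star_system (edges G) {1..t} a c L" "gpath (edges G) xs" "length xs = m"
      "star_verts {1..t} c L \<inter> set xs = {}" by blast
    obtain f where "embeds f (star_forest t a) G"
      "f ` verts (star_forest t a) = star_verts {1..t} c L"
      using star_system_embeds[OF *(1) assms(1)] assms(2) by metis
    moreover have "set xs \<subseteq> verts G"
      using gpath_subset assms *(2,3) by (metis simple_graph_iff_sgr)
    ultimately show "\<exists>f g. embeds f (star_forest t a) G \<and> embeds g (path_graph m) G \<and>
      f ` verts (star_forest t a) \<inter> g ` verts (path_graph m) = {}"
      using gpath_embeds[OF *(2)] *(3,4) by metis
  qed
  then show ?thesis
    using not_graph_free_iff[OF simple_graph_union[OF simple_star_forest simple_path_graph], of t a m G] by blast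
qed

section \<open>Joins and extremal constructions\<close>

lemma graph_iso_refl: "G \<simeq>\<^sub>g G"
  by (auto simp: graph_iso_def intro!: exI[of _ id])

lemma image_all_pairs:
  assumes "bij_betw f A B"
  shows "(`) f ` {{u, v} |u v. u \<in> A \<and> v \<in> A \<and> u \<noteq> v} = {{u, v} |u v. u \<in> B \<and> v \<in> B \<and> u \<noteq> v}"
proof (intro set_eqI iffI)
  fix e assume "e \<in> (`) f ` {{u, v} |u v. u \<in> A \<and> v \<in> A \<and> u \<noteq> v}"
  then obtain u v where "e = {f u, f v}" "u \<in> A" "v \<in> A" "u \<noteq> v" by auto
  moreover from this have "f u \<in> B" "f v \<in> B" "f u \<noteq> f v"
    using assms by (auto simp: bij_betw_def inj_on_def)
  ultimately show "e \<in> {{u, v} |u v. u \<in> B \<and> v \<in> B \<and> u \<noteq> v}" by blast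
next
  fix e assume "e \<in> {{u, v} |u v. u \<in> B \<and> v \<in> B \<and> u \<noteq> v}"
  then obtain x y where "e = {x, y}" "x \<in> f ` A" "y \<in> f ` A" "x \<noteq> y"
    using assms by (auto simp: bij_betw_def)
  then obtain u v where "e = f ` {u, v}" "u \<in> A" "v \<in> A" "u \<noteq> v" by auto
  then show "e \<in> (`) f ` {{u, v} |u v. u \<in> A \<and> v \<in> A \<and> u \<noteq> v}" by blast
qed

lemma clique_iso_complete_graph:
  assumes "sgr V E" "finite U" "\<And>x y. x \<in> U \<Longrightarrow> y \<in> U \<Longrightarrow> x \<noteq> y \<Longrightarrow> {x, y} \<in> E"
  shows "Graph U (ind E U) \<simeq>\<^sub>g complete_graph (card U)"
proof -
  obtain f where f: "bij_betw f U {..<card U}"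
    using finite_same_card_bij[OF assms(2), of "{..<card U}"] by auto
  have "ind E U = {{u, v} |u v. u \<in> U \<and> v \<in> U \<and> u \<noteq> v}"
  proof (intro set_eqI iffI)
    fix e assume "e \<in> ind E U"
    then have e: "e \<in> E" "e \<subseteq> U" by (simp_all add: ind_def)
    obtain u v where "e = {u, v}" "u \<noteq> v" using sgr_edgeE[OF assms(1) e(1)] by metis
    with e(2) show "e \<in> {{u, v} |u v. u \<in> U \<and> v \<in> U \<and> u \<noteq> v}" by blast
  next
    fix e assume "e \<in> {{u, v} |u v. u \<in> U \<and> v \<in> U \<and> u \<noteq> v}"
    then obtain u v where "e = {u, v}" "u \<in> U" "v \<in> U" "u \<noteq> v" by blast
    then show "e \<in> ind E U" using assms(3) by (simp add: ind_def)
  qed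
  then show ?thesis
    unfolding graph_iso_def complete_graph_def
    using f image_all_pairs[OF f] by (intro exI[of _ f]) simp
qed

lemma edges_graph_compl_complete: "edges (graph_compl (complete_graph n)) = {}"
  by (auto simp: graph_compl_def complete_graph_def)

lemma independent_iso_compl:
  assumes "finite W" "ind E W = {}"
  shows "Graph W (ind E W) \<simeq>\<^sub>g graph_compl (complete_graph (card W))"
proof -
  obtain f where f: "bij_betw f W {..<card W}"
    using finite_same_card_bij[OF assms(1), of "{..<card W}"] by auto
  then show ?thesis
    unfolding graph_iso_def edges_graph_compl_complete assms(2)
    by (auto simp: graph_compl_def complete_graph_def)
qed

lemma iso_graph_join:
  assumes sgr: "sgr V E" and U: "U \<subseteq> V" "\<And>u v. u \<in> U \<Longrightarrow> v \<in> V - U \<Longrightarrow> {u, v} \<in> E"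
    and A: "Graph U (ind E U) \<simeq>\<^sub>g A" and B: "Graph (V - U) (ind E (V - U)) \<simeq>\<^sub>g B"
  shows "Graph V E \<simeq>\<^sub>g A \<or>\<^sub>g B"
proof -
  obtain f where f: "bij_betw f U (verts A)" "edges A = (`) f ` ind E U"
    using A by (auto simp: graph_iso_def)
  obtain g where g: "bij_betw g (V - U) (verts B)" "edges B = (`) g ` ind E (V - U)"
    using B by (auto simp: graph_iso_def)
  define h where "h x = (if x \<in> U then Inl (f x) else Inr (g x))" for x
  have "bij_betw h U (Inl ` verts A)" "bij_betw h (V - U) (Inr ` verts B)"
    using f(1) g(1) by (auto simp: h_def bij_betw_def inj_on_def image_iff)
  then have "bij_betw h (U \<union> (V - U)) (Inl ` verts A \<union> Inr ` verts B)"
    by (rule bij_betw_combine) auto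
  moreover have "U \<union> (V - U) = V" using U(1) by auto
  ultimately have bij: "bij_betw h V (verts (A \<or>\<^sub>g B))"
    by (simp add: graph_join_def graph_union_def Plus_def)
  define M where "M = {{u, v} |u v. u \<in> U \<and> v \<in> V - U}"
  have E: "E = ind E U \<union> ind E (V - U) \<union> M"
  proof (intro set_eqI iffI)
    fix e assume e: "e \<in> E"
    then obtain u v where uv: "e = {u, v}" "u \<in> V" "v \<in> V" using sgr_edgeE[OF sgr] by metis
    then show "e \<in> ind E U \<union> ind E (V - U) \<union> M"
      using e unfolding M_def ind_def by (cases "u \<in> U"; cases "v \<in> U") (auto simp: insert_commute)
  qed (use U(2) in \<open>auto simp: M_def ind_def\<close>)
  have hU: "h ` e = Inl ` f ` e" if "e \<subseteq> U" for e using that by (auto simp: h_def image_iff)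
  have hW: "h ` e = Inr ` g ` e" if "e \<subseteq> V - U" for e using that by (auto simp: h_def image_iff)
  have 1: "(`) h ` ind E U = (`) Inl ` edges A"
    unfolding f(2) image_comp by (intro image_cong) (auto simp: hU ind_def image_comp[symmetric])
  have 2: "(`) h ` ind E (V - U) = (`) Inr ` edges B"
    unfolding g(2) image_comp by (intro image_cong) (auto simp: hW ind_def image_comp[symmetric])
  have 3: "(`) h ` M = {{Inl u, Inr v} |u v. u \<in> verts A \<and> v \<in> verts B}"
  proof (intro set_eqI iffI)
    fix e assume "e \<in> (`) h ` M"
    then obtain u v where "e = {Inl (f u), Inr (g v)}" "u \<in> U" "v \<in> V - U"
      by (auto simp: M_def h_def)
    moreover from this have "f u \<in> verts A" "g v \<in> verts B" using f(1) g(1) by (auto simp: bij_betw_def)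
    ultimately show "e \<in> {{Inl u, Inr v} |u v. u \<in> verts A \<and> v \<in> verts B}" by blast
  next
    fix e assume "e \<in> {{Inl u, Inr v} |u v. u \<in> verts A \<and> v \<in> verts B}"
    then obtain x y where xy: "e = {Inl x, Inr y}" "x \<in> f ` U" "y \<in> g ` (V - U)"
      using f(1) g(1) by (auto simp: bij_betw_def)
    then obtain u v where uv: "x = f u" "y = g v" "u \<in> U" "v \<in> V - U" by auto
    then have "e = h ` {u, v}" using xy(1) by (auto simp: h_def)
    moreover have "{u, v} \<in> M" using uv unfolding M_def by blast
    ultimately show "e \<in> (`) h ` M" by blast
  qed
  have "(`) h ` E = (`) Inl ` edges A \<union> (`) Inr ` edges B \<union> {{Inl u, Inr v} |u v. u \<in> verts A \<and> v \<in> verts B}"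
    using 1 2 3 by (subst E) (simp only: image_Un)
  then have "edges (A \<or>\<^sub>g B) = (`) h ` E" by (simp add: graph_join_def graph_union_def)
  then show ?thesis using bij by (auto simp: graph_iso_def)
qed

section \<open>Two comparison graphs without the forbidden graph\<close>

text \<open>Only the neighbours below each vertex are prescribed, so the edges are counted by adding
  the vertices in increasing order.\<close>

definition back_graph :: "nat \<Rightarrow> (nat \<Rightarrow> nat \<Rightarrow> bool) \<Rightarrow> nat graph" where
  "back_graph n R = Graph {..<n} {{u, v} |u v. u < v \<and> v < n \<and> R u v}"

lemma simple_back_graph: "simple_graph (back_graph n R)"
  by (auto simp: simple_graph_def back_graph_def)

lemma back_graph_edge:
  assumes "{u, v} \<in> edges (back_graph n R)"
  shows "(u < v \<and> R u v \<or> v < u \<and> R v u) \<and> u < n \<and> v < n"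
  using assms by (auto simp: back_graph_def doubleton_eq_iff)

lemma card_edges_back_graph: "card (edges (back_graph n R)) = (\<Sum>v<n. card {u. u < v \<and> R u v})"
proof (induction n)
  case 0
  then show ?case by (simp add: back_graph_def)
next
  case (Suc n)
  have eq: "edges (back_graph (Suc n) R) = edges (back_graph n R) \<union> (\<lambda>u. {u, n}) ` {u. u < n \<and> R u n}"
    by (auto simp: back_graph_def less_Suc_eq)
  have "finite (edges (back_graph n R))"
    using simple_back_graph sgr_finite_edges simple_graph_iff_sgr by metis
  moreover have "edges (back_graph n R) \<inter> (\<lambda>u. {u, n}) ` {u. u < n \<and> R u n} = {}"
    by (auto simp: back_graph_def doubleton_eq_iff)
  moreover have "inj_on (\<lambda>u. {u, n}) {u. u < n \<and> R u n}"
    by (auto simp: inj_on_def doubleton_eq_iff)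
  ultimately show ?case unfolding eq by (simp add: card_Un_disjoint card_image Suc.IH)
qed

text \<open>The stars and the path are pairwise disjoint, so their shares of \<open>U\<close> add
  up. A set \<open>U\<close> that is too small for this rules out the forbidden graph.\<close>

lemma star_system_cover:
  assumes S: "star_system E {1..t} a c L" and U: "finite U"
    and dis: "star_verts {1..t} c L \<inter> set xs = {}"
    and meet: "\<And>i. i \<in> {1..t} \<Longrightarrow> insert (c i) (L i) \<inter> U \<noteq> {}" and q: "q \<le> card (set xs \<inter> U)"
  shows "t + q \<le> card U"
proof -
  have "\<forall>i\<in>{1..t}. \<exists>x. x \<in> insert (c i) (L i) \<inter> U" using meet by blast
  from bchoice[OF this] obtain s where s: "\<And>i. i \<in> {1..t} \<Longrightarrow> s i \<in> insert (c i) (L i) \<inter> U"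
    by blast
  have "inj_on s {1..t}"
  proof (rule inj_onI, rule ccontr)
    fix i j assume ij: "i \<in> {1..t}" "j \<in> {1..t}" "s i = s j" "i \<noteq> j"
    then have "insert (c i) (L i) \<inter> insert (c j) (L j) = {}" using S by (simp add: star_system_def)
    then show False using s[OF ij(1)] s[OF ij(2)] ij(3) by auto
  qed
  then have "card (s ` {1..t}) = t" by (simp add: card_image)
  moreover have "s ` {1..t} \<inter> (set xs \<inter> U) = {}" using s dis by blast
  moreover have "s ` {1..t} \<union> (set xs \<inter> U) \<subseteq> U" using s by auto
  ultimately have "t + card (set xs \<inter> U) \<le> card U"
    using card_mono[OF U, of "s ` {1..t} \<union> (set xs \<inter> U)"]
      card_Un_disjoint[of "s ` {1..t}" "set xs \<inter> U"] by simp
  then show ?thesis using q by simp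
qed

text \<open>The path splits into \<open>q\<close> disjoint edges, each of which meets the vertex
  cover \<open>U\<close>.\<close>

lemma path_cover:
  assumes "gpath E xs" "length xs = 2 * q" "\<And>u v. {u, v} \<in> E \<Longrightarrow> u \<in> U \<or> v \<in> U"
  shows "q \<le> card (set xs \<inter> U)"
  using assms(1,2)
proof (induction q arbitrary: xs)
  case (Suc q)
  then obtain x y ys where xs: "xs = x # y # ys" by (cases xs; cases "tl xs") auto
  have q: "q \<le> card (set ys \<inter> U)" using Suc xs by (auto simp: gpath_Cons)
  obtain z where z: "z \<in> U" "z \<in> {x, y}" "z \<notin> set ys"
    using Suc.prems(1) assms(3)[of x y] by (auto simp: xs gpath_Cons)
  then have "insert z (set ys \<inter> U) \<subseteq> set xs \<inter> U" by (auto simp: xs)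
  then have "card (insert z (set ys \<inter> U)) \<le> card (set xs \<inter> U)" by (intro card_mono) auto
  then show ?case using q z(3) by simp
qed simp

lemma gpath_invariant:
  assumes "gpath E xs" "\<And>u v. {u, v} \<in> E \<Longrightarrow> u \<in> set xs \<Longrightarrow> v \<in> set xs \<Longrightarrow> f u = f v" "x \<in> set xs"
  shows "f x = f (hd xs)"
  using assms
proof (induction xs)
  case (Cons y ys)
  show ?case
  proof (cases "x \<in> set ys")
    case True
    then have "f x = f (hd ys)" using Cons by (auto simp: gpath_Cons)
    moreover have "f y = f (hd ys)" using Cons.prems(1,2) True by (cases ys) (auto simp: gpath_Cons)
    ultimately show ?thesis by simp
  next
    case False
    then show ?thesis using Cons.prems by simp
  qed
qed simp

text \<open>The graph is K_{t+k} joined to an edgeless graph. Its first t + k vertices cover all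
  edges, but each of the t stars needs one of them and the path needs k + 1.\<close>

lemma ex_split_join_graph:
  assumes "t + k \<le> n" "\<And>i. i \<in> {1..t} \<Longrightarrow> 1 \<le> a i"
  obtains G :: "nat graph" where "simple_graph G" "card (verts G) = n"
    "graph_free (star_forest t a \<union>\<^sub>g path_graph (2 * k + 2)) G"
    "2 * card (edges G) + (t + k) * (t + k + 1) = 2 * (t + k) * n"
proof -
  define s where "s = t + k"
  define G where "G = back_graph n (\<lambda>u v. u < s)"
  have edge: "u \<in> {..<s} \<or> v \<in> {..<s}" if "{u, v} \<in> edges G" for u v
    using back_graph_edge[of u v n "\<lambda>u v. u < s"] that by (auto simp: G_def)
  have "graph_free (star_forest t a \<union>\<^sub>g path_graph (2 * k + 2)) G"
  proof (subst graph_free_star_forest_path_iff)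
    show "simple_graph G" by (simp add: G_def simple_back_graph)
    show "\<not> (\<exists>c L xs. star_system (edges G) {1..t} a c L \<and> gpath (edges G) xs \<and> length xs = 2 * k + 2 \<and>
         star_verts {1..t} c L \<inter> set xs = {})"
    proof
      assume "\<exists>c L xs. star_system (edges G) {1..t} a c L \<and> gpath (edges G) xs \<and> length xs = 2 * k + 2 \<and>
         star_verts {1..t} c L \<inter> set xs = {}"
      then obtain c L xs where *: "star_system (edges G) {1..t} a c L" "gpath (edges G) xs" "length xs = 2 * (k + 1)"
         "star_verts {1..t} c L \<inter> set xs = {}" by auto
      have "insert (c i) (L i) \<inter> {..<s} \<noteq> {}" if i: "i \<in> {1..t}" for i
      proof -
        obtain u where "u \<in> L i" "{c i, u} \<in> edges G"
          using star_system_leaf[OF *(1) i assms(2)[OF i]] .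
        then show ?thesis using edge by blast
      qed
      then have "t + (k + 1) \<le> card {..<s}"
        using path_cover[OF *(2,3) edge] by (intro star_system_cover[OF *(1) _ *(4)]) auto
      then show False by (simp add: s_def)
    qed
  qed (use assms in auto)
  moreover have "2 * card (edges G) + s * (s + 1) = 2 * s * n"
  proof -
    have "card {u. u < v \<and> u < s} = min v s" for v
    proof -
      have "{u. u < v \<and> u < s} = {..<min v s}" by auto
      then show ?thesis by simp
    qed
    then have "card (edges G) = (\<Sum>v<n. min v s)" by (simp add: G_def card_edges_back_graph)
    moreover have "s \<le> n" using assms by (simp add: s_def)
    then have "2 * (\<Sum>v<n. min v s) + s * (s + 1) = 2 * s * n"
    proof (induction n rule: dec_induct)
      case base
      have "2 * (\<Sum>v<s'. min v s) + s' = s' * s'" if "s' \<le> s" for s'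
        using that by (induction s') auto
      from this[of s] show ?case by (simp add: algebra_simps)
    qed (auto simp: algebra_simps)
    ultimately show ?thesis by simp
  qed
  ultimately show ?thesis
    using that[of G] by (auto simp: G_def simple_back_graph s_def) (simp add: back_graph_def)
qed

text \<open>The graph is K_t joined to copies of K_{2k+1} and a possible smaller clique, the blocks
  of \<open>R\<close>. Stars with at least 2k+1 edges and a path on 2k+2 vertices do not fit into a
  block, so together they need t + 1 of the first t vertices. Vertex t + j has t + j mod (2k+1) back
  neighbours, which \<open>sum_mod_deficit\<close> adds up.\<close>

lemma ex_clique_join_graph:
  assumes "\<And>i. i \<in> {1..t} \<Longrightarrow> 2 * k + 1 \<le> a i"
  obtains G :: "nat graph" where "simple_graph G" "card (verts G) = t + m"
    "graph_free (star_forest t a \<union>\<^sub>g path_graph (2 * k + 2)) G"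
    "2 * card (edges G) + deficit k m = t * (t - 1) + 2 * t * m + 2 * k * m"
proof -
  define N where "N = 2 * k + 1"
  define R where "R u v \<longleftrightarrow> u < t \<or> (u - t) div N = (v - t) div N" for u v
  define G where "G = back_graph (t + m) R"
  have N0: "0 < N" by (simp add: N_def)
  have block: "(u - t) div N = (v - t) div N" if "{u, v} \<in> edges G" "t \<le> u" "t \<le> v" for u v
    using back_graph_edge[of u v "t + m" R] that by (auto simp: G_def R_def)
  have block_card: "card B \<le> N" if B: "\<And>u. u \<in> B \<Longrightarrow> t \<le> u \<and> (u - t) div N = b" for B b
  proof -
    have "B \<subseteq> {t + b * N..<t + b * N + N}"
    proof
      fix u assume "u \<in> B"
      then have "t \<le> u" "u - t = b * N + (u - t) mod N" using B by (auto, metis div_mult_mod_eq)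
      moreover have "(u - t) mod N < N" using N0 by simp
      ultimately show "u \<in> {t + b * N..<t + b * N + N}" by auto
    qed
    then have "card B \<le> card {t + b * N..<t + b * N + N}" by (intro card_mono) auto
    then show ?thesis by simp
  qed
  have "graph_free (star_forest t a \<union>\<^sub>g path_graph (2 * k + 2)) G"
  proof (subst graph_free_star_forest_path_iff)
    show "simple_graph G" by (simp add: G_def simple_back_graph)
    show "1 \<le> a i" if "i \<in> {1..t}" for i using assms[OF that] by simp
    show "\<not> (\<exists>c L xs. star_system (edges G) {1..t} a c L \<and> gpath (edges G) xs \<and> length xs = 2 * k + 2 \<and>
         star_verts {1..t} c L \<inter> set xs = {})"
    proof
      assume "\<exists>c L xs. star_system (edges G) {1..t} a c L \<and> gpath (edges G) xs \<and> length xs = 2 * k + 2 \<and>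
         star_verts {1..t} c L \<inter> set xs = {}"
      then obtain c L xs where *: "star_system (edges G) {1..t} a c L" "gpath (edges G) xs" "length xs = 2 * k + 2"
         "star_verts {1..t} c L \<inter> set xs = {}" by auto
      have "insert (c i) (L i) \<inter> {..<t} \<noteq> {}" if "i \<in> {1..t}" for i
      proof
        assume no: "insert (c i) (L i) \<inter> {..<t} = {}"
        have L: "finite (L i)" "card (L i) = a i" "c i \<notin> L i" "\<And>u. u \<in> L i \<Longrightarrow> {c i, u} \<in> edges G"
          using *(1) that by (auto simp: star_system_def)
        have "t \<le> u \<and> (u - t) div N = (c i - t) div N" if "u \<in> insert (c i) (L i)" for u
        proof -
          have "t \<le> u" "t \<le> c i" using no that by (auto simp: disjoint_iff not_less)
          then show ?thesis using block[of "c i" u] L(4)[of u] that by auto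
        qed
        then have "card (insert (c i) (L i)) \<le> N" by (rule block_card)
        then show False using L assms[OF that] by (simp add: N_def)
      qed
      moreover have "1 \<le> card (set xs \<inter> {..<t})"
      proof (rule ccontr)
        assume "\<not> ?thesis"
        then have no: "set xs \<inter> {..<t} = {}" by (simp add: not_le)
        have "t \<le> u \<and> (u - t) div N = (hd xs - t) div N" if "u \<in> set xs" for u
        proof
          have ge: "t \<le> x" if "x \<in> set xs" for x using no that by (auto simp: disjoint_iff not_less)
          then show "t \<le> u" using that .
          show "(u - t) div N = (hd xs - t) div N"
            using gpath_invariant[OF *(2), of "\<lambda>u. (u - t) div N"] block ge that by blast
        qed
        then have "card (set xs) \<le> N" by (rule block_card)
        then show False using *(3) distinct_card[OF gpath_distinct[OF *(2)]] by (simp add: N_def)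
      qed
      ultimately have "t + 1 \<le> card {..<t}"
        by (rule star_system_cover[OF *(1) _ *(4), rotated]) auto
      then show False by simp
    qed
  qed simp
  moreover have "2 * card (edges G) + deficit k m = t * (t - 1) + 2 * t * m + 2 * k * m"
  proof -
    have low: "card {u. u < v \<and> R u v} = v" if "v < t" for v
    proof -
      have "{u. u < v \<and> R u v} = {..<v}" using that by (auto simp: R_def)
      then show ?thesis by simp
    qed
    have high: "card {u. u < t + j \<and> R u (t + j)} = t + j mod N" for j
    proof -
      have "{u. u < t + j \<and> R u (t + j)} = {..<t} \<union> {t + j div N * N..<t + j}" (is "?A = ?B")
      proof (intro set_eqI iffI)
        fix u assume u: "u \<in> ?A"
        show "u \<in> ?B"
        proof (cases "u < t")
          case False
          then have "j div N * N \<le> u - t" using u by (simp add: R_def) (metis div_times_less_eq_dividend)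
          then show ?thesis using u False by auto
        qed simp
      next
        fix u assume u: "u \<in> ?B"
        show "u \<in> ?A"
        proof (cases "u < t")
          case False
          then have "j div N * N \<le> u - t" "u - t \<le> j" "u < t + j" using u by auto
          then have "j div N \<le> (u - t) div N" "(u - t) div N \<le> j div N"
            using N0 div_le_mono[of "j div N * N" "u - t" N] div_le_mono[of "u - t" j N] by simp_all
          then show ?thesis using False \<open>u < t + j\<close> by (simp add: R_def)
        qed (simp add: R_def)
      qed
      moreover have "card ?B = t + (j - j div N * N)" by (subst card_Un_disjoint) auto
      ultimately show ?thesis by (simp add: minus_div_mult_eq_mod)
    qed
    have "card (edges G) = (\<Sum>v<t + m. card {u. u < v \<and> R u v})"
      by (simp add: G_def card_edges_back_graph)
    also have "\<dots> = (\<Sum>v<t. card {u. u < v \<and> R u v}) + (\<Sum>j<m. card {u. u < t + j \<and> R u (t + j)})"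
    proof (induction m)
      case (Suc m)
      then show ?case by (simp add: add.assoc)
    qed simp
    also have "\<dots> = (\<Sum>v<t. v) + (t * m + (\<Sum>j<m. j mod N))"
      by (simp add: low high sum.distrib)
    finally have "2 * card (edges G) = 2 * (\<Sum>v<t. v) + 2 * t * m + 2 * (\<Sum>j<m. j mod N)" by simp
    moreover have "2 * (\<Sum>v<t. v) = t * (t - 1)" 
    proof (induction t)
      case (Suc t)
      then show ?case by (cases t) auto
    qed simp
    ultimately show ?thesis using sum_mod_deficit[of k m] by (simp add: N_def)
  qed
  ultimately show ?thesis
    using that[of G] by (auto simp: G_def simple_back_graph) (simp add: back_graph_def)
qed

section \<open>Vertices of large degree and clique components\<close>

lemma edges_le_degree_sum:
  assumes "sgr V E" "S \<subseteq> V"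
  shows "card E \<le> card (ind E (V - S)) + (\<Sum>v\<in>S. card (nb E V v))"
proof -
  have fin: "finite V" by (rule sgr_finite_verts[OF assms(1)])
  have "finite S" using assms(2) fin by (rule finite_subset)
  then show ?thesis
    using assms(2)
  proof (induction S rule: finite_induct)
    case empty
    then show ?case by (simp add: ind_self[OF assms(1)])
  next
    case (insert x S)
    have eq: "V - S - {x} = V - insert x S" by auto
    have "card (ind E (V - S)) = card (ind E (V - insert x S)) + card (nb E (V - S) x)"
      using card_ind_remove[OF assms(1), of "V - S" x] insert fin by (simp add: eq)
    moreover have "card (nb E (V - S) x) \<le> card (nb E V x)"
      using fin by (intro card_mono nb_mono) auto
    ultimately show ?case using insert by simp
  qed
qed

text \<open>The missing pairs are kept on the left to make this an equation: once the bounds on both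
  sides meet, every pair between \<open>T\<close> and \<open>W\<close> must be an edge.\<close>

lemma join_edge_count:
  assumes "sgr V E" "finite T" "finite W" "T \<inter> W = {}"
  shows "card (ind E (T \<union> W)) + (\<Sum>x\<in>T. card (W - nb E W x)) =
    card (ind E T) + card T * card W + card (ind E W)"
  using assms(2,4)
proof (induction T rule: finite_induct)
  case empty
  then show ?case by (simp add: ind_empty[OF assms(1)])
next
  case (insert x T)
  have "nb E (T \<union> W) x = nb E T x \<union> nb E W x" "nb E T x \<inter> nb E W x = {}"
    using insert.prems by (auto simp: nb_def)
  then have "card (nb E (T \<union> W) x) = card (nb E T x) + card (nb E W x)"
    using insert.hyps(1) assms(3) by (simp add: card_Un_disjoint)
  moreover have "card (W - nb E W x) + card (nb E W x) = card W"
    using nb_subset[of E W x] assms(3) by (metis card_Diff_subset card_mono finite_nb le_add_diff_inverse2)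
  moreover have "card (ind E (insert x (T \<union> W))) = card (ind E (T \<union> W)) + card (nb E (T \<union> W) x)"
    using insert assms(3) by (intro card_ind_insert[OF assms(1)]) auto
  moreover have "card (ind E (insert x T)) = card (ind E T) + card (nb E T x)"
    using insert by (intro card_ind_insert[OF assms(1)]) auto
  ultimately show ?case using insert by simp
qed

text \<open>Stars are placed one at a time, and each placed star joins the forbidden set
  \<open>X\<close>. The degree condition survives because the sum of the sizes still to come drops
  by at least what \<open>X\<close> gains.\<close>

lemma greedy_stars:
  assumes "sgr V E" "finite I" "inj_on c I" "finite X" "c ` I \<inter> X = {}"
    and "\<And>i. i \<in> I \<Longrightarrow> (\<Sum>j\<in>I. a j + 1) + card X \<le> card (nb E V (c i))"
  shows "\<exists>L. star_system E I a c L \<and> star_verts I c L \<inter> X = {}"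
  using assms(2-)
proof (induction I arbitrary: X rule: finite_induct)
  case empty
  then show ?case by (simp add: star_system_def)
next
  case (insert i I)
  have finV: "finite V" by (rule sgr_finite_verts[OF assms(1)])
  \<comment> \<open>Leaves have to avoid the forbidden set and all centres, including those not yet
    served.\<close>
  let ?B = "X \<union> c ` insert i I"
  have "card (nb E V (c i)) \<le> card (nb E V (c i) - ?B) + card ?B"
    using finV insert.hyps(1) insert.prems(2)
    by (metis card_Un_le diff_card_le_card_Diff finite_Un finite_imageI finite_insert le_diff_conv)
  moreover have "card ?B \<le> card X + Suc (card I)"
    using card_Un_le[of X "c ` insert i I"] card_image_le[of "insert i I" c] insert.hyps by simp
  moreover have "(\<Sum>j\<in>insert i I. a j + 1) = a i + 1 + (\<Sum>j\<in>I. a j + 1)" using insert.hyps by simp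
  moreover have "card I \<le> (\<Sum>j\<in>I. a j + 1)"
    using sum_mono[of I "\<lambda>_. 1" "\<lambda>j. a j + 1"] by simp
  ultimately have "a i \<le> card (nb E V (c i) - ?B)" using insert.prems(4)[of i] by simp
  then obtain Li where Li: "Li \<subseteq> nb E V (c i) - ?B" "card Li = a i" "finite Li"
    by (rule obtain_subset_with_card_n)
  define X' where "X' = X \<union> insert (c i) Li"
  have finX': "finite X'" using insert.prems(2) Li(3) by (simp add: X'_def)
  have ci: "c i \<notin> c ` I" "c i \<notin> Li" using insert.prems(1) insert.hyps(2) Li(1) by (auto simp: inj_on_def)
  have "card X' \<le> card X + (a i + 1)"
    using card_Un_le[of X "insert (c i) Li"] Li(2,3) ci(2) by (simp add: X'_def)
  then have bound: "(\<Sum>j\<in>I. a j + 1) + card X' \<le> card (nb E V (c j))" if "j \<in> I" for j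
    using insert.prems(4)[of j] that insert.hyps by simp
  have "c ` I \<inter> X' = {}" using ci Li(1) insert.prems(3) by (auto simp: X'_def)
  moreover have "inj_on c I" using insert.prems(1) by simp
  ultimately obtain L where L: "star_system E I a c L" "star_verts I c L \<inter> X' = {}"
    using insert.IH[OF _ finX' _ bound] by blast
  have "star_system E (insert i I) a (c(i := c i)) (L(i := Li))"
    using L(1) insert.hyps(2) Li(3,2) ci(2)
  proof (rule star_system_insert)
    show "{c i, u} \<in> E" if "u \<in> Li" for u using that Li(1) by (auto simp: nb_def)
    show "star_verts I c L \<inter> insert (c i) Li = {}" using L(2) unfolding X'_def by blast
  qed
  moreover have "star_verts (insert i I) (c(i := c i)) (L(i := Li)) \<inter> X = {}"
    unfolding star_verts_insert[OF insert.hyps(2)] using L(2) Li(1) insert.prems(3) unfolding X'_def by blast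
  ultimately show ?case unfolding fun_upd_triv by blast
qed

lemma forest_from_hubs:
  assumes "sgr V E" "finite T" "card T = t" "finite X" "T \<inter> X = {}"
    and "\<And>v. v \<in> T \<Longrightarrow> (\<Sum>j\<in>{1..t}. a j + 1) + card X \<le> card (nb E V v)"
  obtains c L where "star_system E {1..t} a c L" "star_verts {1..t} c L \<inter> X = {}"
proof -
  obtain c where c: "bij_betw c {1..t} T"
    using finite_same_card_bij[of "{1..t}" T] assms(2,3) by auto
  have im: "c ` {1..t} = T" and inj: "inj_on c {1..t}" using c by (auto simp: bij_betw_def)
  have "\<exists>L. star_system E {1..t} a c L \<and> star_verts {1..t} c L \<inter> X = {}"
  proof (rule greedy_stars[OF assms(1) _ inj assms(4)])
    show "c ` {1..t} \<inter> X = {}" using im assms(5) by simp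
    show "(\<Sum>j\<in>{1..t}. a j + 1) + card X \<le> card (nb E V (c i))" if "i \<in> {1..t}" for i
      using assms(6)[of "c i"] that im by blast
  qed simp
  then show ?thesis using that by blast
qed

text \<open>The hub \<open>w\<close> may belong to \<open>X\<close>, where it serves the path. The
  other t - 1 hubs carry the stars with indices below \<open>t\<close>, and the star with index
  \<open>t\<close> sits at \<open>v\<close>.\<close>

lemma forest_from_hubs_and_star:
  assumes "sgr V E" "finite T" "card T = t" "1 \<le> t" "w \<in> T" "finite X" "T \<inter> X \<subseteq> {w}"
    and v: "v \<notin> T" "L0 \<inter> T = {}" "finite L0" "card L0 = a t" "v \<notin> L0" "\<And>u. u \<in> L0 \<Longrightarrow> {v, u} \<in> E"
      "insert v L0 \<inter> X = {}"
    and deg: "\<And>v. v \<in> T \<Longrightarrow> (\<Sum>j\<in>{1..t}. a j + 1) + card X \<le> card (nb E V v)"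
  obtains c L where "star_system E {1..t} a c L" "star_verts {1..t} c L \<inter> X = {}"
proof -
  define r where "r = t - 1"
  have t: "t = Suc r" using assms(4) by (simp add: r_def)
  have I: "{1..t} = insert t {1..r}" "t \<notin> {1..r}" using t by auto
  have sum: "(\<Sum>j\<in>{1..t}. a j + 1) = (a t + 1) + (\<Sum>j\<in>{1..r}. a j + 1)" using I by simp
  have cX: "card (X \<union> insert v L0) \<le> card X + (a t + 1)"
    using card_Un_le[of X "insert v L0"] v(3-5) by simp
  obtain c L where cL: "star_system E {1..r} a c L"
    "star_verts {1..r} c L \<inter> (X \<union> insert v L0) = {}"
  proof (rule forest_from_hubs[OF assms(1), of "T - {w}" r "X \<union> insert v L0" a])
    show "card (T - {w}) = r" using assms(2,3,5) t by simp
    show "(T - {w}) \<inter> (X \<union> insert v L0) = {}" using assms(7) v(1,2) by auto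
    show "(\<Sum>j\<in>{1..r}. a j + 1) + card (X \<union> insert v L0) \<le> card (nb E V u)" if "u \<in> T - {w}" for u
      using deg[of u] that sum cX by simp
  qed (use assms(2,6) v(3) in auto)
  have "star_system E (insert t {1..r}) a (c(t := v)) (L(t := L0))"
    using cL(1) I(2) v(3-6)
  proof (rule star_system_insert)
    show "star_verts {1..r} c L \<inter> insert v L0 = {}" using cL(2) by blast
  qed
  moreover have "star_verts (insert t {1..r}) (c(t := v)) (L(t := L0)) \<inter> X = {}"
    unfolding star_verts_insert[OF I(2)] using cL(2) v(7) by blast
  ultimately show ?thesis unfolding I(1)[symmetric] by (rule that)
qed

section \<open>Components of small deficit\<close>

text \<open>No part of the graph has negative deficit, so deficit 0 passes to each part of a
  disconnected graph. For a connected graph the degenerate case costs k(k+1) > 0 and the case of a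
  clique core is strict, so only K_{2k+1} remains.\<close>

lemma zero_deficit_clique:
  assumes "sgr V E" "pfree E (2 * k + 2)" "1 \<le> k" "V \<noteq> {}" "2 * k * card V \<le> 2 * card E"
  shows "\<exists>Z\<subseteq>V. card Z = 2 * k + 1 \<and> clique E Z"
  using assms(1,2,4,5)
proof (induction "card V" arbitrary: V E rule: less_induct)
  case less
  note sgr = less.prems(1) and free = less.prems(2) and ne = less.prems(3) and edges = less.prems(4)
  have fin: "finite V" by (rule sgr_finite_verts[OF sgr])
  have cpos: "0 < card V" using ne fin by (simp add: card_gt_0_iff)
  show ?case
  proof (cases "conn E V")
    case True
    show ?thesis
      using sgr True free
    proof (cases rule: conn_deficit_cases)
      case small
      have le: "2 * card E \<le> card V * (card V - 1)"
        using card_ind_le[OF sgr fin] ind_self[OF sgr] by simp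
      moreover have "card V * (2 * k) = 2 * k * card V" by simp
      ultimately have "card V * (2 * k) \<le> card V * (card V - 1)" using edges by linarith
      then have "2 * k \<le> card V - 1" using cpos by simp
      then have c: "card V = 2 * k + 1" using small(1) cpos by linarith
      then have "card V * (card V - 1) \<le> 2 * card (ind E V)"
        using edges ind_self[OF sgr] by simp
      then show ?thesis using full_clique[OF sgr fin] c by (intro exI[of _ V]) blast
    next
      case degen
      have "0 < k * (k + 1)" using assms(3) by simp
      then show ?thesis using degen(3) edges by linarith
    next
      case pendant
      then show ?thesis using edges by linarith
    qed
  next
    case False
    then obtain A where A: "A \<subset> V" "A \<noteq> {}"
      "card V = card A + card (V - A)" "card (ind E V) = card (ind E A) + card (ind E (V - A))"
      using not_connE[OF sgr] by metis
    have sA: "sgr A (ind E A)" "sgr (V - A) (ind E (V - A))" using sgr_ind[OF sgr] A(1) by auto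
    have "2 * card (ind E (V - A)) \<le> 2 * k * card (V - A)"
      using pfree_edges[OF sA(2) pfree_subset[OF free ind_subset]] by linarith
    then have "2 * k * card A \<le> 2 * card (ind E A)"
      using edges A(3,4) ind_self[OF sgr] by (simp add: distrib_left)
    then obtain Z where Z: "Z \<subseteq> A" "card Z = 2 * k + 1" "clique (ind E A) Z"
      using less.hyps[OF psubset_card_mono[OF fin A(1)] sA(1) pfree_subset[OF free ind_subset] A(2)] by blast
    have "Z \<subseteq> V" using Z(1) A(1) by blast
    moreover have "clique E Z"
      using Z(3) by (simp add: pair_in_ind)
    ultimately show ?thesis using Z(2) by blast
  qed
qed

text \<open>A large degenerate component already uses up the whole deficit k(k+1) allowed for
  \<open>H\<close>. So it is itself tight and \<open>extremal_structure\<close> applies, while the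
  rest has deficit 0 and contains a K_{2k+1} unless it is empty.\<close>

lemma degenerate_component:
  assumes sgr: "sgr W H" and free: "pfree H (2 * k + 2)" and k: "1 \<le> k"
    and edges: "2 * k * card W \<le> 2 * card H + k * (k + 1)"
    and C: "C \<subseteq> W" "conn H C" "\<And>u v. u \<in> C \<Longrightarrow> v \<in> W - C \<Longrightarrow> {u, v} \<notin> H"
    and big: "2 * k + 2 \<le> card C" and degen: "degenerate (ind H C) C k"
  obtains U where "U \<subseteq> C" "card U = k" "\<And>u v. u \<in> U \<Longrightarrow> v \<in> C \<Longrightarrow> u \<noteq> v \<Longrightarrow> {u, v} \<in> H"
    "\<And>u v. u \<in> C - U \<Longrightarrow> v \<in> C - U \<Longrightarrow> {u, v} \<notin> H"
    "2 * k * card W = 2 * card H + k * (k + 1)"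
    "W = C \<or> (\<exists>Z\<subseteq>W - C. card Z = 2 * k + 1 \<and> clique H Z)"
proof -
  have fin: "finite W" by (rule sgr_finite_verts[OF sgr])
  have finC: "finite C" using C(1) fin by (rule finite_subset)
  have sC: "sgr C (ind H C)" and sD: "sgr (W - C) (ind H (W - C))" using sgr_ind[OF sgr] C(1) by auto
  have freeC: "pfree (ind H C) (2 * k + 2)" and freeD: "pfree (ind H (W - C)) (2 * k + 2)"
    using pfree_subset[OF free ind_subset] by auto
  have W: "C \<union> (W - C) = W" using C(1) by auto
  have cW: "card W = card C + card (W - C)"
    using finC fin C(1) card_mono[OF fin C(1)] by (simp add: card_Diff_subset)
  have "card (ind H (C \<union> (W - C))) = card (ind H C) + card (ind H (W - C))"
    by (rule card_ind_Un_separated[OF sgr finC]) (use fin C(3) in auto)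
  then have cH: "card H = card (ind H C) + card (ind H (W - C))"
    unfolding W ind_self[OF sgr] .
  have 1: "2 * card (ind H C) + k * (k + 1) \<le> 2 * k * card C"
    using degenerate_edges[OF sC degen, of C] big ind_ind[of C C H] by simp
  have 2: "2 * card (ind H (W - C)) \<le> 2 * k * card (W - C)"
    using pfree_edges[OF sD freeD] by linarith
  have sum: "2 * k * card W = 2 * k * card C + 2 * k * card (W - C)" using cW by (simp add: distrib_left)
  have eqs: "2 * k * card C \<le> 2 * card (ind H C) + k * (k + 1)"
    "2 * k * card (W - C) \<le> 2 * card (ind H (W - C))" "2 * k * card W = 2 * card H + k * (k + 1)"
    using 1 2 sum cH edges by linarith+
  have "conn (ind H C) C" using C(2) by (simp add: conn_ind)
  then obtain U where U: "U \<subseteq> C" "card U = k"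
    "\<forall>u\<in>U. \<forall>v\<in>C. u \<noteq> v \<longrightarrow> {u, v} \<in> ind H C" "\<forall>u\<in>C - U. \<forall>v\<in>C - U. {u, v} \<notin> ind H C"
    using extremal_structure[OF sC _ freeC degen eqs(1) big] by blast
  have w: "W = C \<or> (\<exists>Z\<subseteq>W - C. card Z = 2 * k + 1 \<and> clique H Z)"
  proof (cases "W - C = {}")
    case True
    then show ?thesis using C(1) by auto
  next
    case False
    from zero_deficit_clique[OF sD freeD k False eqs(2)] show ?thesis
      unfolding pair_in_ind by (intro disjI2) blast
  qed
  have a: "{u, v} \<in> H" if "u \<in> U" "v \<in> C" "u \<noteq> v" for u v
    using U(3) that unfolding pair_in_ind by blast
  have b: "{u, v} \<notin> H" if "u \<in> C - U" "v \<in> C - U" for u v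
    using U(4) that unfolding pair_in_ind by blast
  show ?thesis by (rule that[OF U(1,2) a b eqs(3) w])
qed

text \<open>Without large degenerate components, a component has at most 2k+1 vertices if its
  deficit is 0 and at most 2k+1 vertices per unit of deficit otherwise. The deficits sum to at most
  \<open>K\<close>, so all but (2k+1)K vertices lie in components K_{2k+1}, of which the bound on
  \<open>card W\<close> leaves K + 2.\<close>

lemma many_cliques:
  assumes sgr: "sgr W H" and free: "pfree H (2 * k + 2)" and k: "1 \<le> k"
    and edges: "2 * k * card W \<le> 2 * card H + K"
    and big: "(2 * k + 1) * (2 * K + 2) \<le> card W"
    and comp: "components H W \<C>"
    and no: "\<And>C. C \<in> \<C> \<Longrightarrow> 2 * k + 2 \<le> card C \<Longrightarrow> \<not> degenerate (ind H C) C k"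
  obtains \<Z> where "\<Z> \<subseteq> \<C>" "K + 2 \<le> card \<Z>"
    "\<And>Z. Z \<in> \<Z> \<Longrightarrow> card Z = 2 * k + 1 \<and> clique H Z"
proof -
  have fin: "finite W" by (rule sgr_finite_verts[OF sgr])
  have finC: "finite \<C>" and sub: "\<And>C. C \<in> \<C> \<Longrightarrow> C \<subseteq> W" and ne: "\<And>C. C \<in> \<C> \<Longrightarrow> C \<noteq> {}"
    and cn: "\<And>C. C \<in> \<C> \<Longrightarrow> conn H C"
    using comp unfolding components_def by blast+
  define d where "d C = 2 * k * card C - 2 * card (ind H C)" for C
  have sC: "sgr C (ind H C)" if "C \<in> \<C>" for C using sgr_ind[OF sgr sub[OF that]] .
  have freeC: "pfree (ind H C) (2 * k + 2)" for C using pfree_subset[OF free ind_subset] .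
  have le: "2 * card (ind H C) \<le> 2 * k * card C" if "C \<in> \<C>" for C
    using pfree_edges[OF sC[OF that] freeC] by linarith
  define \<Z> where "\<Z> = {C \<in> \<C>. d C = 0}"
  have bound: "card C \<le> (2 * k + 1) * ((if d C = 0 then 1 else 0) + d C)" if CC: "C \<in> \<C>" for C
  proof -
    have "conn (ind H C) C" using cn[OF CC] by (simp add: conn_ind)
    from sC[OF CC] this freeC show ?thesis
    proof (cases rule: conn_deficit_cases)
      case small
      then show ?thesis by (cases "d C") auto
    next
      case degen
      then show ?thesis using no[OF CC] by blast
    next
      case pendant
      then have "0 < d C" "card C \<le> 2 * k + d C" by (auto simp: d_def)
      moreover have "2 * k \<le> 2 * k * d C" using \<open>0 < d C\<close> by simp
      moreover have "(2 * k + 1) * ((if d C = 0 then 1 else 0) + d C) = 2 * k * d C + d C"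
        using \<open>0 < d C\<close> by simp
      ultimately show ?thesis by linarith
    qed
  qed
  have dK: "(\<Sum>C\<in>\<C>. d C) \<le> K"
  proof -
    have "(\<Sum>C\<in>\<C>. d C) + 2 * card H = (\<Sum>C\<in>\<C>. d C + 2 * card (ind H C))"
      using components_sums(2)[OF sgr comp] by (simp add: sum.distrib sum_distrib_left)
    also have "\<dots> = (\<Sum>C\<in>\<C>. 2 * k * card C)" using le by (intro sum.cong) (auto simp: d_def)
    also have "\<dots> = 2 * k * card W"
      using components_sums(1)[OF sgr comp] by (simp add: sum_distrib_left)
    finally show ?thesis using edges by linarith
  qed
  have "card W \<le> (\<Sum>C\<in>\<C>. (2 * k + 1) * ((if d C = 0 then 1 else 0) + d C))"
    unfolding components_sums(1)[OF sgr comp] by (rule sum_mono) (rule bound)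
  also have "\<dots> = (2 * k + 1) * (card \<Z> + (\<Sum>C\<in>\<C>. d C))"
    using finC by (simp add: sum_distrib_left[symmetric] sum.distrib \<Z>_def sum.If_cases Int_def del: One_nat_def)
  also have "\<dots> \<le> (2 * k + 1) * (card \<Z> + K)" using dK by (intro mult_left_mono) auto
  finally have "(2 * k + 1) * (2 * K + 2) \<le> (2 * k + 1) * (card \<Z> + K)" using big by linarith
  then have "2 * K + 2 \<le> card \<Z> + K" by (subst (asm) mult_le_cancel1) simp
  then have "K + 2 \<le> card \<Z>" by simp
  moreover have "card Z = 2 * k + 1 \<and> clique H Z" if "Z \<in> \<Z>" for Z
  proof -
    have Z: "Z \<in> \<C>" "d Z = 0" using that by (auto simp: \<Z>_def)
    then have "2 * k * card Z \<le> 2 * card (ind H Z)" by (simp add: d_def)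
    from zero_deficit_clique[OF sC[OF Z(1)] freeC k ne[OF Z(1)] this]
    obtain Z' where Z': "Z' \<subseteq> Z" "card Z' = 2 * k + 1"
      "clique (ind H Z) Z'" by blast
    have "card Z \<le> 2 * k + 1" using bound[OF Z(1)] Z(2) by simp
    then have "Z' = Z"
      using Z'(1,2) finite_subset[OF sub[OF Z(1)] fin] by (intro card_seteq) auto
    then show ?thesis using Z'(2,3) by (simp add: pair_in_ind)
  qed
  moreover have "\<Z> \<subseteq> \<C>" by (auto simp: \<Z>_def)
  ultimately show ?thesis using that by blast
qed

text \<open>Let \<open>S0\<close> be the vertex set of the given stars. Off \<open>S0\<close> there
  is no long path, hence at most \<open>k\<close> edges per vertex, so about t times
  \<open>card V\<close> edges meet \<open>S0\<close>. With fewer than \<open>t\<close> vertices of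
  degree at least \<open>D\<close> in \<open>S0\<close>, there would be at most (t-1)
  \<open>card V\<close> + \<open>s * D\<close> of these, which \<open>big\<close> excludes.\<close>

lemma ex_hubs:
  assumes sgr: "sgr V E" and S: "star_system E {1..t} a c L" and t: "1 \<le> t"
    and a: "\<And>i. i \<in> {1..t} \<Longrightarrow> 1 \<le> a i"
    and free: "\<And>xs. gpath E xs \<Longrightarrow> star_verts {1..t} c L \<inter> set xs = {} \<Longrightarrow> length xs \<noteq> 2 * k + 2"
    and edges: "2 * (t + k) * card V \<le> 2 * card E + q"
    and big: "2 * (\<Sum>j\<in>{1..t}. a j + 1) * D + q < 2 * card V"
  obtains T where "T \<subseteq> V" "card T = t" "\<And>v. v \<in> T \<Longrightarrow> D \<le> card (nb E V v)"
proof -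
  define s where "s = (\<Sum>j\<in>{1..t}. a j + 1)"
  define S0 where "S0 = star_verts {1..t} c L"
  have fin: "finite V" by (rule sgr_finite_verts[OF sgr])
  have S0V: "S0 \<subseteq> V"
  proof
    fix x assume "x \<in> S0"
    then obtain i where i: "i \<in> {1..t}" "x \<in> insert (c i) (L i)" by (auto simp: S0_def)
    obtain u where "{c i, u} \<in> E" using star_system_leaf[OF S i(1) a[OF i(1)]] by blast
    then have "c i \<in> V" using sgr_edge(1)[OF sgr] by blast
    moreover have "x \<in> V" if "x \<in> L i"
      using sgr_edge(2)[OF sgr star_systemD(4)[OF S i(1) that]] .
    ultimately show "x \<in> V" using i(2) by blast
  qed
  have finS0: "finite S0" using S0V fin by (rule finite_subset)
  have cS0: "card S0 \<le> s"
  proof -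
    have "card S0 \<le> (\<Sum>i\<in>{1..t}. card (insert (c i) (L i)))" unfolding S0_def by (rule card_UN_le) simp
    also have "\<dots> \<le> s" unfolding s_def
    proof (rule sum_mono)
      show "card (insert (c i) (L i)) \<le> a i + 1" if "i \<in> {1..t}" for i
        using star_systemD[OF S that] by simp
    qed
    finally show ?thesis .
  qed
  have "pfree (ind E (V - S0)) (2 * k + 2)"
  proof (rule ccontr)
    assume "\<not> ?thesis"
    then obtain xs where xs: "gpath (ind E (V - S0)) xs" "length xs = 2 * k + 2" by (rule not_pfreeE)
    then have "gpath E xs" "set xs \<subseteq> V - S0" by (simp_all add: gpath_ind_iff)
    then show False using free[of xs] xs(2) unfolding S0_def by blast
  qed
  then have "2 * card (ind E (V - S0)) \<le> 2 * k * card (V - S0)"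
    using pfree_edges[OF sgr_ind[OF sgr, of "V - S0"], of k] by auto
  moreover have "2 * k * card (V - S0) \<le> 2 * k * card V" using fin by (simp add: card_mono)
  ultimately have e1: "2 * card (ind E (V - S0)) \<le> 2 * k * card V" by linarith
  define X where "X = {v \<in> S0. D \<le> card (nb E V v)}"
  have finX: "finite X" using finS0 by (simp add: X_def)
  have "t \<le> card X"
  proof (rule ccontr)
    assume "\<not> ?thesis"
    then have Xt: "card X + 1 \<le> t" by simp
    have "(\<Sum>v\<in>S0. card (nb E V v)) \<le> (\<Sum>v\<in>S0. (if v \<in> X then card V else 0) + D)"
      using fin nb_subset[of E V] by (intro sum_mono) (auto simp: X_def intro!: trans_le_add1 card_mono)
    also have "\<dots> = card X * card V + card S0 * D"
    proof -
      have "S0 \<inter> X = X" by (auto simp: X_def)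
      then show ?thesis using finS0 by (simp add: sum.distrib sum.If_cases)
    qed
    also have "\<dots> \<le> card X * card V + s * D" using cS0 by simp
    finally have "card E \<le> card (ind E (V - S0)) + card X * card V + s * D"
      using edges_le_degree_sum[OF sgr S0V] by linarith
    then have "2 * (t + k) * card V \<le> 2 * k * card V + 2 * (card X * card V) + 2 * s * D + q"
      using e1 edges by linarith
    moreover have "card X * card V + card V \<le> t * card V" using mult_le_mono1[OF Xt, of "card V"] by simp
    moreover have "2 * (t + k) * card V = 2 * (t * card V) + 2 * k * card V" by (simp add: algebra_simps)
    ultimately have "2 * card V \<le> 2 * s * D + q" by linarith
    then show False using big by (simp add: s_def)
  qed
  then obtain T where "T \<subseteq> X" "card T = t" by (meson obtain_subset_with_card_n)
  moreover from this have "T \<subseteq> V" using S0V by (auto simp: X_def)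
  ultimately show ?thesis using that by (auto simp: X_def)
qed

section \<open>The extremal graphs\<close>

lemma degree_eq_card_nb:
  assumes "sgr V E"
  shows "degree (Graph V E) v = card (nb E V v)"
proof -
  have "{e \<in> E. v \<in> e} = (\<lambda>u. {v, u}) ` nb E V v"
  proof (intro set_eqI iffI)
    fix e assume "e \<in> {e \<in> E. v \<in> e}"
    then have e: "e \<in> E" "v \<in> e" by auto
    obtain x y where xy: "e = {x, y}" "x \<in> V" "y \<in> V" using sgr_edgeE[OF assms e(1)] by metis
    have "v = x \<or> v = y" using e(2) xy(1) by blast
    then obtain u where "e = {v, u}" "u \<in> V" using xy by (metis insert_commute)
    then show "e \<in> (\<lambda>u. {v, u}) ` nb E V v" using e(1) by (simp add: nb_def)
  qed (auto simp: nb_def)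
  moreover have "inj_on (\<lambda>u. {v, u}) (nb E V v)" by (auto simp: inj_on_def doubleton_eq_iff)
  ultimately show ?thesis by (simp add: degree_def card_image)
qed

text \<open>Twice the edge number of K_{t+k} joined to an edgeless graph, on t + m vertices in all,
  is expressed in two ways: directly, and as K_t joined to a graph on m vertices of deficit k(k+1).
  The terms are moved so that no subtraction of the losses occurs.\<close>

lemma edge_bound_identity:
  fixes t k m :: nat
  shows "t * (t - 1) + 2 * t * m + 2 * k * m + (t + k) * (t + k + 1) = 2 * (t + k) * (t + m) + k * (k + 1)"
  by (cases t) (simp_all add: algebra_simps)

definition forest_free :: "'a set set \<Rightarrow> nat \<Rightarrow> (nat \<Rightarrow> nat) \<Rightarrow> nat \<Rightarrow> bool" where
  "forest_free E t a l \<longleftrightarrow> \<not> (\<exists>c L xs. star_system E {1..t} a c L \<and> gpath E xs \<and> length xs = l \<and>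
     star_verts {1..t} c L \<inter> set xs = {})"

lemma forest_freeD:
  assumes "forest_free E t a l" "star_system E {1..t} a c L" "gpath E xs"
    "star_verts {1..t} c L \<inter> set xs = {}"
  shows "length xs \<noteq> l"
  using assms unfolding forest_free_def by blast

lemma hubs_pfree:
  assumes "sgr V E" "forest_free E t a l" "finite T" "card T = t" "2 \<le> l"
    and "\<And>v. v \<in> T \<Longrightarrow> (\<Sum>j\<in>{1..t}. a j + 1) + l \<le> card (nb E V v)"
  shows "pfree (ind E (V - T)) l"
proof (rule ccontr)
  assume "\<not> ?thesis"
  then obtain xs where xs: "gpath (ind E (V - T)) xs" "length xs = l" by (rule not_pfreeE)
  then have p: "gpath E xs" "set xs \<subseteq> V - T" using assms(5) by (simp_all add: gpath_ind_iff)
  have "card (set xs) = l" using distinct_card[OF gpath_distinct[OF p(1)]] xs(2) by simp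
  then obtain c L where "star_system E {1..t} a c L" "star_verts {1..t} c L \<inter> set xs = {}"
    using forest_from_hubs[OF assms(1,3,4), of "set xs" a] p(2) assms(6) by auto
  then show False using forest_freeD[OF assms(2)] p(1) xs(2) by blast
qed

text \<open>The path is \<open>w\<close> followed by a spanning path of \<open>Z\<close> from
  \<open>z\<close>, on 2k+2 vertices. It occupies the hub \<open>w\<close>, but \<open>v\<close> has
  enough neighbours in \<open>W - Z\<close> to carry the star with index \<open>t\<close>
  instead.\<close>

lemma no_clique_and_star:
  assumes sgr: "sgr V E" and free: "forest_free E t a (2 * k + 2)" and T: "finite T" "card T = t" "1 \<le> t"
    and deg: "\<And>v. v \<in> T \<Longrightarrow> (\<Sum>j\<in>{1..t}. a j + 1) + (2 * k + 2) \<le> card (nb E V v)"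
    and Z: "finite Z" "Z \<inter> T = {}" "card Z = 2 * k + 1" "\<And>x y. x \<in> Z \<Longrightarrow> y \<in> Z \<Longrightarrow> x \<noteq> y \<Longrightarrow> {x, y} \<in> E"
    and w: "w \<in> T" "z \<in> Z" "{w, z} \<in> E"
    and v: "v \<notin> Z \<union> T" "finite W" "W \<inter> T = {}" "a t \<le> card (nb E (W - Z) v)"
  shows False
proof -
  obtain zs where zs: "gpath E (z # zs)" "set (z # zs) = Z" "length (z # zs) = card Z"
    using clique_path[OF Z(1), of E z] Z(4) w(2) by blast
  have wZ: "w \<notin> Z" using w(1) Z(2) by auto
  then have p: "gpath E (w # z # zs)" using zs w(3) by (simp add: gpath_Cons)
  have len: "length (w # z # zs) = 2 * k + 2" using zs(3) Z(3) by simp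
  have set: "set (w # z # zs) = insert w Z" using zs(2) by auto
  have cX: "card (insert w Z) = 2 * k + 2" using Z(1,3) wZ by simp
  obtain L0 where L0: "L0 \<subseteq> nb E (W - Z) v" "card L0 = a t" "finite L0"
    using obtain_subset_with_card_n[OF v(4)] by blast
  have "v \<notin> L0" using L0(1) nb_self[OF sgr, of v "W - Z"] by blast
  moreover have "L0 \<subseteq> W - Z" using L0(1) nb_subset[of E "W - Z" v] by (rule order_trans)
  moreover have "\<And>u. u \<in> L0 \<Longrightarrow> {v, u} \<in> E" using L0(1) by (auto simp: nb_def)
  ultimately obtain c L where "star_system E {1..t} a c L"
    "star_verts {1..t} c L \<inter> insert w Z = {}"
  proof (rule_tac forest_from_hubs_and_star[OF sgr T w(1), of "insert w Z" v L0 a])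
    assume L: "v \<notin> L0" "L0 \<subseteq> W - Z" "\<And>u. u \<in> L0 \<Longrightarrow> {v, u} \<in> E"
    show "T \<inter> insert w Z \<subseteq> {w}" using Z(2) by blast
    show "L0 \<inter> T = {}" using L(2) v(3) by blast
    have "v \<noteq> w" using v(1) w(1) by blast
    moreover have "w \<notin> L0" using L(2) v(3) w(1) by blast
    ultimately show "insert v L0 \<inter> insert w Z = {}" using L(2) v(1) by blast
    show "(\<Sum>j\<in>{1..t}. a j + 1) + card (insert w Z) \<le> card (nb E V u)" if "u \<in> T" for u
      using deg[OF that] cX by simp
  qed (use Z(1) v(1) L0(2,3) in auto)
  then show False using forest_freeD[OF free] p len set by metis
qed

lemma universal_of_no_missing:
  assumes sgr: "sgr V E" and T: "T \<subseteq> V" and full: "card T * (card T - 1) \<le> 2 * card (ind E T)"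
    and miss: "(\<Sum>x\<in>T. card (V - T - nb E (V - T) x)) = 0" and "u \<in> T" "v \<in> V" "u \<noteq> v"
  shows "{u, v} \<in> E"
proof (cases "v \<in> T")
  case True
  have "finite T" using T sgr_finite_verts[OF sgr] by (rule finite_subset)
  then show ?thesis using full_clique[OF sgr _ full] True assms(5,7) by blast
next
  case False
  have fin: "finite V" by (rule sgr_finite_verts[OF sgr])
  have "finite T" using T fin by (rule finite_subset)
  then have "card (V - T - nb E (V - T) u) = 0" using miss assms(5) by simp
  then have "V - T - nb E (V - T) u = {}" using fin by simp
  then have "v \<in> nb E (V - T) u" using False assms(6) by blast
  then show ?thesis by (simp add: nb_def)
qed

lemma universal_join:
  assumes sgr: "sgr V E" and U: "U \<subseteq> V" "\<And>u v. u \<in> U \<Longrightarrow> v \<in> V \<Longrightarrow> u \<noteq> v \<Longrightarrow> {u, v} \<in> E"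
    and B: "Graph (V - U) (ind E (V - U)) \<simeq>\<^sub>g B"
  shows "Graph V E \<simeq>\<^sub>g complete_graph (card U) \<or>\<^sub>g B"
proof (rule iso_graph_join[OF sgr U(1) _ _ B])
  show "{u, v} \<in> E" if "u \<in> U" "v \<in> V - U" for u v using U(2)[of u v] that by blast
  have "finite U" using U(1) sgr_finite_verts[OF sgr] by (rule finite_subset)
  moreover have "{x, y} \<in> E" if "x \<in> U" "y \<in> U" "x \<noteq> y" for x y using U that by blast
  ultimately show "Graph U (ind E U) \<simeq>\<^sub>g complete_graph (card U)"
    by (rule clique_iso_complete_graph[OF sgr])
qed

lemma split_graph_iso:
  assumes sgr: "sgr V E" and U: "U \<subseteq> V" "\<And>u v. u \<in> U \<Longrightarrow> v \<in> V \<Longrightarrow> u \<noteq> v \<Longrightarrow> {u, v} \<in> E"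
    "\<And>u v. u \<in> V - U \<Longrightarrow> v \<in> V - U \<Longrightarrow> {u, v} \<notin> E"
  shows "Graph V E \<simeq>\<^sub>g complete_graph (card U) \<or>\<^sub>g graph_compl (complete_graph (card V - card U))"
proof (rule universal_join[OF sgr U(1,2)])
  have fin: "finite V" by (rule sgr_finite_verts[OF sgr])
  have "ind E (V - U) = {}"
  proof (rule ccontr)
    assume "ind E (V - U) \<noteq> {}"
    then obtain e where e: "e \<in> E" "e \<subseteq> V - U" by (auto simp: ind_def)
    obtain u v where "e = {u, v}" using sgr_edgeE[OF sgr e(1)] by metis
    then show False using e U(3)[of u v] by simp
  qed
  moreover have "card (V - U) = card V - card U"
    using U(1) fin by (simp add: card_Diff_subset finite_subset)
  ultimately show "Graph (V - U) (ind E (V - U)) \<simeq>\<^sub>g graph_compl (complete_graph (card V - card U))"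
    using independent_iso_compl[of "V - U" E] fin by simp
qed

text \<open>The hypothesis \<open>edges\<close> comes from comparison with K_{t+k} joined to an
  edgeless graph, and \<open>split\<close> from K_t joined to cliques, available when a_t \<ge>
  2k+1. The first leaves a slack of k(k+1), shared by the non-edges inside and at \<open>T\<close>
  and the deficit of \<open>H\<close>; the second leaves only \<open>deficit k m\<close>, which
  \<open>H\<close> needs anyway.\<close>

theorem hub_graph_structure:
  fixes V :: "'a set"
  assumes sgr: "sgr V E" and free: "forest_free E t a (2 * k + 2)" and T: "T \<subseteq> V" "card T = t"
    and t: "1 \<le> t" and k: "1 \<le> k" and at: "1 \<le> a t"
    and deg: "\<And>v. v \<in> T \<Longrightarrow> (\<Sum>j\<in>{1..t}. a j + 1) + (2 * k + 2) \<le> card (nb E V v)"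
    and m: "card (V - T) = m"
    and edges: "t * (t - 1) + 2 * t * m + 2 * k * m \<le> 2 * card E + k * (k + 1)"
    and big: "(2 * k + 1) * (2 * (k * (k + 1)) + 2) \<le> m"
    and split: "a t \<le> 2 * k \<or>
      2 * card E + deficit k m \<ge> t * (t - 1) + 2 * t * m + 2 * k * m"
  shows "(\<forall>u\<in>T. \<forall>v\<in>V. u \<noteq> v \<longrightarrow> {u, v} \<in> E) \<and> pfree (ind E (V - T)) (2 * k + 2) \<and>
    (a t \<le> 2 * k \<longrightarrow> Graph (V - T) (ind E (V - T)) \<simeq>\<^sub>g
       complete_graph k \<or>\<^sub>g graph_compl (complete_graph (m - k))) \<and>
    (2 * k + 1 \<le> a t \<longrightarrow> 2 * card (ind E (V - T)) + deficit k m = 2 * k * m \<and>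
      (deficit k m = k * (k + 1) \<longrightarrow>
        (\<forall>v\<in>V - T. card (nb (ind E (V - T)) (V - T) v) < a t) \<or>
        Graph (V - T) (ind E (V - T)) \<simeq>\<^sub>g complete_graph k \<or>\<^sub>g graph_compl (complete_graph (m - k))))"
proof -
  define W where "W = V - T"
  define H where "H = ind E W"
  define K where "K = k * (k + 1)"
  define M where "M = (\<Sum>x\<in>T. card (W - nb E W x))"
  have fin: "finite V" by (rule sgr_finite_verts[OF sgr])
  have finT: "finite T" using T(1) fin by (rule finite_subset)
  have finW: "finite W" using fin by (simp add: W_def)
  have cW: "card W = m" using m by (simp add: W_def)
  have TW: "T \<inter> W = {}" "T \<union> W = V" using T(1) by (auto simp: W_def)
  have sH: "sgr W H" unfolding H_def using sgr_ind[OF sgr, of W] by (auto simp: W_def)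
  have freeH: "pfree H (2 * k + 2)"
    unfolding H_def W_def using hubs_pfree[OF sgr free finT T(2) _ deg] by simp
  have fs: "2 * card H + deficit k m \<le> 2 * k * m" using pfree_edges[OF sH freeH] cW by simp
  have cT: "2 * card (ind E T) \<le> t * (t - 1)" using card_ind_le[OF sgr finT] T(2) by simp
  have count: "card E + M = card (ind E T) + t * m + card H"
    using join_edge_count[OF sgr finT finW TW(1)] TW(2) ind_self[OF sgr] T(2) cW by (simp add: M_def H_def)
  have slack: "t * (t - 1) + 2 * k * m + 2 * M \<le> 2 * card (ind E T) + 2 * card H + K"
    using count edges unfolding K_def by linarith
  have edgesH: "2 * k * card W \<le> 2 * card H + k * (k + 1)"
    using slack cT unfolding K_def cW by linarith
  have universal: "{u, v} \<in> E" if "M = 0" "t * (t - 1) \<le> 2 * card (ind E T)" "u \<in> T" "v \<in> V" "u \<noteq> v" for u v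
    using universal_of_no_missing[OF sgr T(1)] that T(2) unfolding M_def W_def by blast
  have no_two: False if "v \<in> W" "Z \<subseteq> W" "v \<notin> Z" "card Z = 2 * k + 1"
    "\<And>x y. x \<in> Z \<Longrightarrow> y \<in> Z \<Longrightarrow> x \<noteq> y \<Longrightarrow> {x, y} \<in> E" "a t \<le> card (nb E (W - Z) v)"
    "w \<in> T" "z \<in> Z" "{w, z} \<in> E" for v Z w z
  proof (rule no_clique_and_star[OF sgr free finT T(2) t deg _ _ that(4,5,7-9) _ finW _ that(6)])
    show "finite Z" using that(2) finW by (rule finite_subset)
    show "Z \<inter> T = {}" "v \<notin> Z \<union> T" "W \<inter> T = {}" using that(1-3) TW(1) by auto
  qed
  obtain w where w: "w \<in> T" using T(2) t by fastforce
  obtain \<C> where \<C>: "components H W \<C>" using ex_components[OF sH] by blast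
  have comp: "C \<subseteq> W" "conn H C" "C \<noteq> {}" "\<And>u v. u \<in> C \<Longrightarrow> v \<in> W - C \<Longrightarrow> {u, v} \<notin> H" if "C \<in> \<C>" for C
    using \<C> that unfolding components_def by blast+
  have disj: "C \<inter> D = {}" if "C \<in> \<C>" "D \<in> \<C>" "C \<noteq> D" for C D
    using \<C> that unfolding components_def by blast
  \<comment> \<open>Both cases end here: a large degenerate component containing a vertex of degree
    at least \<open>a t\<close> is all of \<open>W\<close>, since otherwise that vertex and a
    K_{2k+1} outside give the forbidden graph. The condition \<open>hub\<close> refers to
    \<open>U\<close> because for a_t \<le> 2k the vertex is found in \<open>U\<close>.\<close>
  have join_case: "M = 0 \<and> t * (t - 1) \<le> 2 * card (ind E T) \<and> 2 * card H + K = 2 * k * m \<and>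
      Graph W H \<simeq>\<^sub>g complete_graph k \<or>\<^sub>g graph_compl (complete_graph (m - k))"
    if CC: "C \<in> \<C>" "2 * k + 2 \<le> card C" "degenerate (ind H C) C k"
      and hub: "\<And>U. U \<subseteq> C \<Longrightarrow> card U = k \<Longrightarrow> (\<And>u v. u \<in> U \<Longrightarrow> v \<in> C \<Longrightarrow> u \<noteq> v \<Longrightarrow> {u, v} \<in> H) \<Longrightarrow>
        \<exists>v\<in>C. a t \<le> card (nb H C v)" for C
  proof -
    obtain U where U: "U \<subseteq> C" "card U = k" "\<And>u v. u \<in> U \<Longrightarrow> v \<in> C \<Longrightarrow> u \<noteq> v \<Longrightarrow> {u, v} \<in> H"
      "\<And>u v. u \<in> C - U \<Longrightarrow> v \<in> C - U \<Longrightarrow> {u, v} \<notin> H"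
      and eq: "2 * k * card W = 2 * card H + k * (k + 1)"
      and Z: "W = C \<or> (\<exists>Z\<subseteq>W - C. card Z = 2 * k + 1 \<and> clique H Z)"
      by (rule degenerate_component[OF sH freeH k edgesH comp(1,2)[OF CC(1)] comp(4)[OF CC(1)] CC(2,3)])
        (assumption, assumption, rule that)
    have eqK: "2 * card H + K = 2 * k * m" using eq cW by (simp add: K_def)
    \<comment> \<open>The component takes the whole slack, so no edge is missing at
      \<open>T\<close>; in particular \<open>w\<close> will be adjacent to the clique
      outside.\<close>
    have M0: "M = 0" "t * (t - 1) \<le> 2 * card (ind E T)" using slack eqK cT by linarith+
    have "W = C"
    proof (rule ccontr)
      assume "W \<noteq> C"
      then obtain Z where Z: "Z \<subseteq> W - C" "card Z = 2 * k + 1" "clique H Z"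
        using Z by blast
      obtain v where v: "v \<in> C" "a t \<le> card (nb H C v)" using hub[OF U(1,2)] U(3) by metis
      have "nb H C v \<subseteq> nb E (W - Z) v" using Z(1) comp(1)[OF CC(1)] by (auto simp: nb_def H_def ind_def)
      then have "a t \<le> card (nb E (W - Z) v)"
        using v(2) card_mono[of "nb E (W - Z) v" "nb H C v"] finW by simp
      moreover have "Z \<noteq> {}" using Z(2) by auto
      then obtain z where z: "z \<in> Z" by blast
      moreover have "{w, z} \<in> E" using universal[OF M0 w, of z] z Z(1) TW w by blast
      moreover have "v \<in> W" "v \<notin> Z" "Z \<subseteq> W" using v(1) Z(1) comp(1)[OF CC(1)] by auto
      moreover have "{x, y} \<in> E" if "x \<in> Z" "y \<in> Z" "x \<noteq> y" for x y
        using Z(3) that unfolding H_def pair_in_ind by blast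
      ultimately show False using no_two[of v Z w z] Z(2) w by blast
    qed
    then have "Graph W H \<simeq>\<^sub>g complete_graph (card U) \<or>\<^sub>g graph_compl (complete_graph (card W - card U))"
      using U by (intro split_graph_iso[OF sH]) auto
    then show ?thesis using M0 eqK U(2) cW by simp
  qed
  show ?thesis
  proof (cases "a t \<le> 2 * k")
    case True
    have "\<exists>C\<in>\<C>. 2 * k + 2 \<le> card C \<and> degenerate (ind H C) C k"
    proof (rule ccontr)
      assume no: "\<not> ?thesis"
      have big': "(2 * k + 1) * (2 * (k * (k + 1)) + 2) \<le> card W" using big cW by simp
      obtain \<Z> where \<Z>: "\<Z> \<subseteq> \<C>" "K + 2 \<le> card \<Z>"
        "\<And>Z. Z \<in> \<Z> \<Longrightarrow> card Z = 2 * k + 1 \<and> clique H Z"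
        using many_cliques[OF sH freeH k edgesH big' \<C>] no unfolding K_def by blast
      have fin\<Z>: "finite \<Z>" using \<Z>(2) by (metis card.infinite not_numeral_le_zero add_leE)
      have cl: "{x, y} \<in> E" if "Z \<in> \<Z>" "x \<in> Z" "y \<in> Z" "x \<noteq> y" for Z x y
        using \<Z>(3) that unfolding H_def pair_in_ind by blast
      \<comment> \<open>If \<open>w\<close> missed all the cliques, one vertex of each would give K
        + 2 non-neighbours of \<open>w\<close>, while the slack admits at most K / 2 missing
        pairs.\<close>
      have "\<exists>Z\<in>\<Z>. \<exists>z\<in>Z. {w, z} \<in> E"
      proof (rule ccontr)
        assume none: "\<not> ?thesis"
        have "\<forall>Z\<in>\<Z>. \<exists>z. z \<in> Z" using comp(3) \<Z>(1) by blast
        from bchoice[OF this] obtain f where f: "\<And>Z. Z \<in> \<Z> \<Longrightarrow> f Z \<in> Z" by blast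
        have "inj_on f \<Z>"
        proof (rule inj_onI, rule ccontr)
          fix C D assume CD: "C \<in> \<Z>" "D \<in> \<Z>" "f C = f D" "C \<noteq> D"
          then have "C \<inter> D = {}" using disj \<Z>(1) by blast
          then show False using f[OF CD(1)] f[OF CD(2)] CD(3) by auto
        qed
        then have "card \<Z> = card (f ` \<Z>)" by (simp add: card_image)
        also have "f ` \<Z> \<subseteq> W - nb E W w"
        proof
          fix x assume "x \<in> f ` \<Z>"
          then obtain Z where Z: "Z \<in> \<Z>" "x \<in> Z" using f by blast
          then have "x \<in> W" using comp(1) \<Z>(1) by blast
          moreover have "{w, x} \<notin> E" using none Z by blast
          ultimately show "x \<in> W - nb E W w" by (simp add: nb_def)
        qed
        then have "card (f ` \<Z>) \<le> card (W - nb E W w)" using finW by (intro card_mono) auto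
        also have "\<dots> \<le> M" unfolding M_def using finT w by (intro member_le_sum) auto
        finally have "K + 2 \<le> M" using \<Z>(2) by simp
        moreover have "2 * M \<le> K" using slack cT fs by linarith
        ultimately show False by linarith
      qed
      then obtain Z z where Z: "Z \<in> \<Z>" "z \<in> Z" "{w, z} \<in> E" by blast
      \<comment> \<open>In a second clique \<open>C\<close> every vertex has 2k \<ge> a_t neighbours
        off \<open>Z\<close>, so it can carry the smallest star.\<close>
      have "card (\<Z> - {Z}) = card \<Z> - 1" using Z(1) fin\<Z> by simp
      then have "\<Z> - {Z} \<noteq> {}" using \<Z>(2) by (metis card.empty add_2_eq_Suc' diff_Suc_1 Suc_le_mono Suc_le_D diff_is_0_eq not_less_eq_eq le0)
      then obtain C where C: "C \<in> \<Z>" "C \<noteq> Z" by blast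
      have CZ: "C \<inter> Z = {}" using disj C Z(1) \<Z>(1) by blast
      obtain v where v: "v \<in> C" using comp(3) C(1) \<Z>(1) by blast
      have CW: "C \<subseteq> W" "Z \<subseteq> W" using comp(1) C(1) Z(1) \<Z>(1) by blast+
      have finC: "finite C" using CW(1) finW by (rule finite_subset)
      have "C - {v} \<subseteq> nb E (W - Z) v"
      proof
        fix u assume u: "u \<in> C - {v}"
        then have "{v, u} \<in> E" using cl[OF C(1) v, of u] by blast
        then show "u \<in> nb E (W - Z) v" using u CZ CW by (auto simp: nb_def)
      qed
      then have "card (C - {v}) \<le> card (nb E (W - Z) v)" using finW by (intro card_mono) auto
      then have "a t \<le> card (nb E (W - Z) v)" using \<Z>(3)[OF C(1)] v finC True by simp
      then show False
        using no_two[of v Z w z] v CW CZ \<Z>(3)[OF Z(1)] cl[OF Z(1)] Z(2,3) w by blast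
    qed
    then obtain C where C: "C \<in> \<C>" "2 * k + 2 \<le> card C" "degenerate (ind H C) C k" by blast
    have finC: "finite C" using comp(1)[OF C(1)] finW by (rule finite_subset)
    \<comment> \<open>Any \<open>u\<close> in \<open>U\<close> is adjacent to the rest of
      \<open>C\<close>, that is to at least 2k+1 vertices.\<close>
    have hub: "\<exists>v\<in>C. a t \<le> card (nb H C v)" if U: "U \<subseteq> C" "card U = k"
      "\<And>u v. u \<in> U \<Longrightarrow> v \<in> C \<Longrightarrow> u \<noteq> v \<Longrightarrow> {u, v} \<in> H" for U
    proof -
      obtain u where u: "u \<in> U" using U(2) k by fastforce
      have "C - {u} \<subseteq> nb H C u" using U(3)[OF u] by (auto simp: nb_def)
      then have "card (C - {u}) \<le> card (nb H C u)" using finC by (intro card_mono) auto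
      moreover have "card (C - {u}) = card C - 1" using u U(1) finC by auto
      ultimately have "a t \<le> card (nb H C u)" using C(2) True by simp
      then show ?thesis using u U(1) by blast
    qed
    have J: "M = 0 \<and> t * (t - 1) \<le> 2 * card (ind E T) \<and> 2 * card H + K = 2 * k * m \<and>
      Graph W H \<simeq>\<^sub>g complete_graph k \<or>\<^sub>g graph_compl (complete_graph (m - k))"
      by (rule join_case[OF C hub])
    then have "\<forall>u\<in>T. \<forall>v\<in>V. u \<noteq> v \<longrightarrow> {u, v} \<in> E" using universal by blast
    then show ?thesis unfolding W_def[symmetric] H_def[symmetric]
      using J freeH True by auto
  next
    case False
    then have edges2: "t * (t - 1) + 2 * t * m + 2 * k * m \<le> 2 * card E + deficit k m" using split by blast
    \<comment> \<open>The lower bound on \<open>card E\<close> equals the sum of the upper bounds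
      for \<open>T\<close>, for the pairs between \<open>T\<close> and \<open>W\<close>, and for
      \<open>H\<close>; so all three are attained.\<close>
    then have M0: "M = 0" "t * (t - 1) \<le> 2 * card (ind E T)" and eqH: "2 * card H + deficit k m = 2 * k * m"
      using count cT fs by linarith+
    have univ: "\<forall>u\<in>T. \<forall>v\<in>V. u \<noteq> v \<longrightarrow> {u, v} \<in> E" using universal[OF M0] by blast
    have "Graph W H \<simeq>\<^sub>g complete_graph k \<or>\<^sub>g graph_compl (complete_graph (m - k))"
      if def: "deficit k m = k * (k + 1)" and v: "v \<in> W" "a t \<le> card (nb H W v)" for v
    proof -
      obtain C where C: "C \<in> \<C>" "v \<in> C" using \<C> v(1) unfolding components_def by blast
      have CW: "C \<subseteq> W" by (rule comp(1)[OF C(1)])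
      have finC: "finite C" using CW finW by (rule finite_subset)
      have "nb H W v \<subseteq> nb H C v" using comp(4)[OF C(1,2)] by (auto simp: nb_def)
      then have "card (nb H W v) \<le> card (nb H C v)" using finC by (intro card_mono) auto
      then have vC: "a t \<le> card (nb H C v)" using v(2) by simp
      have "nb H C v \<subseteq> C - {v}" using nb_self[OF sH] by (auto simp: nb_def)
      then have "card (nb H C v) \<le> card (C - {v})" using finC by (intro card_mono) auto
      \<comment> \<open>As a_t \<ge> 2k+1, the vertex \<open>v\<close> and its neighbours make the
        component too large for the case \<open>small\<close>.\<close>
      then have cC: "2 * k + 2 \<le> card C" using vC False C(2) finC by simp
      have sC: "sgr C (ind H C)" and sD: "sgr (W - C) (ind H (W - C))" using sgr_ind[OF sH] CW by auto
      have "conn (ind H C) C" using comp(2)[OF C(1)] by (simp add: conn_ind)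
      have "degenerate (ind H C) C k"
        using sC \<open>conn (ind H C) C\<close> pfree_subset[OF freeH ind_subset]
      proof (cases rule: conn_deficit_cases)
        case small
        then show ?thesis using cC by simp
      next
        \<comment> \<open>The strict inequality, added to the bound for the rest of
          \<open>H\<close>, contradicts the equality \<open>eqH\<close>.\<close>
        case pendant
        have "2 * card (ind H (W - C)) + deficit k (card (W - C)) \<le> 2 * k * card (W - C)"
          by (rule pfree_edges[OF sD pfree_subset[OF freeH ind_subset]])
        moreover have WC: "C \<union> (W - C) = W" using CW by auto
        have c: "card W = card C + card (W - C)"
          using finC finW CW card_mono[OF finW CW] by (simp add: card_Diff_subset)
        have "card (ind H (C \<union> (W - C))) = card (ind H C) + card (ind H (W - C))"
          by (rule card_ind_Un_separated[OF sH finC]) (use finW comp(4)[OF C(1)] in auto)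
        then have "card H = card (ind H C) + card (ind H (W - C))"
          unfolding WC ind_self[OF sH] .
        moreover have "deficit k m \<le> deficit k (card C) + deficit k (card (W - C))"
          using deficit_add[of k "card C" "card (W - C)"] c cW by simp
        moreover have "2 * k * m = 2 * k * card C + 2 * k * card (W - C)"
          using c cW by (simp add: distrib_left[symmetric])
        ultimately show ?thesis using pendant(2) eqH by linarith
      qed
      then show ?thesis using join_case[OF C(1) cC] vC C(2) by blast
    qed
    then have "(deficit k m = k * (k + 1) \<longrightarrow> (\<forall>v\<in>W. card (nb H W v) < a t) \<or>
          Graph W H \<simeq>\<^sub>g complete_graph k \<or>\<^sub>g graph_compl (complete_graph (m - k)))"
      by (meson not_le)
    then show ?thesis unfolding W_def[symmetric] H_def[symmetric]
      using univ freeH eqH False by simp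
  qed
qed

theorem theorem1p8:
  fixes t k :: nat and a :: "nat \<Rightarrow> nat"
  assumes "t \<ge> 1" and "k \<ge> 1"
    and "\<And>i j. 1 \<le> i \<Longrightarrow> i \<le> j \<Longrightarrow> j \<le> t \<Longrightarrow> a i \<ge> a j"
    and "a t \<ge> 3"
  shows "\<exists>n0. \<forall>n\<ge>n0. \<forall>G \<in> ex_graphs n (star_forest t a \<union>\<^sub>g path_graph (2 * k + 2)).
    G \<in> ex_graphs n (star_forest t a) \<or>
    (\<exists>H :: nat graph. simple_graph H \<and> card (verts H) = n - t \<and>
       G \<simeq>\<^sub>g complete_graph t \<or>\<^sub>g H \<and>
       (a t \<le> 2 * k \<longrightarrow>
          H \<simeq>\<^sub>g complete_graph k \<or>\<^sub>g graph_compl (complete_graph (n - t - k))) \<and>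
       (a t \<ge> 2 * k + 1 \<longrightarrow>
          H \<in> ex_graphs (n - t) (path_graph (2 * k + 2)) \<and>
          ([n - t = k] (mod (2 * k + 1)) \<or> [n - t = k + 1] (mod (2 * k + 1)) \<longrightarrow>
             H \<simeq>\<^sub>g complete_graph k \<or>\<^sub>g graph_compl (complete_graph (n - t - k)) \<or>
             max_degree H \<le> a t - 1)))"
proof -
  define s where "s = (\<Sum>j\<in>{1..t}. a j + 1)"
  \<comment> \<open>A hub of degree \<open>D\<close> has room for all stars with their centres,
    \<open>s\<close> vertices in total, besides a path on 2k+2 vertices.\<close>
  define D where "D = s + (2 * k + 2)"
  define q where "q = (t + k) * (t + k + 1)"
  define m0 where "m0 = (2 * k + 1) * (2 * (k * (k + 1)) + 2)"
  \<comment> \<open>The terms \<open>2 * s * D + q\<close> with the final 1 serve to find the hubs,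
    \<open>t + k\<close> makes room for K_{t+k}, and \<open>t + m0\<close> makes n - t large enough
    for \<open>many_cliques\<close>.\<close>
  define n0 where "n0 = 2 * s * D + q + t + k + m0 + 1"
  define F where "F = star_forest t a \<union>\<^sub>g path_graph (2 * k + 2)"
  have at: "a t \<le> a i" "1 \<le> a i" if "i \<in> {1..t}" for i
    using assms(3)[of i t] assms(4) that by auto
  have F_iff: "graph_free F G \<longleftrightarrow> forest_free (edges G) t a (2 * k + 2)" if "simple_graph G" for G :: "nat graph"
    unfolding F_def forest_free_def using at(2) by (intro graph_free_star_forest_path_iff[OF that]) auto
  have S_iff: "graph_free (star_forest t a) G \<longleftrightarrow> \<not> (\<exists>c L. star_system (edges G) {1..t} a c L)"
    if "simple_graph G" for G :: "nat graph"
    using at(2) by (rule graph_free_star_forest_iff[OF that])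
  have "G \<in> ex_graphs n (star_forest t a) \<or>
    (\<exists>H :: nat graph. simple_graph H \<and> card (verts H) = n - t \<and>
       G \<simeq>\<^sub>g complete_graph t \<or>\<^sub>g H \<and>
       (a t \<le> 2 * k \<longrightarrow>
          H \<simeq>\<^sub>g complete_graph k \<or>\<^sub>g graph_compl (complete_graph (n - t - k))) \<and>
       (a t \<ge> 2 * k + 1 \<longrightarrow>
          H \<in> ex_graphs (n - t) (path_graph (2 * k + 2)) \<and>
          ([n - t = k] (mod (2 * k + 1)) \<or> [n - t = k + 1] (mod (2 * k + 1)) \<longrightarrow>
             H \<simeq>\<^sub>g complete_graph k \<or>\<^sub>g graph_compl (complete_graph (n - t - k)) \<or>
             max_degree H \<le> a t - 1)))"
    if n: "n \<ge> n0" and G: "G \<in> ex_graphs n F" for n and G :: "nat graph"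
  proof (cases "graph_free (star_forest t a) G")
    \<comment> \<open>Graphs without the star forest are in particular F-free, so \<open>G\<close>,
      which is extremal in the larger class, is extremal in the smaller one.\<close>
    case True
    have "card (edges G') \<le> card (edges G)"
      if "simple_graph G'" "card (verts G') = n" "graph_free (star_forest t a) G'" for G' :: "nat graph"
    proof -
      have "graph_free F G'" using that(1,3) unfolding S_iff[OF that(1)] F_iff[OF that(1)] forest_free_def by blast
      then show ?thesis using G that(1,2) unfolding ex_graphs_def by blast
    qed
    then have "G \<in> ex_graphs n (star_forest t a)" using G True unfolding ex_graphs_def by blast
    then show ?thesis ..
  next
    case False
    define V where "V = verts G"
    define E where "E = edges G"
    define m where "m = n - t"
    have simple: "simple_graph G" and cV: "card V = n" and freeG: "graph_free F G"
      and ext: "\<And>G' :: nat graph. simple_graph G' \<Longrightarrow> card (verts G') = n \<Longrightarrow> graph_free F G' \<Longrightarrow>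
        card (edges G') \<le> card E"
      using G unfolding ex_graphs_def V_def E_def by blast+
    have sgr: "sgr V E" using simple unfolding V_def E_def simple_graph_iff_sgr .
    have GE: "Graph V E = G" by (simp add: V_def E_def)
    have free: "forest_free E t a (2 * k + 2)" using freeG F_iff[OF simple] by (simp add: E_def)
    obtain c L where S: "star_system E {1..t} a c L"
      using False S_iff[OF simple] unfolding E_def by blast
    have nt: "t + k \<le> n" "n = t + m" "m0 \<le> m" using n by (auto simp: n0_def m_def)
    have edges: "2 * (t + k) * n \<le> 2 * card E + q"
    proof -
      obtain G1 :: "nat graph" where "simple_graph G1" "card (verts G1) = n" "graph_free F G1"
        "2 * card (edges G1) + q = 2 * (t + k) * n"
        by (rule ex_split_join_graph[OF nt(1) at(2)])
          (assumption, rule that, simp_all only: F_def q_def)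
      then show ?thesis using ext[of G1] by linarith
    qed
    obtain T where T: "T \<subseteq> V" "card T = t" "\<And>v. v \<in> T \<Longrightarrow> D \<le> card (nb E V v)"
    proof (rule ex_hubs[OF sgr S assms(1) at(2)])
      show "length xs \<noteq> 2 * k + 2" if "gpath E xs" "star_verts {1..t} c L \<inter> set xs = {}" for xs
        by (rule forest_freeD[OF free S that])
      show "2 * (t + k) * card V \<le> 2 * card E + q" using edges cV by simp
      show "2 * (\<Sum>j\<in>{1..t}. a j + 1) * D + q < 2 * card V"
        unfolding s_def[symmetric] cV using n by (simp add: n0_def)
    qed (assumption, rule that)
    have finT: "finite T" using T(1) sgr_finite_verts[OF sgr] by (rule finite_subset)
    have cW: "card (V - T) = m" using finT T(1,2) cV by (simp add: card_Diff_subset m_def)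
    have split: "a t \<le> 2 * k \<or> 2 * card E + deficit k m \<ge> t * (t - 1) + 2 * t * m + 2 * k * m"
    proof (cases "a t \<le> 2 * k")
      case False
      \<comment> \<open>Since \<open>a t\<close> is the smallest value, all stars are too large for
        the cliques of the comparison graph.\<close>
      then have "2 * k + 1 \<le> a i" if "i \<in> {1..t}" for i using at(1)[OF that] by simp
      then obtain G2 :: "nat graph" where "simple_graph G2" "card (verts G2) = t + m" "graph_free F G2"
        "2 * card (edges G2) + deficit k m = t * (t - 1) + 2 * t * m + 2 * k * m"
        by (rule ex_clique_join_graph)
          (assumption, rule that, simp_all only: F_def)
      then show ?thesis using ext[of G2] nt(2) by linarith
    qed simp
    have edges': "t * (t - 1) + 2 * t * m + 2 * k * m \<le> 2 * card E + k * (k + 1)"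
      using edges edge_bound_identity[of t m k] unfolding q_def nt(2) by linarith
    have at1: "1 \<le> a t" using assms(4) by simp
    have big: "(2 * k + 1) * (2 * (k * (k + 1)) + 2) \<le> m" using nt(3) by (simp only: m0_def)
    define W where "W = V - T"
    define H where "H = Graph W (ind E W)"
    have deg: "(\<Sum>j\<in>{1..t}. a j + 1) + (2 * k + 2) \<le> card (nb E V v)" if "v \<in> T" for v
      using T(3)[OF that] by (simp only: D_def s_def)
    have R: "\<forall>u\<in>T. \<forall>v\<in>V. u \<noteq> v \<longrightarrow> {u, v} \<in> E" "pfree (ind E W) (2 * k + 2)"
      "a t \<le> 2 * k \<longrightarrow> H \<simeq>\<^sub>g complete_graph k \<or>\<^sub>g graph_compl (complete_graph (m - k))"
      "2 * k + 1 \<le> a t \<longrightarrow> 2 * card (ind E W) + deficit k m = 2 * k * m \<and>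
        (deficit k m = k * (k + 1) \<longrightarrow> (\<forall>v\<in>W. card (nb (ind E W) W v) < a t) \<or>
          H \<simeq>\<^sub>g complete_graph k \<or>\<^sub>g graph_compl (complete_graph (m - k)))"
      using hub_graph_structure[OF sgr free T(1,2) assms(1,2) at1 deg cW edges' big split]
      unfolding W_def[symmetric] H_def[symmetric] by blast+
    have sW: "sgr W (ind E W)" using sgr_ind[OF sgr, of W] by (auto simp: W_def)
    have simpleH: "simple_graph H" using sW by (simp add: simple_graph_iff_sgr H_def)
    have cH: "card (verts H) = n - t" using cW by (simp add: H_def W_def m_def)
    have iso: "G \<simeq>\<^sub>g complete_graph t \<or>\<^sub>g H"
      using universal_join[OF sgr T(1) _ graph_iso_refl] R(1) unfolding GE H_def W_def T(2) by blast
    have pathH: "graph_free (path_graph (2 * k + 2)) H"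
      using R(2) graph_free_path_iff[OF simpleH, of "2 * k + 2"] by (simp add: H_def)
    \<comment> \<open>Here \<open>H\<close> attains the bound of \<open>pfree_edges\<close> with
      equality.\<close>
    have exH: "H \<in> ex_graphs (n - t) (path_graph (2 * k + 2))" if "2 * k + 1 \<le> a t"
    proof -
      have "card (edges G') \<le> card (edges H)"
        if "simple_graph G'" "card (verts G') = n - t" "graph_free (path_graph (2 * k + 2)) G'"
        for G' :: "nat graph"
      proof -
        have "pfree (edges G') (2 * k + 2)" using that(3) graph_free_path_iff[OF that(1)] by simp
        then have "2 * card (edges G') + deficit k m \<le> 2 * k * m"
          using pfree_edges[OF that(1)[unfolded simple_graph_iff_sgr]] that(2) by (simp add: m_def)
        then show ?thesis using R(4) \<open>2 * k + 1 \<le> a t\<close> by (simp add: H_def)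
      qed
      then show ?thesis using simpleH cH pathH unfolding ex_graphs_def by blast
    qed
    have resid: "deficit k m = k * (k + 1)"
      if "[n - t = k] (mod (2 * k + 1)) \<or> [n - t = k + 1] (mod (2 * k + 1))"
    proof -
      \<comment> \<open>Because k \<ge> 1, the number k + 1 is below the modulus and is its own
        residue.\<close>
      have "m mod (2 * k + 1) = k \<or> m mod (2 * k + 1) = k + 1"
        using that assms(2) by (auto simp: cong_def m_def)
      then show ?thesis by (auto simp: deficit_def)
    qed
    have maxdeg: "max_degree H \<le> a t - 1" if "\<forall>v\<in>W. card (nb (ind E W) W v) < a t"
    proof -
      \<comment> \<open>A nonempty \<open>W\<close> is needed for the maximum in
        \<open>max_degree\<close> to be meaningful.\<close>
      have "0 < card W" using cW big by (simp add: W_def)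
      then have "finite W" "W \<noteq> {}" by (auto simp: card_gt_0_iff)
      moreover have "degree H v \<le> a t - 1" if "v \<in> W" for v
        using \<open>\<forall>v\<in>W. card (nb (ind E W) W v) < a t\<close> that
        unfolding H_def degree_eq_card_nb[OF sW] by fastforce
      ultimately show ?thesis by (simp add: max_degree_def H_def)
    qed
    show ?thesis
    proof (rule disjI2, rule exI[of _ H], intro conjI impI)
      assume "2 * k + 1 \<le> a t"
        "[n - t = k] (mod (2 * k + 1)) \<or> [n - t = k + 1] (mod (2 * k + 1))"
      then show "H \<simeq>\<^sub>g complete_graph k \<or>\<^sub>g graph_compl (complete_graph (n - t - k)) \<or> max_degree H \<le> a t - 1"
        using R(4) resid maxdeg unfolding m_def by blast
    qed (use simpleH cH iso R(3) exH in \<open>auto simp: m_def\<close>)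
  qed
  then show ?thesis unfolding F_def by blast
qed

end
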